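(* Let $r>0$, let $f_0:(\mathbb K^n,0)\to(\mathbb K^k,0)$ be analytic, and consider the family obtained by perturbing $f_0$ by all homogeneous terms of degree $r$: $$f_u(x)=f_0(x)+\sum_{|\omega|=r,\ 1\le i\le k}u^i_\omega x^\omega e_i,\qquad u=(u^i_\omega)\in\mathbb K^c,$$ where $e_i$ is the $i$-th standard basis vector of $\mathbb K^k$ and $c$ is the number of pairs $(\omega,i)$. Then for any $u_0\in\mathbb K^c$, $W$ (respectively $X$) is $(t^r)$ for $\Gamma(f_{u_0})$ if and only if the germ at $u_0$ of the family $\Gamma(f_u)$ has Verdier equisingular intersection with $W$ (respectively $X$).
   Context: $\mathbb K$ is $\mathbb R$ or $\mathbb C$. $\mathbb K^{n+k}=\mathbb K^n\times\mathbb K^k$ has coordinates $(x_1,\dots,x_n,y_1,\dots,y_k)$ and $Y=\{0\}\times\mathbb K^k$. $F:(\mathbb K^{n+k},0)\to(\mathbb K^p,0)$ is an analytic map germ, $X=F^{-1}(0)$, $e$ is the codimension of $X\setminus Y$, $W$ is the Zariski open subset of $X\setminus Y$ where $F$ has rank $e$ (a smooth submanifold), $S=X\setminus W$, and $W$ is assumed dense in $X\setminus Y$ in the metric topology. $(t^r)$ for $r\ge1$. Let $P=\Gamma(f)$ be the graph of an analytic $f:(\mathbb K^n,0)\to(\mathbb K^k,0)$. Graphs of two $C^r$ map germs vanishing at $0$ satisfy $j^rP=j^rQ$ if the maps have the same $r$-jet at $0$. If $\mathbb K=\mathbb C$, $\mathbb C^n,\mathbb C^k$ are regarded as real spaces and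 the graphs $Q$ are graphs of real $C^r$ maps. $W$ is $(t^r)$ for $P$ if every $Q$ with $j^rQ=j^rP$ is transverse to $W$ at all points near (but not necessarily at) $0$. $X$ is $(t^r)$ for $P$ if in addition every such $Q$ satisfies $Q\cap S=\{0\}$ as germs at $0$. Verdier equisingular intersection. For the family $f_u$, $u\in\mathbb K^c$ (with $f_u(0)=0$), put $f(x,u)=f_u(x)$, $\beta(x,u)=(x,f(x,u))$, $\tilde X=\beta^{-1}(X)$, $\tilde S=\beta^{-1}(S)$, $\tilde W=\beta^{-1}(W)$, $\tilde Y=\{0\}\times\mathbb K^c$, all as germs at $(0,u_0)$. For linear subspaces $A,B$ of a Euclidean/Hermitian space, $\operatorname{dist}(A,B)=\sup\tan\arcsin\frac{|(u,v)|}{\|u\|\|v\|}$ over nonzero $u\in B^\perp$, $v\in A$. $\tilde W$ is $(w)$ regular over $\tilde Y$ at a point of $\tilde Y$ if it is a smooth submanifold near that point and there is $C>0$ with $\operatorname{dist}(\{0\}\times\mathbb K^c,T_w\tilde W)\le C|x|$ for all $w=(x,u)\in\tilde W$ near that point; $\tilde X$ is $(w)$ regular over $\tilde Y$ at a point if $\tilde W$ is and the germ of $\tilde S$ there is contained in $\tilde Y$. The germ at $u_0$ of the family $\Gamma(f_u)$ has Verdier equisingular intersection with $W$ (resp. $X$) if $\tilde W$ (resp. $\tilde X$) is $(w)$ regular over $\tilde Y$ at each point of $\tilde Y$ near $(0,u_0)$. *)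

theory Defs
  imports "HOL-Analysis.Analysis"
begin

section \<open>The ground field\<close>

text \<open>
  The class of normed fields that are, via a conjugation-preserving isometric embedding into
  the complex numbers, either the real or the complex field. It provides one notation for both
  cases; \<open>conjugate\<close> is the identity on the reals.
\<close>

class real_or_complex = real_normed_field + euclidean_space +
  fixes conjugate :: "'a \<Rightarrow> 'a"
  assumes embedding_ex:
    "\<exists>\<phi> :: 'a \<Rightarrow> complex.
       (\<forall>x y. \<phi> (x + y) = \<phi> x + \<phi> y) \<and> (\<forall>x y. \<phi> (x * y) = \<phi> x * \<phi> y) \<and> \<phi> 1 = 1 \<and>
       (\<forall>x. cmod (\<phi> x) = norm x) \<and> (\<forall>x. \<phi> (conjugate x) = cnj (\<phi> x)) \<and>
       (range \<phi> = \<real> \<or> range \<phi> = UNIV)"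

instantiation real :: real_or_complex
begin
definition conjugate_real :: "real \<Rightarrow> real" where "conjugate_real x = x"
instance
  by standard
    (rule exI[of _ complex_of_real], auto simp: conjugate_real_def Reals_def)
end

instantiation complex :: real_or_complex
begin
definition conjugate_complex :: "complex \<Rightarrow> complex" where "conjugate_complex = cnj"
instance
  by standard (rule exI[of _ id], auto simp: conjugate_complex_def)
end

section \<open>Product coordinates, analytic maps, submanifolds\<close>

text \<open>The product of two coordinate spaces is the coordinate space over the sum of the index types.\<close>

definition pair_vec :: "'a^'m::finite \<Rightarrow> 'a^'l::finite \<Rightarrow> 'a^('m + 'l)" where
  "pair_vec x y = (\<chi> i. case i of Inl j \<Rightarrow> x $ j | Inr j \<Rightarrow> y $ j)"

definition fst_vec :: "'a^('m::finite + 'l::finite) \<Rightarrow> 'a^'m" where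
  "fst_vec z = (\<chi> j. z $ Inl j)"

definition snd_vec :: "'a^('m::finite + 'l::finite) \<Rightarrow> 'a^'l" where
  "snd_vec z = (\<chi> j. z $ Inr j)"

definition vertical :: "('a::zero^('m::finite + 'l::finite)) set" where
  "vertical = {pair_vec 0 y | y. True}"

definition graph_of :: "('a^'n::finite \<Rightarrow> 'a^'k::finite) \<Rightarrow> ('a^('n + 'k)) set" where
  "graph_of f = {pair_vec x (f x) | x. True}"

definition monom_vec :: "'a::comm_monoid_mult^'m \<Rightarrow> ('m \<Rightarrow> nat) \<Rightarrow> 'a" where
  "monom_vec x \<omega> = (\<Prod>i\<in>UNIV. (x $ i) ^ \<omega> i)"

definition analytic_near :: "('a::real_or_complex^'m \<Rightarrow> 'a^'l) \<Rightarrow> 'a^'m \<Rightarrow> bool" where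
  "analytic_near f a \<longleftrightarrow>
     (\<exists>c. \<exists>\<delta>>0. \<forall>h. norm h < \<delta> \<longrightarrow>
        ((\<lambda>\<omega> :: 'm \<Rightarrow> nat. monom_vec h \<omega> *s c \<omega>) has_sum f (a + h)) UNIV)"

text \<open>Local flattening of \<open>M\<close> at \<open>p\<close> to a \<open>\<K>\<close>-linear subspace of dimension \<open>d\<close> (over \<open>\<K>\<close>)
  by an analytic diffeomorphism.\<close>

definition submanifold_at :: "nat \<Rightarrow> ('a::real_or_complex^'m) set \<Rightarrow> 'a^'m \<Rightarrow> bool" where
  "submanifold_at d M p \<longleftrightarrow>
     (\<exists>U V (\<phi> :: 'a^'m \<Rightarrow> 'a^'m) \<psi> L. open U \<and> p \<in> U \<and> open V \<and> homeomorphism U V \<phi> \<psi> \<and>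
        (\<forall>z\<in>U. analytic_near \<phi> z) \<and> (\<forall>z\<in>V. analytic_near \<psi> z) \<and>
        vec.subspace L \<and> vec.dim L = d \<and> \<phi> ` (M \<inter> U) = V \<inter> L)"

definition smooth_submanifold_near :: "('a::real_or_complex^'m) set \<Rightarrow> 'a^'m \<Rightarrow> bool" where
  "smooth_submanifold_near M a \<longleftrightarrow>
     (\<forall>\<^sub>F p in nhds a. p \<in> M \<longrightarrow> (\<exists>d. submanifold_at d M p))"

text \<open>The set of velocities at \<open>p\<close> of real curves in \<open>M\<close>. If \<open>M\<close> is a (real or complex) submanifold,
  this is its tangent space, regarded as a subset of the ambient vector space.\<close>

definition tangent_space :: "('v::real_normed_vector) set \<Rightarrow> 'v \<Rightarrow> 'v set" where
  "tangent_space M p =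
     {v. \<exists>\<gamma> :: real \<Rightarrow> 'v. \<gamma> 0 = p \<and> (\<forall>\<^sub>F t in nhds 0. \<gamma> t \<in> M) \<and>
                   (\<gamma> has_vector_derivative v) (at 0)}"

definition transverse_at :: "('v::real_normed_vector) set \<Rightarrow> 'v set \<Rightarrow> 'v \<Rightarrow> bool" where
  "transverse_at Q W q \<longleftrightarrow>
     (q \<in> Q \<inter> W \<longrightarrow> {a + b | a b. a \<in> tangent_space Q q \<and> b \<in> tangent_space W q} = UNIV)"

section \<open>The sets X, W, S\<close>

definition zero_locus :: "('a::zero^'m \<Rightarrow> 'a^'p) \<Rightarrow> ('a^'m) set" where
  "zero_locus F = {z. F z = 0}"

text \<open>The dimension of the germ at 0 of \<open>A\<close> is the largest dimension of nonempty submanifolds contained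
  in \<open>A\<close> arbitrarily near 0. The empty germ gets dimension 0, as \<open>Sup {} = 0\<close> on the naturals.\<close>

definition germ_codim :: "('a::real_or_complex^'m) set \<Rightarrow> nat" where
  "germ_codim A = CARD('m) -
     Sup {d. \<forall>\<epsilon>>0. \<exists>M. M \<noteq> {} \<and> M \<subseteq> A \<inter> ball 0 \<epsilon> \<and> (\<forall>p\<in>M. submanifold_at d M p)}"

definition rank_at :: "('a::real_or_complex^'m \<Rightarrow> 'a^'p) \<Rightarrow> 'a^'m \<Rightarrow> nat" where
  "rank_at F z = rank (matrix (frechet_derivative F (at z)))"

definition regular_part ::
    "('a::real_or_complex^('n::finite + 'k::finite) \<Rightarrow> 'a^'p) \<Rightarrow> ('a^('n + 'k)) set" where
  "regular_part F =
     {z \<in> zero_locus F - vertical. rank_at F z = germ_codim (zero_locus F - vertical)}"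

section \<open>Jets and jet transversality\<close>

primrec iter_deriv ::
    "('v::real_normed_vector \<Rightarrow> 'w::real_normed_vector) \<Rightarrow> 'v list \<Rightarrow> 'v \<Rightarrow> 'w" where
  "iter_deriv f [] = f"
| "iter_deriv f (v # vs) = (\<lambda>x. frechet_derivative (iter_deriv f vs) (at x) v)"

text \<open>Differentiability is over the reals, also when the ground field is complex.\<close>

definition Cr_near ::
    "nat \<Rightarrow> ('v::real_normed_vector \<Rightarrow> 'w::real_normed_vector) \<Rightarrow> 'v \<Rightarrow> bool" where
  "Cr_near r f a \<longleftrightarrow>
     (\<exists>U. open U \<and> a \<in> U \<and>
        (\<forall>vs. length vs < r \<longrightarrow> (\<forall>x\<in>U. iter_deriv f vs differentiable (at x))) \<and>
        (\<forall>vs. length vs \<le> r \<longrightarrow> continuous_on U (iter_deriv f vs)))"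

definition same_jet ::
    "nat \<Rightarrow> ('v::real_normed_vector \<Rightarrow> 'w::real_normed_vector) \<Rightarrow> ('v \<Rightarrow> 'w) \<Rightarrow> 'v \<Rightarrow> bool" where
  "same_jet r f g a \<longleftrightarrow> (\<forall>vs. length vs \<le> r \<longrightarrow> iter_deriv f vs a = iter_deriv g vs a)"

definition jet_competitor ::
    "nat \<Rightarrow> ('v::real_normed_vector \<Rightarrow> 'w::real_normed_vector) \<Rightarrow> ('v \<Rightarrow> 'w) \<Rightarrow> bool" where
  "jet_competitor r f g \<longleftrightarrow> Cr_near r g 0 \<and> g 0 = 0 \<and> same_jet r f g 0"

definition tr_W ::
    "nat \<Rightarrow> ('a::real_or_complex^('n::finite + 'k::finite)) set \<Rightarrow> ('a^'n \<Rightarrow> 'a^'k) \<Rightarrow> bool" where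
  "tr_W r W f \<longleftrightarrow>
     (\<forall>g. jet_competitor r f g \<longrightarrow> (\<forall>\<^sub>F q in at 0. transverse_at (graph_of g) W q))"

definition tr_X ::
    "nat \<Rightarrow> ('a::real_or_complex^('n::finite + 'k::finite)) set \<Rightarrow> ('a^('n + 'k)) set \<Rightarrow>
     ('a^'n \<Rightarrow> 'a^'k) \<Rightarrow> bool" where
  "tr_X r X W f \<longleftrightarrow> tr_W r W f \<and>
     (\<forall>g. jet_competitor r f g \<longrightarrow> (\<forall>\<^sub>F q in nhds 0. q \<in> graph_of g \<inter> (X - W) \<longleftrightarrow> q = 0))"

section \<open>Verdier equisingular intersection\<close>

definition herm :: "'a::real_or_complex^'m \<Rightarrow> 'a^'m \<Rightarrow> 'a" where
  "herm u v = (\<Sum>i\<in>UNIV. u $ i * conjugate (v $ i))"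

definition herm_compl :: "('a::real_or_complex^'m) set \<Rightarrow> ('a^'m) set" where
  "herm_compl B = {u. \<forall>v\<in>B. herm u v = 0}"

text \<open>In HOL \<open>tan (pi / 2) = 0\<close>, so the value at \<open>1\<close> has to be set to infinity explicitly.\<close>

definition tan_arcsin :: "real \<Rightarrow> ereal" where
  "tan_arcsin t = (if t < 1 then ereal (tan (arcsin t)) else \<infinity>)"

text \<open>Inserting \<open>0\<close> only matters if there are no nonzero vectors to test, where \<open>Sup {} = -\<infinity>\<close>.\<close>

definition subspace_dist :: "('a::real_or_complex^'m) set \<Rightarrow> ('a^'m) set \<Rightarrow> ereal" where
  "subspace_dist A B = Sup (insert 0
     {tan_arcsin (norm (herm u v) / (norm u * norm v)) | u v.
        u \<in> herm_compl B \<and> u \<noteq> 0 \<and> v \<in> A \<and> v \<noteq> 0})"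

definition w_regular_W ::
    "('a::real_or_complex^('n::finite + 'c::finite)) set \<Rightarrow> 'a^('n + 'c) \<Rightarrow> bool" where
  "w_regular_W W a \<longleftrightarrow> smooth_submanifold_near W a \<and>
     (\<exists>C>0. \<forall>\<^sub>F w in nhds a. w \<in> W \<longrightarrow>
        subspace_dist vertical (tangent_space W w) \<le> ereal (C * norm (fst_vec w)))"

definition w_regular_X ::
    "('a::real_or_complex^('n::finite + 'c::finite)) set \<Rightarrow> ('a^('n + 'c)) set \<Rightarrow> 'a^('n + 'c) \<Rightarrow> bool" where
  "w_regular_X W S a \<longleftrightarrow> w_regular_W W a \<and> (\<forall>\<^sub>F z in nhds a. z \<in> S \<longrightarrow> z \<in> vertical)"

definition family_map ::
    "('a^'c::finite \<Rightarrow> 'a^'n::finite \<Rightarrow> 'a^'k::finite) \<Rightarrow> 'a^('n + 'c) \<Rightarrow> 'a^('n + 'k)" where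
  "family_map f z = pair_vec (fst_vec z) (f (snd_vec z) (fst_vec z))"

definition verdier_equisingular_W ::
    "('a::real_or_complex^('n::finite + 'k::finite)) set \<Rightarrow> ('a^'c::finite \<Rightarrow> 'a^'n \<Rightarrow> 'a^'k) \<Rightarrow>
     'a^'c \<Rightarrow> bool" where
  "verdier_equisingular_W W f u\<^sub>0 \<longleftrightarrow>
     (\<forall>\<^sub>F a in nhds (pair_vec 0 u\<^sub>0). a \<in> vertical \<longrightarrow> w_regular_W (family_map f -` W) a)"

definition verdier_equisingular_X ::
    "('a::real_or_complex^('n::finite + 'k::finite)) set \<Rightarrow> ('a^('n + 'k)) set \<Rightarrow>
     ('a^'c::finite \<Rightarrow> 'a^'n \<Rightarrow> 'a^'k) \<Rightarrow> 'a^'c \<Rightarrow> bool" where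
  "verdier_equisingular_X X W f u\<^sub>0 \<longleftrightarrow>
     (\<forall>\<^sub>F a in nhds (pair_vec 0 u\<^sub>0). a \<in> vertical \<longrightarrow>
        w_regular_X (family_map f -` W) (family_map f -` (X - W)) a)"

text \<open>The coordinates of the parameter are labelled by pairs of a multi-index and a component
  through \<open>\<iota>\<close>, which the theorem assumes to enumerate all pairs with multi-index of degree \<open>r\<close>.\<close>

definition degree_pairs :: "nat \<Rightarrow> (('n::finite \<Rightarrow> nat) \<times> 'k) set" where
  "degree_pairs r = {(\<omega>, i). (\<Sum>j\<in>UNIV. \<omega> j) = r}"

definition perturbed_family ::
    "('a::real_or_complex^'n \<Rightarrow> 'a^'k) \<Rightarrow> ('c \<Rightarrow> ('n \<Rightarrow> nat) \<times> 'k) \<Rightarrow> 'a^'c::finite \<Rightarrow> 'a^'n \<Rightarrow> 'a^'k" where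
  "perturbed_family f\<^sub>0 \<iota> u x =
     f\<^sub>0 x + (\<Sum>j\<in>UNIV. (u $ j * monom_vec x (fst (\<iota> j))) *s axis (snd (\<iota> j)) 1)"

end

theory Submission
  imports Defs
begin

text \<open>
  Put \<open>\<beta>(x, u) = (x, f\<^sub>u(x))\<close>. Off \<open>x = 0\<close> it is a submersion, the derivative in \<open>u\<close> being onto
  with a right inverse of norm \<open>O(\<bar>x\<bar>\<^sup>-\<^sup>r)\<close>. Hence \<open>\<beta>\<^sup>-\<^sup>1(W)\<close> is smooth there, and its normal vectors
  are \<open>\<nu> = (\<xi> + f\<^sub>u'(x)\<^sup>*\<eta>, h(x)\<^sup>*\<eta>)\<close> for the normal vectors \<open>(\<xi>, \<eta>)\<close> of \<open>W\<close>, where \<open>h(x)\<close> is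
  the derivative in \<open>u\<close>. As \<open>\<bar>h(x)\<^sup>*\<eta>\<bar>\<close> is comparable to \<open>\<bar>x\<bar>\<^sup>r\<bar>\<eta>\<bar>\<close>, condition (w) says
  \<open>\<bar>\<eta>\<bar>\<bar>x\<bar>\<^sup>r\<^sup>-\<^sup>1 \<le> C\<bar>\<xi> + f\<^sub>u'(x)\<^sup>*\<eta>\<bar>\<close>.

  A competitor \<open>g\<close> agrees at \<open>x\<close> with some \<open>f\<^sub>u\<close>, \<open>u \<rightarrow> u\<^sub>0\<close>, and the derivatives of \<open>g\<close> and \<open>f\<^sub>u\<close> at
  \<open>x\<close> differ by \<open>o(\<bar>x\<bar>\<^sup>r\<^sup>-\<^sup>1)\<close>, so a point of non-transversality, \<open>\<xi> + g'(x)\<^sup>*\<eta> = 0\<close>, violates (w).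
  Conversely, if (w) fails along a sequence, small bumps at rapidly decreasing scales correct
  \<open>f\<close> at the points of the sequence to a competitor which is not transverse to \<open>W\<close> there.
\<close>

section \<open>Power series in several variables\<close>

text \<open>The right inverse of h(x) divides by x_m^r for the coordinate x_m of largest modulus,
  where |x_m| \<ge> |x|/n; the coefficients of all x_m^r e_i are parameters of the family. The
  exponents match the freedom of a competitor: with the r-jet fixed, values move by o(|x|^r) and
  derivatives by o(|x|^(r-1)). The factor |x|^r of h(x)^* against the factor |x| in (w) leaves the
  same |x|^(r-1). At a point (x, u) violating (w) a bump does two things. Its value (f_u - f)(x),
  with f the map for the parameter \<open>u\<^sub>0\<close>, brings the graph onto W. Its derivative
  is that of f_u - f minus the rank-one map v -> (\<nu>_1, v) \<eta> / |\<eta>|^2, where \<nu>_1 is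
  the x-component of \<nu>; this makes (\<xi>, \<eta>) normal to the new graph. The rank-one map has
  norm at most |\<nu>_1| / |\<eta>|, which failure of (w) makes small against |x|^(r-1). Competitors
  are only real differentiable, yet the same normal vectors serve: tangent spaces of W are linear
  over the ground field, and for such spaces the real and the Hermitian complement agree. The
  condition on S is treated in the same way, prescribing values only.\<close>

definition degree_of :: "('m::finite \<Rightarrow> nat) \<Rightarrow> nat" where
  "degree_of \<omega> = (\<Sum>i\<in>UNIV. \<omega> i)"

definition polydisc :: "real \<Rightarrow> ('a::real_or_complex^'m) set" where
  "polydisc \<rho> = {h. \<forall>i. norm (h $ i) \<le> \<rho>}"

text \<open>\<open>M\<close> bounds the weighted l1 norm of the coefficients at radius
  \<open>\<rho>\<close>. This is a Banach algebra norm, so such bounds add and multiply with the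
  functions, and the coefficients can stay hidden.\<close>

definition powser :: "real \<Rightarrow> real \<Rightarrow> ('a::real_or_complex^'m \<Rightarrow> 'a) \<Rightarrow> bool" where
  "powser \<rho> M f \<longleftrightarrow>
     (\<exists>c S. ((\<lambda>\<omega> :: 'm \<Rightarrow> nat. norm (c \<omega>) * \<rho> ^ degree_of \<omega>) has_sum S) UNIV \<and> S \<le> M \<and>
        (\<forall>h\<in>polydisc \<rho>. ((\<lambda>\<omega>. c \<omega> * monom_vec h \<omega>) has_sum f h) UNIV))"

lemma norm_vec_le_sum:
  fixes x :: "'a::real_normed_vector^'m"
  shows "norm x \<le> (\<Sum>i\<in>UNIV. norm (x $ i))"
  unfolding norm_vec_def by (rule L2_set_le_sum) auto

lemma norm_monom_vec:
  fixes h :: "'a::real_or_complex^'m"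
  shows "norm (monom_vec h \<omega>) = (\<Prod>i\<in>UNIV. norm (h $ i) ^ \<omega> i)"
  by (simp add: monom_vec_def norm_power flip: prod_norm)

lemma norm_monom_vec_le:
  fixes h :: "'a::real_or_complex^'m"
  assumes "\<And>i. norm (h $ i) \<le> \<rho>"
  shows "norm (monom_vec h \<omega>) \<le> \<rho> ^ degree_of \<omega>"
proof -
  have "(\<Prod>i\<in>UNIV. norm (h $ i) ^ \<omega> i) \<le> (\<Prod>i\<in>UNIV. \<rho> ^ \<omega> i)"
    by (intro prod_mono) (use assms in \<open>auto intro: power_mono\<close>)
  then show ?thesis
    by (simp add: norm_monom_vec degree_of_def power_sum)
qed

lemma has_sum_UNIV_superset:
  assumes "(f has_sum x) A" "\<And>y. y \<notin> A \<Longrightarrow> f y = 0"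
  shows "(f has_sum x) UNIV"
  using has_sum_cong_neutral[where S = A and T = UNIV and g = f and f = f and x = x] assms by auto

lemma has_sum_sum:
  fixes f :: "'b \<Rightarrow> 'c \<Rightarrow> 'd::topological_comm_monoid_add"
  assumes "finite B" "\<And>b. b \<in> B \<Longrightarrow> (f b has_sum s b) A"
  shows "((\<lambda>x. \<Sum>b\<in>B. f b x) has_sum (\<Sum>b\<in>B. s b)) A"
  using assms by (induction B rule: finite_induct) (auto intro: has_sum_add)

text \<open>Each coordinate is an unconditionally summable real family, hence absolutely summable,
  and the l1 norm of the coordinates dominates the norm. It turns the plain \<open>has_sum\<close>
  of \<open>analytic_near\<close> into a majorant.\<close>

lemma summable_on_norm_euclidean:
  fixes f :: "'b \<Rightarrow> 'v::euclidean_space"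
  assumes "f summable_on A"
  shows "(\<lambda>x. norm (f x)) summable_on A"
proof -
  have "(\<lambda>x. \<bar>f x \<bullet> b\<bar>) summable_on A" for b
  proof -
    have "(\<lambda>x. f x \<bullet> b) summable_on A"
      using summable_on_bounded_linear[OF bounded_linear_inner_left assms] by (simp add: o_def)
    then show ?thesis
      using summable_on_iff_abs_summable_on_real by fastforce
  qed
  then have "((\<lambda>x. \<bar>f x \<bullet> b\<bar>) has_sum infsum (\<lambda>x. \<bar>f x \<bullet> b\<bar>) A) A" for b
    by simp
  then have "((\<lambda>x. \<Sum>b\<in>Basis. \<bar>f x \<bullet> b\<bar>) has_sum (\<Sum>b\<in>Basis. infsum (\<lambda>x. \<bar>f x \<bullet> b\<bar>) A)) A"
    by (intro has_sum_sum) auto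
  then have "(\<lambda>x. \<Sum>b\<in>Basis. \<bar>f x \<bullet> b\<bar>) summable_on A"
    by (rule has_sum_imp_summable)
  then show ?thesis
    by (rule summable_on_comparison_test) (auto simp: norm_le_l1)
qed

text \<open>Fubini for the double family of coefficients. Products, substitutions and reciprocals
  below are all obtained as such sums of simpler series, so regrouping is justified only
  here.\<close>

lemma powser_has_sum:
  fixes f :: "'b \<Rightarrow> 'a::real_or_complex^'m \<Rightarrow> 'a"
  assumes "\<rho> > 0"
    and f: "\<And>k. k \<in> A \<Longrightarrow> powser \<rho> (M k) (f k)"
    and M: "(M has_sum T) A"
    and g: "\<And>h. h \<in> polydisc \<rho> \<Longrightarrow> ((\<lambda>k. f k h) has_sum g h) A"
  shows "powser \<rho> T g"
proof -
  have "\<forall>k\<in>A. \<exists>c S. ((\<lambda>\<omega>. norm (c \<omega>) * \<rho> ^ degree_of \<omega>) has_sum S) UNIV \<and> S \<le> M k \<and>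
        (\<forall>h\<in>polydisc \<rho>. ((\<lambda>\<omega>. c \<omega> * monom_vec h \<omega>) has_sum f k h) UNIV)"
    using f by (simp only: powser_def) auto
  from bchoice[OF this] obtain c where "\<forall>k\<in>A. \<exists>S. ((\<lambda>\<omega>. norm (c k \<omega>) * \<rho> ^ degree_of \<omega>) has_sum S) UNIV \<and> S \<le> M k \<and>
        (\<forall>h\<in>polydisc \<rho>. ((\<lambda>\<omega>. c k \<omega> * monom_vec h \<omega>) has_sum f k h) UNIV)" ..
  from bchoice[OF this] obtain S where "\<forall>k\<in>A. ((\<lambda>\<omega>. norm (c k \<omega>) * \<rho> ^ degree_of \<omega>) has_sum S k) UNIV \<and> S k \<le> M k \<and>
        (\<forall>h\<in>polydisc \<rho>. ((\<lambda>\<omega>. c k \<omega> * monom_vec h \<omega>) has_sum f k h) UNIV)" ..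
  then have c: "\<And>k. k \<in> A \<Longrightarrow> ((\<lambda>\<omega>. norm (c k \<omega>) * \<rho> ^ degree_of \<omega>) has_sum S k) UNIV"
      "\<And>k. k \<in> A \<Longrightarrow> S k \<le> M k"
      "\<And>k h. \<lbrakk>k \<in> A; h \<in> polydisc \<rho>\<rbrakk> \<Longrightarrow> ((\<lambda>\<omega>. c k \<omega> * monom_vec h \<omega>) has_sum f k h) UNIV"
    by auto
  have S0: "S k \<ge> 0" if "k \<in> A" for k
    by (rule has_sum_nonneg[OF c(1)[OF that]]) (use \<open>\<rho> > 0\<close> in auto)
  have "S summable_on A"
    by (rule summable_on_comparison_test[OF has_sum_imp_summable[OF M]]) (use c(2) S0 in auto)
  then obtain S' where S': "(S has_sum S') A" by (auto simp: summable_on_def)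
  have "S' \<le> T"
    by (rule has_sum_mono[OF S' M]) (use c(2) in auto)
  let ?N = "\<lambda>(k, \<omega>). norm (c k \<omega>) * \<rho> ^ degree_of \<omega>"
  have N: "?N summable_on A \<times> UNIV"
    by (rule summable_on_SigmaI[where g = S]) (use c(1) \<open>S summable_on A\<close> \<open>\<rho> > 0\<close> in auto)
  have N1: "(?N has_sum S') (A \<times> UNIV)"
    by (rule has_sum_SigmaI[where g = S]) (use c(1) S' N in auto)
  \<comment> \<open>The majorants are summable over all pairs, so the order of summation may be
    exchanged and the coefficients collected by multi-index.\<close>
  have N2: "((\<lambda>(\<omega>, k). norm (c k \<omega>) * \<rho> ^ degree_of \<omega>) has_sum S') (UNIV \<times> A)"
    using N1 by (subst (asm) has_sum_swap) (simp add: case_prod_unfold)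
  have Nc: "(\<lambda>k. norm (c k \<omega>) * \<rho> ^ degree_of \<omega>) summable_on A" for \<omega>
    using summable_on_SigmaD1[OF has_sum_imp_summable[OF N2], of \<omega>] by simp
  have nc: "(\<lambda>k. norm (c k \<omega>)) summable_on A" for \<omega>
    using Nc[of \<omega>] \<open>\<rho> > 0\<close> by (subst (asm) summable_on_cmult_left') auto
  then have cs: "(\<lambda>k. c k \<omega>) summable_on A" for \<omega>
    by (rule abs_summable_summable)
  define d where "d \<omega> = infsum (\<lambda>k. c k \<omega>) A" for \<omega>
  have d: "((\<lambda>k. c k \<omega>) has_sum d \<omega>) A" for \<omega>
    using cs by (simp add: d_def)
  have dn: "norm (d \<omega>) \<le> infsum (\<lambda>k. norm (c k \<omega>)) A" for \<omega>
    using norm_has_sum_bound[OF has_sum_infsum[OF nc] d] by simp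
  have N3: "((\<lambda>\<omega>. infsum (\<lambda>k. norm (c k \<omega>)) A * \<rho> ^ degree_of \<omega>) has_sum S') UNIV"
  proof (rule has_sum_SigmaD[OF N2])
    fix \<omega>
    show "((\<lambda>k. (case (\<omega>, k) of (\<omega>, k) \<Rightarrow> norm (c k \<omega>) * \<rho> ^ degree_of \<omega>)) has_sum
          infsum (\<lambda>k. norm (c k \<omega>)) A * \<rho> ^ degree_of \<omega>) A"
      using has_sum_cmult_left[OF has_sum_infsum[OF nc]] by simp
  qed
  have "(\<lambda>\<omega>. norm (d \<omega>) * \<rho> ^ degree_of \<omega>) summable_on UNIV"
    by (rule summable_on_comparison_test[OF has_sum_imp_summable[OF N3]])
      (use dn \<open>\<rho> > 0\<close> in \<open>auto intro: mult_right_mono\<close>)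
  then obtain S'' where S'': "((\<lambda>\<omega>. norm (d \<omega>) * \<rho> ^ degree_of \<omega>) has_sum S'') UNIV"
    by (auto simp: summable_on_def)
  have "S'' \<le> S'"
    by (rule has_sum_mono[OF S'' N3]) (use dn \<open>\<rho> > 0\<close> in \<open>auto intro: mult_right_mono\<close>)
  moreover have "((\<lambda>\<omega>. d \<omega> * monom_vec h \<omega>) has_sum g h) UNIV" if h: "h \<in> polydisc \<rho>" for h
  proof -
    have "(\<lambda>(k, \<omega>). norm (c k \<omega> * monom_vec h \<omega>)) summable_on A \<times> UNIV"
      by (rule summable_on_comparison_test[OF N])
       (use norm_monom_vec_le[of h \<rho>] h in \<open>auto simp: norm_mult polydisc_def intro!: mult_left_mono\<close>)
    then have "(\<lambda>x. norm ((\<lambda>(k, \<omega>). c k \<omega> * monom_vec h \<omega>) x)) summable_on A \<times> UNIV"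
      by (simp add: case_prod_unfold)
    then have sm: "(\<lambda>(k, \<omega>). c k \<omega> * monom_vec h \<omega>) summable_on A \<times> UNIV"
      by (rule abs_summable_summable)
    have "((\<lambda>(k, \<omega>). c k \<omega> * monom_vec h \<omega>) has_sum g h) (A \<times> UNIV)"
      by (rule has_sum_SigmaI[where g = "\<lambda>k. f k h"]) (use c(3) h g sm in auto)
    then have *: "((\<lambda>(\<omega>, k). c k \<omega> * monom_vec h \<omega>) has_sum g h) (UNIV \<times> A)"
      by (subst (asm) has_sum_swap) (simp add: case_prod_unfold)
    show ?thesis
      by (rule has_sum_SigmaD[OF *]) (use has_sum_cmult_left[OF d] in auto)
  qed
  ultimately show ?thesis
    unfolding powser_def using S'' \<open>S' \<le> T\<close> by (intro exI[of _ d] exI[of _ S'']) auto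
qed

lemma powser_mono: "powser \<rho> M f \<Longrightarrow> M \<le> M' \<Longrightarrow> powser \<rho> M' f"
  unfolding powser_def by (meson order_trans)

lemma powser_cong:
  "powser \<rho> M f \<Longrightarrow> (\<And>h. h \<in> polydisc \<rho> \<Longrightarrow> f h = g h) \<Longrightarrow> powser \<rho> M g"
  unfolding powser_def by simp

lemma powser_norm_le:
  assumes "powser \<rho> M f" "h \<in> polydisc \<rho>"
  shows "norm (f h) \<le> M"
proof -
  obtain c S where c: "((\<lambda>\<omega>. norm (c \<omega>) * \<rho> ^ degree_of \<omega>) has_sum S) UNIV" "S \<le> M"
      "((\<lambda>\<omega>. c \<omega> * monom_vec h \<omega>) has_sum f h) UNIV"
    using assms unfolding powser_def by blast
  have le: "norm (c \<omega> * monom_vec h \<omega>) \<le> norm (c \<omega>) * \<rho> ^ degree_of \<omega>" for \<omega>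
    using norm_monom_vec_le[of h \<rho>] assms(2)
    by (auto simp: norm_mult polydisc_def intro!: mult_left_mono)
  have "(\<lambda>\<omega>. norm (c \<omega> * monom_vec h \<omega>)) summable_on UNIV"
    by (rule summable_on_comparison_test[OF has_sum_imp_summable[OF c(1)]]) (use le in auto)
  then obtain S' where S': "((\<lambda>\<omega>. norm (c \<omega> * monom_vec h \<omega>)) has_sum S') UNIV"
    by (auto simp: summable_on_def)
  have "norm (f h) \<le> S'" by (rule norm_has_sum_bound[OF S' c(3)])
  also have "S' \<le> S" by (rule has_sum_mono[OF S' c(1)]) (use le in auto)
  finally show ?thesis using c(2) by simp
qed

lemma powser_nonneg: "powser \<rho> M f \<Longrightarrow> \<rho> \<ge> 0 \<Longrightarrow> M \<ge> 0"
  using powser_norm_le[of \<rho> M f 0] order_trans[OF norm_ge_zero[of "f 0"], of M]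
  by (simp add: polydisc_def)

lemma powser_mult_monom:
  fixes f :: "'a::real_or_complex^'m \<Rightarrow> 'a"
  assumes "powser \<rho> M f" "\<rho> \<ge> 0"
  shows "powser \<rho> (norm k * \<rho> ^ degree_of \<tau> * M) (\<lambda>h. k * monom_vec h \<tau> * f h)"
proof -
  obtain c S where c: "((\<lambda>\<omega>. norm (c \<omega>) * \<rho> ^ degree_of \<omega>) has_sum S) UNIV" "S \<le> M"
      "\<And>h. h \<in> polydisc \<rho> \<Longrightarrow> ((\<lambda>\<omega>. c \<omega> * monom_vec h \<omega>) has_sum f h) UNIV"
    using assms(1) unfolding powser_def by blast
  define s where "s = (\<lambda>(\<omega>::'m \<Rightarrow> nat) i. \<omega> i + \<tau> i)"
  have inj: "inj s" unfolding s_def by (auto simp: inj_def fun_eq_iff)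
  define d where "d \<sigma> = (if \<sigma> \<in> range s then k * c (inv s \<sigma>) else 0)" for \<sigma>
  have ds: "d (s \<omega>) = k * c \<omega>" for \<omega>
    by (simp add: d_def inj)
  have deg: "degree_of (s \<omega>) = degree_of \<omega> + degree_of \<tau>" for \<omega>
    by (simp add: degree_of_def s_def sum.distrib)
  have mon: "monom_vec h (s \<omega>) = monom_vec h \<omega> * monom_vec h \<tau>" for \<omega> and h :: "'a^'m"
    by (simp add: monom_vec_def s_def power_add prod.distrib)
  have 1: "((\<lambda>\<omega>. norm (d \<omega>) * \<rho> ^ degree_of \<omega>) has_sum (norm k * \<rho> ^ degree_of \<tau> * S)) UNIV"
  proof -
    have "((\<lambda>\<omega>. norm (d \<omega>) * \<rho> ^ degree_of \<omega>) has_sum (norm k * \<rho> ^ degree_of \<tau> * S)) (range s)"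
      unfolding has_sum_reindex[OF inj] o_def ds deg
      using has_sum_cmult_right[OF c(1), of "norm k * \<rho> ^ degree_of \<tau>"]
      by (simp add: norm_mult power_add mult_ac)
    then show ?thesis
      by (rule has_sum_UNIV_superset) (auto simp: d_def)
  qed
  have 2: "((\<lambda>\<omega>. d \<omega> * monom_vec h \<omega>) has_sum (k * monom_vec h \<tau> * f h)) UNIV" if "h \<in> polydisc \<rho>" for h
  proof -
    have "((\<lambda>\<omega>. d \<omega> * monom_vec h \<omega>) has_sum (k * monom_vec h \<tau> * f h)) (range s)"
      unfolding has_sum_reindex[OF inj] o_def ds mon
      using has_sum_cmult_right[OF c(3)[OF that], of "k * monom_vec h \<tau>"]
      by (simp add: mult_ac)
    then show ?thesis
      by (rule has_sum_UNIV_superset) (auto simp: d_def)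
  qed
  have "norm k * \<rho> ^ degree_of \<tau> * S \<le> norm k * \<rho> ^ degree_of \<tau> * M"
    using c(2) assms(2) by (intro mult_left_mono) auto
  then show ?thesis unfolding powser_def using 1 2 by blast
qed

lemma monom_vec_zero: "monom_vec (0::'a::real_or_complex^'m) \<omega> = (if \<omega> = (\<lambda>_. 0) then 1 else 0)"
  by (auto simp: monom_vec_def fun_eq_iff)

lemma powser_const: "powser \<rho> (norm k) (\<lambda>h::'a::real_or_complex^'m. k)"
proof -
  have 1: "((\<lambda>\<omega>. norm (if \<omega> = (\<lambda>_. 0) then k else 0) * \<rho> ^ degree_of \<omega>) has_sum norm k) UNIV"
  proof -
    have "((\<lambda>\<omega>. norm (if \<omega> = (\<lambda>_. 0) then k else 0) * \<rho> ^ degree_of \<omega>) has_sum norm k) {\<lambda>_. 0}"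
      by (rule has_sum_finiteI) (auto simp: degree_of_def)
    then show ?thesis
      by (rule has_sum_UNIV_superset) (auto simp: monom_vec_zero)
  qed
  have 2: "((\<lambda>\<omega>. (if \<omega> = (\<lambda>_. 0) then k else 0) * monom_vec h \<omega>) has_sum k) UNIV" for h :: "'a^'m"
  proof -
    have "((\<lambda>\<omega>. (if \<omega> = (\<lambda>_. 0) then k else 0) * monom_vec h \<omega>) has_sum k) {\<lambda>_. 0}"
      by (rule has_sum_finiteI) (auto simp: monom_vec_def)
    then show ?thesis
      by (rule has_sum_UNIV_superset) (auto simp: monom_vec_zero)
  qed
  show ?thesis unfolding powser_def using 1 2
    by (intro exI[of _ "\<lambda>\<omega>. if \<omega> = (\<lambda>_. 0) then k else 0"] exI[of _ "norm k"]) auto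
qed

lemma powser_monom:
  assumes "\<rho> \<ge> 0"
  shows "powser \<rho> (norm k * \<rho> ^ degree_of \<tau>) (\<lambda>h::'a::real_or_complex^'m. k * monom_vec h \<tau>)"
  using powser_mult_monom[OF powser_const[of \<rho> "1::'a"] assms, of k \<tau>] by simp

text \<open>Only \<open>f\<close> is expanded: each term is a monomial times \<open>g\<close>,
  covered by \<open>powser_mult_monom\<close>. This avoids forming a Cauchy product of
  multi-indices.\<close>

lemma powser_mult:
  fixes f g :: "'a::real_or_complex^'m \<Rightarrow> 'a"
  assumes f: "powser \<rho> M f" and g: "powser \<rho> N g" and "\<rho> > 0"
  shows "powser \<rho> (M * N) (\<lambda>h. f h * g h)"
proof -
  obtain c S where c: "((\<lambda>\<omega>. norm (c \<omega>) * \<rho> ^ degree_of \<omega>) has_sum S) UNIV" "S \<le> M"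
      "\<And>h. h \<in> polydisc \<rho> \<Longrightarrow> ((\<lambda>\<omega>. c \<omega> * monom_vec h \<omega>) has_sum f h) UNIV"
    using f unfolding powser_def by blast
  have "powser \<rho> (S * N) (\<lambda>h. f h * g h)"
    by (rule powser_has_sum[OF \<open>\<rho> > 0\<close> powser_mult_monom[OF g]])
      (use c(1,3) \<open>\<rho> > 0\<close> in \<open>auto intro!: has_sum_cmult_left\<close>)
  then show ?thesis
    by (rule powser_mono) (use c(2) powser_nonneg[OF g] \<open>\<rho> > 0\<close> in \<open>auto intro: mult_right_mono\<close>)
qed

lemma powser_sum:
  assumes "\<rho> > 0" "finite A" "\<And>k. k \<in> A \<Longrightarrow> powser \<rho> (M k) (f k)"
  shows "powser \<rho> (\<Sum>k\<in>A. M k) (\<lambda>h. \<Sum>k\<in>A. f k h)"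
  by (rule powser_has_sum[OF assms(1,3)]) (use assms(2) in \<open>auto intro: has_sum_finiteI\<close>)

lemma powser_power:
  assumes "powser \<rho> M f" "\<rho> > 0"
  shows "powser \<rho> (M ^ n) (\<lambda>h. f h ^ n)"
proof (induction n)
  case 0
  then show ?case using powser_const[of \<rho> 1] by simp
next
  case (Suc n)
  then show ?case using powser_mult[OF assms(1) Suc assms(2)] by simp
qed

lemma powser_prod:
  fixes f :: "'b \<Rightarrow> 'a::real_or_complex^'m \<Rightarrow> 'a"
  assumes "\<rho> > 0" "finite A" "\<And>k. k \<in> A \<Longrightarrow> powser \<rho> (M k) (f k)"
  shows "powser \<rho> (\<Prod>k\<in>A. M k) (\<lambda>h. \<Prod>k\<in>A. f k h)"
  using assms(2,3)
proof (induction A rule: finite_induct)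
  case empty
  then show ?case using powser_const[of \<rho> "1::'a"] by simp
next
  case (insert x F)
  have "powser \<rho> (M x * prod M F) (\<lambda>h. f x h * (\<Prod>k\<in>F. f k h))"
    by (rule powser_mult[OF _ insert.IH assms(1)]) (use insert in auto)
  then show ?case using insert.hyps by simp
qed

text \<open>Each component of \<open>F\<close> has bound \<open>\<sigma>\<close>, so the monomial of
  exponent \<open>\<omega>\<close> in \<open>F\<close> has bound
  \<open>\<sigma> ^ degree_of \<omega>\<close>, exactly the weight of that coefficient in the
  majorant of \<open>g\<close>.\<close>

lemma powser_subst:
  fixes F :: "'a::real_or_complex^'m \<Rightarrow> 'a^'l" and g :: "'a^'l \<Rightarrow> 'a"
  assumes g: "powser \<sigma> M g" and F: "\<And>i. powser \<rho> \<sigma> (\<lambda>h. F h $ i)" and "\<rho> > 0"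
  shows "powser \<rho> M (\<lambda>h. g (F h))"
proof -
  obtain c S where c: "((\<lambda>\<omega>. norm (c \<omega>) * \<sigma> ^ degree_of \<omega>) has_sum S) UNIV" "S \<le> M"
      "\<And>h. h \<in> polydisc \<sigma> \<Longrightarrow> ((\<lambda>\<omega>. c \<omega> * monom_vec h \<omega>) has_sum g h) UNIV"
    using g unfolding powser_def by blast
  have F': "F h \<in> polydisc \<sigma>" if "h \<in> polydisc \<rho>" for h
    using powser_norm_le[OF F that] by (simp add: polydisc_def)
  have "powser \<rho> S (\<lambda>h. g (F h))"
  proof (rule powser_has_sum[OF \<open>\<rho> > 0\<close> _ c(1)])
    fix \<omega> :: "'l \<Rightarrow> nat"
    have "powser \<rho> (\<Prod>i\<in>UNIV. \<sigma> ^ \<omega> i) (\<lambda>h. \<Prod>i\<in>UNIV. (F h $ i) ^ \<omega> i)"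
      using F \<open>\<rho> > 0\<close> by (intro powser_prod powser_power) auto
    from powser_mult[OF powser_const[of \<rho> "c \<omega>"] this \<open>\<rho> > 0\<close>]
    show "powser \<rho> (norm (c \<omega>) * \<sigma> ^ degree_of \<omega>) (\<lambda>h. c \<omega> * monom_vec (F h) \<omega>)"
      by (simp add: monom_vec_def degree_of_def power_sum)
  qed (use c(3) F' in auto)
  then show ?thesis using c(2) powser_mono by blast
qed

lemma powser_coeff_zero:
  assumes "((\<lambda>\<omega>. c \<omega> * monom_vec (0::'a::real_or_complex^'m) \<omega>) has_sum s) UNIV"
  shows "c (\<lambda>_. 0) = s"
proof -
  have "((\<lambda>\<omega>. c \<omega> * monom_vec (0::'a^'m) \<omega>) has_sum c (\<lambda>_. 0)) {\<lambda>_. 0}"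
    by (rule has_sum_finiteI) (auto simp: monom_vec_zero)
  then have "((\<lambda>\<omega>. c \<omega> * monom_vec (0::'a^'m) \<omega>) has_sum c (\<lambda>_. 0)) UNIV"
    by (rule has_sum_UNIV_superset) (auto simp: monom_vec_zero)
  then show ?thesis using assms has_sum_unique by blast
qed

lemma polydisc_mono: "\<rho> \<le> \<rho>' \<Longrightarrow> polydisc \<rho> \<subseteq> polydisc \<rho>'"
  by (auto simp: polydisc_def intro: order_trans)

lemma zero_in_polydisc [simp]: "\<rho> \<ge> 0 \<Longrightarrow> 0 \<in> polydisc \<rho>"
  by (simp add: polydisc_def)

lemma powser_shrink:
  assumes "powser \<rho> M f" "0 < \<rho>'" "\<rho>' \<le> \<rho>"
  shows "powser \<rho>' M f"
proof -
  obtain c S where c: "((\<lambda>\<omega>. norm (c \<omega>) * \<rho> ^ degree_of \<omega>) has_sum S) UNIV" "S \<le> M"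
      "\<And>h. h \<in> polydisc \<rho> \<Longrightarrow> ((\<lambda>\<omega>. c \<omega> * monom_vec h \<omega>) has_sum f h) UNIV"
    using assms(1) unfolding powser_def by blast
  have le: "norm (c \<omega>) * \<rho>' ^ degree_of \<omega> \<le> norm (c \<omega>) * \<rho> ^ degree_of \<omega>" for \<omega>
    using assms by (intro mult_left_mono power_mono) auto
  have "(\<lambda>\<omega>. norm (c \<omega>) * \<rho>' ^ degree_of \<omega>) summable_on UNIV"
    by (rule summable_on_comparison_test[OF has_sum_imp_summable[OF c(1)]]) (use le assms in auto)
  then obtain S' where S': "((\<lambda>\<omega>. norm (c \<omega>) * \<rho>' ^ degree_of \<omega>) has_sum S') UNIV"
    by (auto simp: summable_on_def)
  have "S' \<le> S" by (rule has_sum_mono[OF S' c(1)]) (use le in auto)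
  then show ?thesis unfolding powser_def
    using S' c(2,3) polydisc_mono[OF assms(3)] by (intro exI[of _ c] exI[of _ S']) auto
qed

text \<open>Without a constant term every monomial has degree at least 1, so scaling the radius by
  \<open>t\<close> gains a factor \<open>t\<close> in the bound. This makes a germ small enough to
  be substituted into another series.\<close>

lemma powser_shrink_vanish:
  assumes "powser \<rho> M f" "f 0 = 0" "0 < \<rho>" "0 < t" "t \<le> 1"
  shows "powser (t * \<rho>) (t * M) f"
proof -
  obtain c S where c: "((\<lambda>\<omega>. norm (c \<omega>) * \<rho> ^ degree_of \<omega>) has_sum S) UNIV" "S \<le> M"
      "\<And>h. h \<in> polydisc \<rho> \<Longrightarrow> ((\<lambda>\<omega>. c \<omega> * monom_vec h \<omega>) has_sum f h) UNIV"
    using assms(1) unfolding powser_def by blast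
  have c0: "c (\<lambda>_. 0) = 0"
    using powser_coeff_zero[OF c(3)[of 0]] assms(2,3) by simp
  have le: "norm (c \<omega>) * (t * \<rho>) ^ degree_of \<omega> \<le> t * (norm (c \<omega>) * \<rho> ^ degree_of \<omega>)" for \<omega>
  proof (cases "\<omega> = (\<lambda>_. 0)")
    case False
    then have "degree_of \<omega> \<noteq> 0" by (auto simp: degree_of_def fun_eq_iff)
    then have "t ^ degree_of \<omega> \<le> t"
      using power_decreasing[of 1 "degree_of \<omega>" t] assms by simp
    then have "t ^ degree_of \<omega> * (norm (c \<omega>) * \<rho> ^ degree_of \<omega>) \<le> t * (norm (c \<omega>) * \<rho> ^ degree_of \<omega>)"
      using assms by (intro mult_right_mono) auto
    then show ?thesis by (simp add: power_mult_distrib mult_ac)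
  qed (simp add: c0)
  have cs: "((\<lambda>\<omega>. t * (norm (c \<omega>) * \<rho> ^ degree_of \<omega>)) has_sum t * S) UNIV"
    by (rule has_sum_cmult_right[OF c(1)])
  have "(\<lambda>\<omega>. norm (c \<omega>) * (t * \<rho>) ^ degree_of \<omega>) summable_on UNIV"
    by (rule summable_on_comparison_test[OF has_sum_imp_summable[OF cs]]) (use le assms in auto)
  then obtain S' where S': "((\<lambda>\<omega>. norm (c \<omega>) * (t * \<rho>) ^ degree_of \<omega>) has_sum S') UNIV"
    by (auto simp: summable_on_def)
  have "S' \<le> t * S" by (rule has_sum_mono[OF S' cs]) (use le in auto)
  also have "\<dots> \<le> t * M" using c(2) assms by simp
  finally show ?thesis unfolding powser_def
    using S' c(3) polydisc_mono[of "t * \<rho>" \<rho>] assms by (intro exI[of _ c] exI[of _ S']) auto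
qed

definition unit_index :: "'m \<Rightarrow> 'm \<Rightarrow> nat" where
  "unit_index i = (\<lambda>j. if j = i then 1 else 0)"

lemma monom_vec_unit_index [simp]: "monom_vec (h::'a::real_or_complex^'m) (unit_index i) = h $ i"
  by (simp add: monom_vec_def unit_index_def if_distrib[of "\<lambda>n. _ ^ n"] cong: if_cong)

lemma degree_of_unit_index [simp]: "degree_of (unit_index i) = 1"
  by (simp add: degree_of_def unit_index_def)

lemma powser_nth: "\<rho> \<ge> 0 \<Longrightarrow> powser \<rho> \<rho> (\<lambda>h::'a::real_or_complex^'m. h $ i)"
  using powser_monom[of \<rho> 1 "unit_index i"] by simp

lemma powser_add:
  fixes f g :: "'a::real_or_complex^'m \<Rightarrow> 'a"
  assumes "powser \<rho> M f" "powser \<rho> N g" "\<rho> > 0"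
  shows "powser \<rho> (M + N) (\<lambda>h. f h + g h)"
  using powser_sum[of \<rho> UNIV "\<lambda>b. if b then M else N" "\<lambda>b. if b then f else g"] assms
  by (simp add: UNIV_bool add.commute)


lemma degree_of_ge_2:
  fixes \<omega> :: "'m::finite \<Rightarrow> nat"
  assumes "\<omega> \<noteq> (\<lambda>_. 0)" "\<omega> \<notin> range unit_index"
  shows "degree_of \<omega> \<ge> 2"
proof (rule ccontr)
  assume small: "\<not> degree_of \<omega> \<ge> 2"
  obtain i where i: "\<omega> i \<noteq> 0" using assms(1) by auto
  have eq: "degree_of \<omega> = \<omega> i + (\<Sum>j\<in>UNIV - {i}. \<omega> j)"
    unfolding degree_of_def by (rule sum.remove) auto
  have "\<omega> i = 1" "(\<Sum>j\<in>UNIV - {i}. \<omega> j) = 0" using small i eq by linarith+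
  then have "\<omega> i = 1" "\<And>j. j \<noteq> i \<Longrightarrow> \<omega> j = 0" by auto
  then have "\<omega> = unit_index i" by (auto simp: unit_index_def fun_eq_iff)
  with assms(2) show False by auto
qed

text \<open>Removing the terms of degree 0 and 1 leaves monomials of degree at least 2, whose sum is
  at most S (|h| / \<rho>)^2.\<close>

lemma powser_has_derivative_zero:
  fixes f :: "'a::real_or_complex^'m \<Rightarrow> 'a"
  assumes "\<rho> > 0" and c: "((\<lambda>\<omega>. norm (c \<omega>) * \<rho> ^ degree_of \<omega>) has_sum S) UNIV"
    and f: "\<And>h. h \<in> polydisc \<rho> \<Longrightarrow> ((\<lambda>\<omega>. c \<omega> * monom_vec h \<omega>) has_sum f h) UNIV"
  shows "(f has_derivative (\<lambda>h. \<Sum>i\<in>UNIV. c (unit_index i) * h $ i)) (at 0)"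
proof -
  define F where "F = insert (\<lambda>_. 0) (range (unit_index :: 'm \<Rightarrow> 'm \<Rightarrow> nat))"
  define D where "D h = (\<Sum>i\<in>UNIV. c (unit_index i) * h $ i)" for h :: "'a^'m"
  have "finite F" unfolding F_def by simp
  have inj: "inj (unit_index :: 'm \<Rightarrow> 'm \<Rightarrow> nat)"
    by (auto simp: inj_def unit_index_def fun_eq_iff split: if_splits)
  have z: "(\<lambda>_. 0) \<notin> range (unit_index :: 'm \<Rightarrow> 'm \<Rightarrow> nat)"
    by (auto simp: unit_index_def fun_eq_iff) (metis zero_neq_one)
  have c0: "c (\<lambda>_. 0) = f 0"
    using powser_coeff_zero f[of 0] \<open>\<rho> > 0\<close> by auto
  have sumF: "(\<Sum>\<omega>\<in>F. c \<omega> * monom_vec h \<omega>) = f 0 + D h" for h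
    unfolding F_def using z
    by (simp add: c0 D_def sum.reindex[OF inj]) (simp add: monom_vec_def)
  have S0: "S \<ge> 0" by (rule has_sum_nonneg[OF c]) (use \<open>\<rho> > 0\<close> in auto)
  have R: "norm (f h - f 0 - D h) \<le> S * (norm h / \<rho>)\<^sup>2" if h: "norm h \<le> \<rho>" for h
  proof -
    let ?g = "\<lambda>\<omega>. c \<omega> * monom_vec h \<omega>"
    have hi: "norm (h $ i) \<le> norm h" for i by (rule Finite_Cartesian_Product.norm_nth_le)
    have hp: "h \<in> polydisc \<rho>" using hi h order_trans by (auto simp: polydisc_def)
    have "(?g has_sum (f h - (f 0 + D h))) (UNIV - F)"
      by (rule has_sum_Diff[OF f[OF hp]]) (use \<open>finite F\<close> sumF in \<open>auto intro!: has_sum_finiteI\<close>)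
    then have g: "(?g has_sum (f h - f 0 - D h)) (UNIV - F)" by (simp add: algebra_simps)
    have le: "norm (?g \<omega>) \<le> (norm h / \<rho>)\<^sup>2 * (norm (c \<omega>) * \<rho> ^ degree_of \<omega>)" if "\<omega> \<in> UNIV - F" for \<omega>
    proof -
      have d2: "degree_of \<omega> \<ge> 2" using that degree_of_ge_2 by (auto simp: F_def)
      have "norm (monom_vec h \<omega>) \<le> norm h ^ degree_of \<omega>" by (rule norm_monom_vec_le[OF hi])
      also have "\<dots> = (norm h / \<rho>) ^ degree_of \<omega> * \<rho> ^ degree_of \<omega>"
        using \<open>\<rho> > 0\<close> by (simp add: power_divide)
      also have "\<dots> \<le> (norm h / \<rho>)\<^sup>2 * \<rho> ^ degree_of \<omega>"
        using d2 h \<open>\<rho> > 0\<close> by (intro mult_right_mono power_decreasing) auto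
      finally have "norm (c \<omega>) * norm (monom_vec h \<omega>) \<le> norm (c \<omega>) * ((norm h / \<rho>)\<^sup>2 * \<rho> ^ degree_of \<omega>)"
        by (intro mult_left_mono) auto
      then show ?thesis by (simp add: norm_mult mult_ac)
    qed
    have cs: "((\<lambda>\<omega>. (norm h / \<rho>)\<^sup>2 * (norm (c \<omega>) * \<rho> ^ degree_of \<omega>)) has_sum (norm h / \<rho>)\<^sup>2 * S) UNIV"
      by (rule has_sum_cmult_right[OF c])
    have ss: "(\<lambda>\<omega>. (norm h / \<rho>)\<^sup>2 * (norm (c \<omega>) * \<rho> ^ degree_of \<omega>)) summable_on (UNIV - F)"
      by (rule summable_on_subset_banach[OF has_sum_imp_summable[OF cs]]) auto
    have "(\<lambda>\<omega>. norm (?g \<omega>)) summable_on (UNIV - F)"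
      by (rule summable_on_comparison_test[OF ss]) (use le in auto)
    then obtain S' where S': "((\<lambda>\<omega>. norm (?g \<omega>)) has_sum S') (UNIV - F)"
      by (auto simp: summable_on_def)
    have "norm (f h - f 0 - D h) \<le> S'" by (rule norm_has_sum_bound[OF S' g])
    also have "S' \<le> (norm h / \<rho>)\<^sup>2 * S"
      by (rule order_trans[OF has_sum_mono[OF S' has_sum_infsum[OF ss]]])
        (use le \<open>\<rho> > 0\<close> has_sum_mono2[OF has_sum_infsum[OF ss] cs] in auto)
    finally show ?thesis by (simp add: mult.commute)
  qed
  have "linear D"
    by (rule linearI) (simp_all add: D_def sum.distrib scaleR_sum_right algebra_simps)
  then have bl: "bounded_linear D" by (simp add: linear_conv_bounded_linear)
  have "(f has_derivative D) (at 0)"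
    unfolding has_derivative_at_alt
  proof (intro conjI bl allI impI)
    fix e :: real assume "e > 0"
    \<comment> \<open>S |y|^2 / \<rho>^2 \<le> e |y| holds once S |y| \<le> e \<rho>^2;
      \<open>S + 1\<close> keeps the quotient meaningful when \<open>S = 0\<close>.\<close>
    define d where "d = min \<rho> (e * \<rho>\<^sup>2 / (S + 1))"
    have "d > 0" using \<open>e > 0\<close> \<open>\<rho> > 0\<close> S0 by (simp add: d_def)
    moreover have "norm (f y - f 0 - D (y - 0)) \<le> e * norm (y - 0)" if "norm (y - 0) < d" for y
    proof -
      have "norm y * (S + 1) \<le> e * \<rho>\<^sup>2"
        using that S0 by (simp add: d_def pos_less_divide_eq)
      then have "S * norm y \<le> e * \<rho>\<^sup>2" by (simp add: algebra_simps) (smt (verit) norm_ge_zero)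
      then have "S * norm y * norm y \<le> e * \<rho>\<^sup>2 * norm y" by (intro mult_right_mono) auto
      then have "S * (norm y / \<rho>)\<^sup>2 \<le> e * norm y"
        using \<open>\<rho> > 0\<close> by (simp add: power_divide divide_simps power2_eq_square mult_ac)
      then show ?thesis using R[of y] that by (simp add: d_def)
    qed
    ultimately show "\<exists>d>0. \<forall>y. norm (y - 0) < d \<longrightarrow> norm (f y - f 0 - D (y - 0)) \<le> e * norm (y - 0)"
      by blast
  qed
  then show ?thesis by (simp add: D_def[abs_def])
qed

lemma powser_recentre_joint:
  fixes f :: "'a::real_or_complex^'m \<Rightarrow> 'a"
  assumes "\<rho> > 0" "powser \<rho> M f"
  shows "powser (\<rho> / 2) M (\<lambda>z :: 'a^('m + 'm). f (fst_vec z + snd_vec z))"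
proof (rule powser_subst[OF assms(2)])
  fix i
  show "powser (\<rho> / 2) \<rho> (\<lambda>h :: 'a^('m + 'm). (fst_vec h + snd_vec h) $ i)"
    using powser_add[OF powser_nth[of "\<rho> / 2" "Inl i :: 'm + 'm"] powser_nth[of "\<rho> / 2" "Inr i :: 'm + 'm"]] \<open>\<rho> > 0\<close>
    by (simp add: fst_vec_def snd_vec_def)
qed (use assms in auto)

lemma fst_vec_pair_vec [simp]: "fst_vec (pair_vec x y) = x"
  by (simp add: fst_vec_def pair_vec_def)

lemma snd_vec_pair_vec [simp]: "snd_vec (pair_vec x y) = y"
  by (simp add: snd_vec_def pair_vec_def)

lemma pair_vec_collapse [simp]: "pair_vec (fst_vec z) (snd_vec z) = z"
  by (auto simp: fst_vec_def snd_vec_def pair_vec_def vec_eq_iff split: sum.split)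

lemma pair_vec_nth [simp]: "pair_vec x y $ Inl i = x $ i" "pair_vec x y $ Inr j = y $ j"
  by (simp_all add: pair_vec_def)

lemma sum_UNIV_Plus: "(\<Sum>i\<in>(UNIV :: ('m::finite + 'l::finite) set). g i) = (\<Sum>i\<in>UNIV. g (Inl i)) + (\<Sum>i\<in>UNIV. g (Inr i))"
  by (simp add: UNIV_Plus_UNIV[symmetric] sum.Plus del: UNIV_Plus_UNIV)

lemma prod_UNIV_Plus:
  "(\<Prod>i\<in>(UNIV :: ('m::finite + 'l::finite) set). g i) = (\<Prod>i\<in>UNIV. g (Inl i)) * (\<Prod>i\<in>UNIV. g (Inr i))"
  by (simp add: UNIV_Plus_UNIV[symmetric] Plus_def prod.union_disjoint prod.reindex del: UNIV_Plus_UNIV)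
    (subst prod.union_disjoint, auto simp: prod.reindex)

text \<open>Expanding \<open>f (h\<^sub>0 + h)\<close> jointly in \<open>(h\<^sub>0, h)\<close> shows that the coefficients of the
  linear terms in \<open>h\<close>, i.e. the partial derivatives, are again power series in \<open>h\<^sub>0\<close>.\<close>

lemma powser_has_derivative:
  fixes f :: "'a::real_or_complex^'m \<Rightarrow> 'a"
  assumes "\<rho> > 0" "powser \<rho> M f"
  obtains N D where "\<And>i. powser (\<rho> / 2) (N i) (D i)"
    "\<And>z. z \<in> polydisc (\<rho> / 2) \<Longrightarrow> (f has_derivative (\<lambda>h. \<Sum>i\<in>UNIV. D i z * h $ i)) (at z)"
proof -
  define \<sigma> where "\<sigma> = \<rho> / 2"
  have "\<sigma> > 0" using assms by (simp add: \<sigma>_def)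
  obtain c S where c: "((\<lambda>\<omega>. norm (c \<omega>) * \<sigma> ^ degree_of \<omega>) has_sum S) UNIV"
    "\<And>z :: 'a^('m + 'm). z \<in> polydisc \<sigma> \<Longrightarrow> ((\<lambda>\<omega>. c \<omega> * monom_vec z \<omega>) has_sum f (fst_vec z + snd_vec z)) UNIV"
    using powser_recentre_joint[OF assms] unfolding powser_def \<sigma>_def by blast
  define d where "d \<tau> \<omega> = c (case_sum \<omega> \<tau>)" for \<omega> \<tau> :: "'m \<Rightarrow> nat"
  \<comment> \<open>A multi-index in the doubled variables is a pair: \<open>\<omega>\<close> for
    the base point and \<open>\<tau>\<close> for the increment. Summing over \<open>\<omega>\<close>
    first gives the coefficient functions \<open>C \<tau>\<close>.\<close>
  have bij: "bij_betw (\<lambda>(\<tau>, \<omega>). case_sum \<omega> \<tau>) UNIV (UNIV :: ('m + 'm \<Rightarrow> nat) set)"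
    by (rule bij_betw_byWitness[where f' = "\<lambda>\<omega>. (\<omega> \<circ> Inr, \<omega> \<circ> Inl)"])
       (auto simp: fun_eq_iff split: sum.split)
  have deg: "degree_of (case_sum \<omega> \<tau>) = degree_of \<omega> + degree_of \<tau>" for \<omega> \<tau> :: "'m \<Rightarrow> nat"
    by (simp add: degree_of_def sum_UNIV_Plus)
  have mon: "monom_vec (pair_vec x y) (case_sum \<omega> \<tau>) = monom_vec x \<omega> * monom_vec y \<tau>"
    for x y :: "'a^'m" and \<omega> \<tau>
    by (simp add: monom_vec_def prod_UNIV_Plus)
  have n1: "((\<lambda>(\<tau>, \<omega>). norm (d \<tau> \<omega>) * \<sigma> ^ degree_of \<omega> * \<sigma> ^ degree_of \<tau>) has_sum S) (UNIV \<times> UNIV)"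
    using c(1) unfolding has_sum_reindex_bij_betw[OF bij, symmetric]
    by (simp add: case_prod_unfold deg d_def power_add mult.assoc)
  have "(\<lambda>\<omega>. norm (d \<tau> \<omega>) * \<sigma> ^ degree_of \<omega> * \<sigma> ^ degree_of \<tau>) summable_on UNIV" for \<tau>
    using summable_on_SigmaD1[OF has_sum_imp_summable[OF n1], of \<tau>] by simp
  then have n2: "(\<lambda>\<omega>. norm (d \<tau> \<omega>) * \<sigma> ^ degree_of \<omega>) summable_on UNIV" for \<tau>
    using \<open>\<sigma> > 0\<close> by (subst (asm) summable_on_cmult_left') auto
  define N where "N \<tau> = infsum (\<lambda>\<omega>. norm (d \<tau> \<omega>) * \<sigma> ^ degree_of \<omega>) UNIV" for \<tau>
  have N: "((\<lambda>\<omega>. norm (d \<tau> \<omega>) * \<sigma> ^ degree_of \<omega>) has_sum N \<tau>) UNIV" for \<tau>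
    using n2 by (simp add: N_def)
  have NS: "((\<lambda>\<tau>. N \<tau> * \<sigma> ^ degree_of \<tau>) has_sum S) UNIV"
    by (rule has_sum_SigmaD[OF n1]) (use has_sum_cmult_left[OF N] in simp)
  define C where "C \<tau> x = infsum (\<lambda>\<omega>. d \<tau> \<omega> * monom_vec x \<omega>) UNIV" for \<tau> and x :: "'a^'m"
  have C: "((\<lambda>\<omega>. d \<tau> \<omega> * monom_vec x \<omega>) has_sum C \<tau> x) UNIV" if "x \<in> polydisc \<sigma>" for x \<tau>
  proof -
    have "(\<lambda>\<omega>. norm (d \<tau> \<omega> * monom_vec x \<omega>)) summable_on UNIV"
      by (rule summable_on_comparison_test[OF n2[of \<tau>]])
        (use norm_monom_vec_le[of x \<sigma>] that in \<open>auto simp: norm_mult polydisc_def intro!: mult_left_mono\<close>)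
    then show ?thesis unfolding C_def by (simp add: abs_summable_summable)
  qed
  have Cp: "powser \<sigma> (N \<tau>) (C \<tau>)" for \<tau>
    unfolding powser_def using N C by blast
  show thesis
  proof (rule that[of "\<lambda>i. N (unit_index i)" "\<lambda>i. C (unit_index i)"])
    show "powser (\<rho> / 2) (N (unit_index i)) (C (unit_index i))" for i
      using Cp \<sigma>_def by simp
    fix z :: "'a^'m" assume "z \<in> polydisc (\<rho> / 2)"
    then have z: "z \<in> polydisc \<sigma>" by (simp add: \<sigma>_def)
    have le: "norm (C \<tau> z) * \<sigma> ^ degree_of \<tau> \<le> N \<tau> * \<sigma> ^ degree_of \<tau>" for \<tau>
      using powser_norm_le[OF Cp z] \<open>\<sigma> > 0\<close> by (intro mult_right_mono) auto
    have "(\<lambda>\<tau>. norm (C \<tau> z) * \<sigma> ^ degree_of \<tau>) summable_on UNIV"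
      by (rule summable_on_comparison_test[OF has_sum_imp_summable[OF NS]]) (use le \<open>\<sigma> > 0\<close> in auto)
    then obtain S' where S': "((\<lambda>\<tau>. norm (C \<tau> z) * \<sigma> ^ degree_of \<tau>) has_sum S') UNIV"
      by (auto simp: summable_on_def)
    have "((\<lambda>h. f (z + h)) has_derivative (\<lambda>h. \<Sum>i\<in>UNIV. C (unit_index i) z * h $ i)) (at 0)"
    proof (rule powser_has_derivative_zero[OF \<open>\<sigma> > 0\<close> S'])
      fix h :: "'a^'m" assume h: "h \<in> polydisc \<sigma>"
      have "pair_vec z h \<in> polydisc \<sigma>"
        using z h by (auto simp: polydisc_def pair_vec_def split: sum.split)
      from c(2)[OF this]
      have "((\<lambda>(\<tau>, \<omega>). d \<tau> \<omega> * (monom_vec z \<omega> * monom_vec h \<tau>)) has_sum f (z + h)) (UNIV \<times> UNIV)"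
        unfolding has_sum_reindex_bij_betw[OF bij, symmetric]
        by (simp add: case_prod_unfold mon d_def)
      then show "((\<lambda>\<tau>. C \<tau> z * monom_vec h \<tau>) has_sum f (z + h)) UNIV"
        by (rule has_sum_SigmaD) (use has_sum_cmult_left[OF C[OF z]] in \<open>simp add: mult.assoc\<close>)
    qed
    then show "(f has_derivative (\<lambda>h. \<Sum>i\<in>UNIV. C (unit_index i) z * h $ i)) (at z)"
      by (simp add: has_derivative_at)
  qed
qed

section \<open>Germs of scalar analytic functions\<close>

definition sanalytic :: "('a::real_or_complex^'m \<Rightarrow> 'a) \<Rightarrow> 'a^'m \<Rightarrow> bool" where
  "sanalytic f a \<longleftrightarrow> (\<exists>\<rho>>0. \<exists>M. powser \<rho> M (\<lambda>h. f (a + h)))"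

lemma sanalyticE_common:
  fixes f :: "'b::finite \<Rightarrow> 'a::real_or_complex^'m \<Rightarrow> 'a"
  assumes "\<And>i. sanalytic (f i) a"
  obtains \<rho> M where "\<rho> > 0" "\<And>i. powser \<rho> M (\<lambda>h. f i (a + h))"
proof -
  from assms obtain \<rho> M where \<rho>: "\<And>i. \<rho> i > 0" "\<And>i. powser (\<rho> i) (M i) (\<lambda>h. f i (a + h))"
    unfolding sanalytic_def by metis
  show thesis
  proof (rule that[of "Min (range \<rho>)" "Max (range M)"])
    show "Min (range \<rho>) > 0" using \<rho>(1) by (subst Min_gr_iff) auto
    show "powser (Min (range \<rho>)) (Max (range M)) (\<lambda>h. f i (a + h))" for i
      by (rule powser_mono[OF powser_shrink[OF \<rho>(2)]]) (use \<open>Min (range \<rho>) > 0\<close> in auto)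
  qed
qed

lemma sanalytic_const: "sanalytic (\<lambda>x. k) a"
  unfolding sanalytic_def using powser_const by (metis zero_less_one)

lemma sanalytic_nth: "sanalytic (\<lambda>x. x $ i) (a :: 'a::real_or_complex^'m)"
  unfolding sanalytic_def
  using powser_add[OF powser_const[of 1 "a $ i"] powser_nth[of 1 i]]
  by (intro exI[of _ "1::real"]) auto

lemma sanalytic_sum:
  fixes f :: "'b \<Rightarrow> 'a::real_or_complex^'m \<Rightarrow> 'a"
  assumes "finite A" "\<And>k. k \<in> A \<Longrightarrow> sanalytic (f k) a"
  shows "sanalytic (\<lambda>x. \<Sum>k\<in>A. f k x) a"
  using assms
proof (induction A rule: finite_induct)
  case empty
  then show ?case using sanalytic_const[of 0] by simp
next
  case (insert k A)
  \<comment> \<open>The type \<open>bool\<close> serves as the finite index type, so that both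
    summands get one common radius and bound.\<close>
  have "sanalytic (if b then f k else (\<lambda>x. \<Sum>k\<in>A. f k x)) a" for b
    using insert by simp
  then obtain \<rho> M where *: "\<rho> > 0" "\<And>b. powser \<rho> M (\<lambda>h. (if b then f k else (\<lambda>x. \<Sum>k\<in>A. f k x)) (a + h))"
    using sanalyticE_common[where f = "\<lambda>b. if b then f k else (\<lambda>x. \<Sum>k\<in>A. f k x)" and a = a] by blast
  from powser_add[OF *(2)[of True] *(2)[of False] *(1)] insert.hyps *(1) show ?case
    unfolding sanalytic_def by auto
qed

lemma sanalytic_mult:
  fixes f g :: "'a::real_or_complex^'m \<Rightarrow> 'a"
  assumes "sanalytic f a" "sanalytic g a"
  shows "sanalytic (\<lambda>x. f x * g x) a"
proof -
  have "sanalytic (if b then f else g) a" for b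
    using assms by simp
  then obtain \<rho> M where *: "\<rho> > 0" "\<And>b. powser \<rho> M (\<lambda>h. (if b then f else g) (a + h))"
    using sanalyticE_common[where f = "\<lambda>b. if b then f else g" and a = a] by blast
  from powser_mult[OF *(2)[of True] *(2)[of False] *(1)] *(1) show ?thesis
    unfolding sanalytic_def by auto
qed

lemma sanalytic_add:
  fixes f g :: "'a::real_or_complex^'m \<Rightarrow> 'a"
  assumes "sanalytic f a" "sanalytic g a"
  shows "sanalytic (\<lambda>x. f x + g x) a"
  using sanalytic_sum[of "UNIV :: bool set" "\<lambda>b. if b then f else g" a] assms
  by (simp add: UNIV_bool add.commute)

lemma sanalytic_diff:
  fixes f g :: "'a::real_or_complex^'m \<Rightarrow> 'a"
  assumes "sanalytic f a" "sanalytic g a"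
  shows "sanalytic (\<lambda>x. f x - g x) a"
  using sanalytic_add[OF assms(1) sanalytic_mult[OF sanalytic_const[of "-1"] assms(2)]] by simp

lemma sanalytic_prod:
  fixes f :: "'b \<Rightarrow> 'a::real_or_complex^'m \<Rightarrow> 'a"
  assumes "finite A" "\<And>k. k \<in> A \<Longrightarrow> sanalytic (f k) a"
  shows "sanalytic (\<lambda>x. \<Prod>k\<in>A. f k x) a"
  using assms
  by (induction A rule: finite_induct) (auto intro: sanalytic_mult sanalytic_const)

lemma sanalytic_power: "sanalytic f a \<Longrightarrow> sanalytic (\<lambda>x. f x ^ n) a"
  by (induction n) (auto intro: sanalytic_mult sanalytic_const)

lemma sanalytic_compose:
  fixes F :: "'a::real_or_complex^'m \<Rightarrow> 'a^'l" and g :: "'a^'l \<Rightarrow> 'a"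
  assumes g: "sanalytic g (F a)" and F: "\<And>i. sanalytic (\<lambda>x. F x $ i) a"
  shows "sanalytic (\<lambda>x. g (F x)) a"
proof -
  obtain \<sigma> M where \<sigma>: "\<sigma> > 0" "powser \<sigma> M (\<lambda>k. g (F a + k))"
    using g unfolding sanalytic_def by auto
  have "sanalytic (\<lambda>x. F x $ i - F a $ i) a" for i
    by (intro sanalytic_diff F sanalytic_const)
  then obtain \<rho> N where \<rho>: "\<rho> > 0" "\<And>i. powser \<rho> N (\<lambda>h. F (a + h) $ i - F a $ i)"
    using sanalyticE_common[of "\<lambda>i x. F x $ i - F a $ i"] by blast
  have N0: "N \<ge> 0" using powser_nonneg[OF \<rho>(2)] \<rho>(1) by simp
  \<comment> \<open>Shrinking by \<open>t\<close> brings the bound \<open>N\<close> of F - F(a)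
    below the radius \<open>\<sigma>\<close> of \<open>g\<close>; \<open>N + 1\<close> excludes
    division by zero.\<close>
  define t where "t = min 1 (\<sigma> / (N + 1))"
  have t: "0 < t" "t \<le> 1" "t * N \<le> \<sigma>"
  proof -
    have "t * (N + 1) \<le> \<sigma>" using N0 \<sigma>(1)
      by (simp add: t_def pos_le_divide_eq[symmetric] del: distrib_left_numeral)
    moreover show "0 < t" "t \<le> 1" using N0 \<sigma>(1) by (auto simp: t_def)
    ultimately show "t * N \<le> \<sigma>" by (simp add: algebra_simps)
  qed
  have "powser (t * \<rho>) \<sigma> (\<lambda>h. (F (a + h) - F a) $ i)" for i
    using powser_mono[OF powser_shrink_vanish[OF \<rho>(2) _ \<rho>(1) t(1,2)] t(3)] by simp
  from powser_subst[OF \<sigma>(2) this] have "powser (t * \<rho>) M (\<lambda>h. g (F (a + h)))"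
    using t \<rho>(1) by simp
  moreover have "t * \<rho> > 0" using t \<rho>(1) by simp
  ultimately show ?thesis unfolding sanalytic_def by blast
qed

lemma sanalytic_inverse:
  fixes f :: "'a::real_or_complex^'m \<Rightarrow> 'a"
  assumes "sanalytic f a" "f a \<noteq> 0"
  shows "sanalytic (\<lambda>x. inverse (f x)) a"
proof -
  define b where "b = f a"
  have "sanalytic (\<lambda>x. 1 - inverse b * f x) a"
    by (intro sanalytic_diff sanalytic_const sanalytic_mult assms)
  then obtain \<rho> M where \<rho>: "\<rho> > 0" "powser \<rho> M (\<lambda>h. 1 - inverse b * f (a + h))"
    unfolding sanalytic_def by auto
  have M0: "M \<ge> 0" using powser_nonneg[OF \<rho>(2)] \<rho>(1) by simp
  \<comment> \<open>The factor pushes the bound of 1 - f / f(a) down to 1/2, so that its geometric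
    series converges with majorant sum 2.\<close>
  define t where "t = 1 / (2 * (M + 1))"
  have t: "0 < t" "t \<le> 1" "t * M \<le> 1/2" using M0 by (auto simp: t_def field_simps)
  have p: "powser (t * \<rho>) (1/2) (\<lambda>h. 1 - inverse b * f (a + h))"
    by (rule powser_mono[OF powser_shrink_vanish[OF \<rho>(2) _ \<rho>(1) t(1,2)] t(3)])
      (use assms(2) in \<open>simp add: b_def\<close>)
  have pos: "t * \<rho> > 0" using t \<rho>(1) by simp
  have "powser (t * \<rho>) 2 (\<lambda>h. b * inverse (f (a + h)))"
  proof (rule powser_has_sum[OF pos])
    show "powser (t * \<rho>) ((1/2) ^ n) (\<lambda>h. (1 - inverse b * f (a + h)) ^ n)" for n
      by (rule powser_power[OF p pos])
    have "(\<lambda>n. (1/2 :: real) ^ n) sums (1 / (1 - 1/2))" by (rule geometric_sums) simp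
    then show "((\<lambda>n. (1/2 :: real) ^ n) has_sum 2) UNIV"
      by (intro sums_nonneg_imp_has_sum) auto
    fix h :: "'a^'m" assume "h \<in> polydisc (t * \<rho>)"
    from powser_norm_le[OF p this]
    have n: "norm (1 - inverse b * f (a + h)) < 1" by simp
    have "f (a + h) \<noteq> 0" using n by auto
    moreover have "b \<noteq> 0" using assms(2) b_def by simp
    ultimately have e: "1 / (1 - (1 - inverse b * f (a + h))) = b * inverse (f (a + h))"
      by (simp add: field_simps)
    show "((\<lambda>n. (1 - inverse b * f (a + h)) ^ n) has_sum b * inverse (f (a + h))) UNIV"
      using geometric_sums[OF n] n unfolding e
      by (intro norm_summable_imp_has_sum) (auto simp: norm_power intro!: summable_geometric)
  qed
  then have "sanalytic (\<lambda>x. b * inverse (f x)) a"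
    unfolding sanalytic_def using pos by blast
  from sanalytic_mult[OF sanalytic_const[of "inverse b"] this]
  show ?thesis using assms(2) by (simp add: b_def mult.assoc[symmetric])
qed

lemma sanalytic_cong:
  fixes f :: "'a::real_or_complex^'m \<Rightarrow> 'a"
  assumes "sanalytic f a" "\<forall>\<^sub>F x in nhds a. f x = g x"
  shows "sanalytic g a"
proof -
  obtain \<rho> M where \<rho>: "\<rho> > 0" "powser \<rho> M (\<lambda>h. f (a + h))"
    using assms(1) unfolding sanalytic_def by auto
  obtain d where d: "d > 0" "\<And>x. dist x a < d \<Longrightarrow> f x = g x"
    using assms(2) unfolding eventually_nhds_metric by auto
  define r where "r = min \<rho> (d / (2 * CARD('m)))"
  have "r > 0" using \<rho> d by (simp add: r_def)
  have *: "f (a + h) = g (a + h)" if "h \<in> polydisc r" for h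
  proof (rule d(2))
    have "norm h \<le> (\<Sum>i\<in>UNIV. norm (h $ i))" by (rule norm_vec_le_sum)
    also have "\<dots> \<le> (\<Sum>i\<in>(UNIV :: 'm set). d / (2 * CARD('m)))"
      using that by (intro sum_mono) (auto simp: polydisc_def r_def)
    also have "\<dots> < d" using d(1) by simp
    finally show "dist (a + h) a < d" by (simp add: dist_norm)
  qed
  have "powser r M (\<lambda>h. g (a + h))"
    by (rule powser_cong[OF powser_shrink[OF \<rho>(2)]]) (use \<open>r > 0\<close> * in \<open>auto simp: r_def\<close>)
  then show ?thesis unfolding sanalytic_def using \<open>r > 0\<close> by blast
qed

lemma eventually_polydisc:
  fixes a :: "'a::real_or_complex^'m"
  assumes "\<rho> > 0"
  shows "\<forall>\<^sub>F x in nhds a. x - a \<in> polydisc \<rho>"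
  unfolding eventually_nhds_metric
proof (intro exI conjI allI impI)
  show "\<rho> > 0" by fact
  fix x :: "'a^'m" assume "dist x a < \<rho>"
  then show "x - a \<in> polydisc \<rho>"
    using Finite_Cartesian_Product.norm_nth_le[of "x - a"] by (auto simp: polydisc_def dist_norm) (meson less_imp_le order_le_less_trans)
qed

lemma powser_recentre:
  fixes f :: "'a::real_or_complex^'m \<Rightarrow> 'a"
  assumes "\<rho> > 0" "powser \<rho> M f" "x \<in> polydisc (\<rho> / 2)"
  shows "powser (\<rho> / 2) M (\<lambda>h. f (x + h))"
proof (rule powser_subst[OF assms(2)])
  fix i
  have "powser (\<rho> / 2) (norm (x $ i) + \<rho> / 2) (\<lambda>h. x $ i + h $ i)"
    using assms(1) by (intro powser_add powser_const powser_nth) auto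
  moreover have "norm (x $ i) \<le> \<rho> / 2" using assms(3) by (simp add: polydisc_def)
  then have "norm (x $ i) + \<rho> / 2 \<le> \<rho>" by simp
  ultimately show "powser (\<rho> / 2) \<rho> (\<lambda>h. (x + h) $ i)"
    unfolding vector_add_component by (rule powser_mono)
qed (use assms in auto)

lemma sanalytic_eventually:
  fixes f :: "'a::real_or_complex^'m \<Rightarrow> 'a"
  assumes "sanalytic f a"
  shows "\<forall>\<^sub>F x in nhds a. sanalytic f x"
proof -
  obtain \<rho> M where \<rho>: "\<rho> > 0" "powser \<rho> M (\<lambda>h. f (a + h))"
    using assms unfolding sanalytic_def by auto
  have "\<forall>\<^sub>F x in nhds a. x - a \<in> polydisc (\<rho> / 2)"
    using \<rho>(1) by (intro eventually_polydisc) auto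
  then show ?thesis
  proof eventually_elim
    case (elim x)
    from powser_recentre[OF \<rho> elim] have "powser (\<rho> / 2) M (\<lambda>h. f (x + h))" by simp
    then show ?case unfolding sanalytic_def using \<rho>(1) half_gt_zero by blast
  qed
qed

lemma sanalytic_has_derivative:
  fixes f :: "'a::real_or_complex^'m \<Rightarrow> 'a"
  assumes "sanalytic f a"
  obtains D where "\<And>i. sanalytic (D i) a"
    "\<forall>\<^sub>F x in nhds a. (f has_derivative (\<lambda>h. \<Sum>i\<in>UNIV. D i x * h $ i)) (at x)"
proof -
  obtain \<rho> M where \<rho>: "\<rho> > 0" "powser \<rho> M (\<lambda>h. f (a + h))"
    using assms unfolding sanalytic_def by auto
  obtain N D where D: "\<And>i. powser (\<rho> / 2) (N i) (D i)"
    "\<And>z. z \<in> polydisc (\<rho> / 2) \<Longrightarrow> ((\<lambda>h. f (a + h)) has_derivative (\<lambda>h. \<Sum>i\<in>UNIV. D i z * h $ i)) (at z)"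
    using powser_has_derivative[OF \<rho>] by blast
  show thesis
  proof (rule that[of "\<lambda>i x. D i (x - a)"])
    show "sanalytic (\<lambda>x. D i (x - a)) a" for i
      unfolding sanalytic_def using D(1)[of i] \<rho>(1) by (intro exI[of _ "\<rho> / 2"]) auto
    have "\<forall>\<^sub>F x in nhds a. x - a \<in> polydisc (\<rho> / 2)"
      using \<rho>(1) by (intro eventually_polydisc) auto
    then show "\<forall>\<^sub>F x in nhds a. (f has_derivative (\<lambda>h. \<Sum>i\<in>UNIV. D i (x - a) * h $ i)) (at x)"
    proof eventually_elim
      case (elim x)
      from D(2)[OF this] show ?case by (simp add: has_derivative_at add.assoc[symmetric])
    qed
  qed
qed

text \<open>From left to right, convergence at a single point with all coordinates equal to the
  radius already majorises the series on the whole closed polydisc. From right to left, the scalar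
  coefficients are assembled into vectors and convergence is checked by components.\<close>

lemma analytic_near_iff_sanalytic:
  fixes f :: "'a::real_or_complex^'m \<Rightarrow> 'a^'l"
  shows "analytic_near f a \<longleftrightarrow> (\<forall>i. sanalytic (\<lambda>x. f x $ i) a)"
proof
  assume "analytic_near f a"
  then obtain c \<delta> where c: "\<delta> > 0"
    "\<And>h. norm h < \<delta> \<Longrightarrow> ((\<lambda>\<omega> :: 'm \<Rightarrow> nat. monom_vec h \<omega> *s c \<omega>) has_sum f (a + h)) UNIV"
    unfolding analytic_near_def by blast
  show "\<forall>i. sanalytic (\<lambda>x. f x $ i) a"
  proof
    fix i
    have bl: "bounded_linear (\<lambda>x :: 'a^'l. x $ i)" by (rule bounded_linear_vec_nth)
    have comp: "((\<lambda>\<omega>. c \<omega> $ i * monom_vec h \<omega>) has_sum f (a + h) $ i) UNIV" if "norm h < \<delta>" for h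
      using has_sum_bounded_linear[OF bl c(2)[OF that]] by (simp add: o_def mult.commute)
    define \<rho> where "\<rho> = \<delta> / (2 * CARD('m))"
    have "\<rho> > 0" using c(1) by (simp add: \<rho>_def)
    have small: "norm h < \<delta>" if "h \<in> polydisc \<rho>" for h :: "'a^'m"
    proof -
      have "norm h \<le> (\<Sum>i\<in>UNIV. norm (h $ i))" by (rule norm_vec_le_sum)
      also have "\<dots> \<le> (\<Sum>i\<in>(UNIV :: 'm set). \<rho>)"
        using that by (intro sum_mono) (auto simp: polydisc_def)
      also have "\<dots> < \<delta>" using c(1) by (simp add: \<rho>_def)
      finally show ?thesis .
    qed
    \<comment> \<open>At this point the norm of every monomial equals its maximum over the
      polydisc.\<close>
    define p :: "'a^'m" where "p = (\<chi> i. of_real \<rho>)"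
    have "p \<in> polydisc \<rho>" using \<open>\<rho> > 0\<close> by (simp add: polydisc_def p_def)
    from summable_on_norm_euclidean[OF has_sum_imp_summable[OF comp[OF small[OF this]]]]
    have "(\<lambda>\<omega>. norm (c \<omega> $ i) * \<rho> ^ degree_of \<omega>) summable_on UNIV"
      using \<open>\<rho> > 0\<close> by (simp add: norm_mult norm_monom_vec p_def degree_of_def power_sum)
    then obtain S where "((\<lambda>\<omega>. norm (c \<omega> $ i) * \<rho> ^ degree_of \<omega>) has_sum S) UNIV"
      by (auto simp: summable_on_def)
    then have "powser \<rho> S (\<lambda>h. f (a + h) $ i)"
      unfolding powser_def using comp small by (intro exI[of _ "\<lambda>\<omega>. c \<omega> $ i"] exI[of _ S]) auto
    then show "sanalytic (\<lambda>x. f x $ i) a"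
      unfolding sanalytic_def using \<open>\<rho> > 0\<close> by blast
  qed
next
  assume "\<forall>i. sanalytic (\<lambda>x. f x $ i) a"
  then obtain \<rho> M where \<rho>: "\<rho> > 0" "\<And>i. powser \<rho> M (\<lambda>h. f (a + h) $ i)"
    using sanalyticE_common[of "\<lambda>i x. f x $ i"] by blast
  then have "\<forall>i. \<exists>c. \<forall>h\<in>polydisc \<rho>. ((\<lambda>\<omega>. c \<omega> * monom_vec h \<omega>) has_sum f (a + h) $ i) UNIV"
    unfolding powser_def by blast
  then obtain c where c: "\<And>i h. h \<in> polydisc \<rho> \<Longrightarrow> ((\<lambda>\<omega>. c i \<omega> * monom_vec h \<omega>) has_sum f (a + h) $ i) UNIV"
    by metis
  have "((\<lambda>\<omega> :: 'm \<Rightarrow> nat. monom_vec h \<omega> *s (\<chi> i. c i \<omega>)) has_sum f (a + h)) UNIV" if "norm h < \<rho>" for h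
  proof -
    have h: "h \<in> polydisc \<rho>"
      using that Finite_Cartesian_Product.norm_nth_le[of h] by (auto simp: polydisc_def) (meson less_imp_le order_le_less_trans)
    show ?thesis
      unfolding has_sum_def
    proof (rule vec_tendstoI)
      fix i
      show "((\<lambda>x. (\<Sum>\<omega>\<in>x. monom_vec h \<omega> *s (\<chi> i. c i \<omega>)) $ i) \<longlongrightarrow> f (a + h) $ i) (finite_subsets_at_top UNIV)"
        using c[OF h, of i] unfolding has_sum_def by (simp add: mult.commute)
    qed
  qed
  then show "analytic_near f a"
    unfolding analytic_near_def using \<rho>(1) by (intro exI[of _ "\<lambda>\<omega>. \<chi> i. c i \<omega>"] exI[of _ \<rho>]) auto
qed

section \<open>Maps of class \<open>C\<^sup>k\<close> and their jets\<close>

definition Ck :: "nat \<Rightarrow> 'v set \<Rightarrow> ('v::real_normed_vector \<Rightarrow> 'w::real_normed_vector) \<Rightarrow> bool" where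
  "Ck k U f \<longleftrightarrow>
     (\<forall>vs. length vs < k \<longrightarrow> (\<forall>x\<in>U. iter_deriv f vs differentiable (at x))) \<and>
     (\<forall>vs. length vs \<le> k \<longrightarrow> continuous_on U (iter_deriv f vs))"

lemma Cr_near_iff_Ck: "Cr_near k f a \<longleftrightarrow> (\<exists>U. open U \<and> a \<in> U \<and> Ck k U f)"
  unfolding Cr_near_def Ck_def by blast

lemma frechet_derivative_cong_open:
  assumes "open U" "x \<in> U" "\<And>y. y \<in> U \<Longrightarrow> f y = g y"
  shows "frechet_derivative f (at x) = frechet_derivative g (at x)"
proof -
  have "(f has_derivative D) (at x) \<longleftrightarrow> (g has_derivative D) (at x)" for D
    using has_derivative_transform_within_open[of f D x UNIV U g]
      has_derivative_transform_within_open[of g D x UNIV U f] assms by auto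
  then show ?thesis unfolding frechet_derivative_def by simp
qed

lemma differentiable_cong_open:
  assumes "open U" "x \<in> U" "\<And>y. y \<in> U \<Longrightarrow> f y = g y" "f differentiable (at x)"
  shows "g differentiable (at x)"
  using has_derivative_transform_within_open[of f _ x UNIV U g] assms
  unfolding differentiable_def by blast

lemma iter_deriv_cong:
  assumes "open U" "\<And>y. y \<in> U \<Longrightarrow> f y = g y" "x \<in> U"
  shows "iter_deriv f vs x = iter_deriv g vs x"
  using assms(3)
proof (induction vs arbitrary: x)
  case (Cons v vs)
  have "frechet_derivative (iter_deriv f vs) (at x) = frechet_derivative (iter_deriv g vs) (at x)"
    by (rule frechet_derivative_cong_open[OF assms(1) Cons.prems]) (rule Cons.IH)
  then show ?case by simp
qed (use assms in auto)

text \<open>The head of the list is the direction differentiated last. Peeling from the other end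
  exposes the first derivative, which reduces C^(k+1) to C^k of the first derivative in
  \<open>Ck_Suc\<close>.\<close>

lemma iter_deriv_snoc:
  "iter_deriv f (vs @ [v]) = iter_deriv (\<lambda>x. frechet_derivative f (at x) v) vs"
  by (induction vs) auto

lemma Ck_cong:
  fixes f g :: "'v::real_normed_vector \<Rightarrow> 'w::real_normed_vector"
  assumes "open U" "\<And>y. y \<in> U \<Longrightarrow> f y = g y" "Ck k U f"
  shows "Ck k U g"
proof -
  have eq: "iter_deriv f vs x = iter_deriv g vs x" if "x \<in> U" for vs x
    using iter_deriv_cong assms(1,2) that by blast
  show ?thesis
    unfolding Ck_def
  proof (intro conjI allI impI ballI)
    fix vs :: "'v list" and x assume "length vs < k" "x \<in> U"
    then have "iter_deriv f vs differentiable (at x)" using assms(3) by (auto simp: Ck_def)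
    then show "iter_deriv g vs differentiable (at x)"
      using differentiable_cong_open[of U x "iter_deriv f vs" "iter_deriv g vs"] assms(1) \<open>x \<in> U\<close> eq
      by auto
  next
    fix vs :: "'v list" assume "length vs \<le> k"
    then have "continuous_on U (iter_deriv f vs)" using assms(3) by (auto simp: Ck_def)
    then show "continuous_on U (iter_deriv g vs)"
      by (subst continuous_on_cong[OF refl eq[symmetric]]) auto
  qed
qed

lemma Ck_0: "Ck 0 U f \<longleftrightarrow> continuous_on U f"
  by (auto simp: Ck_def)

lemma Ck_Suc:
  fixes f :: "'v::real_normed_vector \<Rightarrow> 'w::real_normed_vector"
  assumes "open U"
  shows "Ck (Suc k) U f \<longleftrightarrow> (\<forall>x\<in>U. f differentiable (at x)) \<and>
    (\<forall>v. Ck k U (\<lambda>x. frechet_derivative f (at x) v))"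
proof (intro iffI conjI ballI allI)
  fix x assume *: "Ck (Suc k) U f" "x \<in> U"
  then show "f differentiable (at x)" unfolding Ck_def by (metis iter_deriv.simps(1) list.size(3) zero_less_Suc)
next
  fix v assume *: "Ck (Suc k) U f"
  show "Ck k U (\<lambda>x. frechet_derivative f (at x) v)"
    unfolding Ck_def iter_deriv_snoc[symmetric] using * unfolding Ck_def by simp
next
  assume *: "(\<forall>x\<in>U. f differentiable (at x)) \<and> (\<forall>v. Ck k U (\<lambda>x. frechet_derivative f (at x) v))"
  then have cont: "continuous_on U f"
    using assms by (simp add: continuous_on_eq_continuous_at differentiable_imp_continuous_within)
  show "Ck (Suc k) U f"
    unfolding Ck_def
  proof (intro conjI allI impI ballI)
    fix vs :: "'v list" and x assume "length vs < Suc k" "x \<in> U"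
    then show "iter_deriv f vs differentiable (at x)"
      using * unfolding Ck_def by (cases vs rule: rev_cases) (auto simp: iter_deriv_snoc)
  next
    fix vs :: "'v list" assume "length vs \<le> Suc k"
    then show "continuous_on U (iter_deriv f vs)"
      using * cont unfolding Ck_def by (cases vs rule: rev_cases) (auto simp: iter_deriv_snoc)
  qed
qed

lemma Ck_SucI:
  assumes "open U" "\<And>x. x \<in> U \<Longrightarrow> (f has_derivative f' x) (at x)" "\<And>v. Ck k U (\<lambda>x. f' x v)"
  shows "Ck (Suc k) U f"
proof -
  have "frechet_derivative f (at x) = f' x" if "x \<in> U" for x
    using assms(2)[OF that] by (metis frechet_derivative_at)
  then have "Ck k U (\<lambda>x. frechet_derivative f (at x) v)" for v
    by (intro Ck_cong[OF assms(1) _ assms(3)]) auto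
  then show ?thesis
    unfolding Ck_Suc[OF assms(1)] using assms(2) by (auto simp: differentiable_def)
qed

lemma Ck_SucD:
  assumes "open U" "Ck (Suc k) U f"
  shows "x \<in> U \<Longrightarrow> (f has_derivative frechet_derivative f (at x)) (at x)"
    and "Ck k U (\<lambda>x. frechet_derivative f (at x) v)"
  using assms Ck_Suc[OF assms(1)] frechet_derivative_works by blast+

lemma Ck_mono: "Ck k U f \<Longrightarrow> j \<le> k \<Longrightarrow> Ck j U f"
  unfolding Ck_def by auto

lemma Ck_subset: "Ck k U f \<Longrightarrow> V \<subseteq> U \<Longrightarrow> Ck k V f"
  unfolding Ck_def by (meson continuous_on_subset subsetD)

lemma Ck_imp_continuous: "Ck k U f \<Longrightarrow> continuous_on U f"
  using Ck_mono[of k U f 0] Ck_0 by blast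

lemma iter_deriv_has_derivative:
  assumes "Ck k U f" "length vs < k" "x \<in> U"
  shows "(iter_deriv f vs has_derivative (\<lambda>v. iter_deriv f (v # vs) x)) (at x)"
  using assms frechet_derivative_works[of "iter_deriv f vs" "at x"] unfolding Ck_def by simp

lemma Ck_const: "open U \<Longrightarrow> Ck k U (\<lambda>x. c)"
proof (induction k arbitrary: c)
  case (Suc k)
  show ?case by (rule Ck_SucI[OF Suc.prems has_derivative_const Suc.IH[OF Suc.prems]])
qed (simp add: Ck_0)

lemma Ck_bounded_linear:
  assumes "open U" "bounded_linear L"
  shows "Ck k U L"
proof (cases k)
  case 0
  then show ?thesis using assms by (simp add: Ck_0 linear_continuous_on)
next
  case (Suc j)
  show ?thesis unfolding Suc
    by (rule Ck_SucI[OF assms(1) bounded_linear_imp_has_derivative[OF assms(2)] Ck_const[OF assms(1)]])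
qed

lemma Ck_add:
  assumes "open U" "Ck k U f" "Ck k U g"
  shows "Ck k U (\<lambda>x. f x + g x)"
  using assms(2,3)
proof (induction k arbitrary: f g)
  case (Suc k)
  show ?case
    by (rule Ck_SucI[OF assms(1) has_derivative_add[OF Ck_SucD(1)[OF assms(1) Suc.prems(1)] Ck_SucD(1)[OF assms(1) Suc.prems(2)]]])
      (assumption | intro Suc.IH Ck_SucD(2)[OF assms(1)] Suc.prems)+
qed (simp add: Ck_0 continuous_on_add)

lemma Ck_compose_bounded_linear:
  assumes "open U" "bounded_linear L" "Ck k U f"
  shows "Ck k U (\<lambda>x. L (f x))"
  using assms(3)
proof (induction k arbitrary: f)
  case 0
  then show ?case using bounded_linear.continuous_on[OF assms(2)] by (simp add: Ck_0)
next
  case (Suc k)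
  show ?case
    by (rule Ck_SucI[OF assms(1) bounded_linear.has_derivative[OF assms(2) Ck_SucD(1)[OF assms(1) Suc.prems]]])
      (assumption | intro Suc.IH Ck_SucD(2)[OF assms(1)] Suc.prems)+
qed

lemma Ck_sum:
  assumes "open U" "finite A" "\<And>i. i \<in> A \<Longrightarrow> Ck k U (f i)"
  shows "Ck k U (\<lambda>x. \<Sum>i\<in>A. f i x)"
  using assms(2,3)
  by (induction A rule: finite_induct) (use assms(1) in \<open>auto intro: Ck_const Ck_add\<close>)

lemma Ck_diff:
  assumes "open U" "Ck k U f" "Ck k U g"
  shows "Ck k U (\<lambda>x. f x - g x)"
  using Ck_add[OF assms(1,2) Ck_compose_bounded_linear[OF assms(1) bounded_linear_minus[OF bounded_linear_ident] assms(3)]]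
  by simp

lemma Ck_scaleR:
  fixes f :: "'v::real_normed_vector \<Rightarrow> real" and g :: "'v \<Rightarrow> 'w::real_normed_vector"
  assumes "open U" "Ck k U f" "Ck k U g"
  shows "Ck k U (\<lambda>x. f x *\<^sub>R g x)"
  using assms(2,3)
proof (induction k arbitrary: f g)
  case (Suc k)
  show ?case
  proof (rule Ck_SucI[OF assms(1) has_derivative_scaleR[OF Ck_SucD(1)[OF assms(1) Suc.prems(1)] Ck_SucD(1)[OF assms(1) Suc.prems(2)]]])
    fix v
    show "Ck k U (\<lambda>x. f x *\<^sub>R frechet_derivative g (at x) v + frechet_derivative f (at x) v *\<^sub>R g x)"
      using Ck_mono[OF Suc.prems(1), of k] Ck_mono[OF Suc.prems(2), of k]
      by (intro Ck_add[OF assms(1)] Suc.IH Ck_SucD(2)[OF assms(1)] Suc.prems) auto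
  qed
qed (simp add: Ck_0 continuous_on_scaleR)

lemma iter_deriv_add:
  assumes "open U" "Ck k U f" "Ck k U g" "length vs \<le> k" "x \<in> U"
  shows "iter_deriv (\<lambda>x. f x + g x) vs x = iter_deriv f vs x + iter_deriv g vs x"
  using assms(4,5)
proof (induction vs arbitrary: x)
  case (Cons v vs)
  have "((\<lambda>y. iter_deriv f vs y + iter_deriv g vs y) has_derivative
      (\<lambda>v. iter_deriv f (v # vs) x + iter_deriv g (v # vs) x)) (at x)"
    using Cons.prems assms(2,3) by (intro has_derivative_add iter_deriv_has_derivative) auto
  then have "(iter_deriv (\<lambda>x. f x + g x) vs has_derivative
      (\<lambda>v. iter_deriv f (v # vs) x + iter_deriv g (v # vs) x)) (at x)"
    by (rule has_derivative_transform_within_open[OF _ assms(1) Cons.prems(2)])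
      (use Cons in auto)
  from fun_cong[OF frechet_derivative_at[OF this], of v] show ?case
    by simp
qed simp

lemma iter_deriv_compose_bounded_linear:
  assumes "open U" "Ck k U f" "bounded_linear L" "length vs \<le> k" "x \<in> U"
  shows "iter_deriv (\<lambda>x. L (f x)) vs x = L (iter_deriv f vs x)"
  using assms(4,5)
proof (induction vs arbitrary: x)
  case (Cons v vs)
  have "((\<lambda>y. L (iter_deriv f vs y)) has_derivative (\<lambda>v. L (iter_deriv f (v # vs) x))) (at x)"
    using Cons.prems assms(2,3) by (intro bounded_linear.has_derivative[OF assms(3)] iter_deriv_has_derivative) auto
  then have "(iter_deriv (\<lambda>x. L (f x)) vs has_derivative (\<lambda>v. L (iter_deriv f (v # vs) x))) (at x)"
    by (rule has_derivative_transform_within_open[OF _ assms(1) Cons.prems(2)])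
      (use Cons in auto)
  from fun_cong[OF frechet_derivative_at[OF this], of v] show ?case
    by simp
qed simp

lemma iter_deriv_diff:
  assumes "open U" "Ck k U f" "Ck k U g" "length vs \<le> k" "x \<in> U"
  shows "iter_deriv (\<lambda>x. f x - g x) vs x = iter_deriv f vs x - iter_deriv g vs x"
proof -
  have m: "bounded_linear (\<lambda>x :: 'b. - x)" by (intro bounded_linear_minus bounded_linear_ident)
  show ?thesis
    using iter_deriv_add[OF assms(1,2) Ck_compose_bounded_linear[OF assms(1) m assms(3)] assms(4,5)]
      iter_deriv_compose_bounded_linear[OF assms(1,3) m assms(4,5)] by simp
qed

lemma iter_deriv_zero: "iter_deriv (\<lambda>x. 0) vs = (\<lambda>x. 0)"
  by (induction vs) auto

lemma iter_deriv_sum: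
  assumes "open U" "finite A" "\<And>i. i \<in> A \<Longrightarrow> Ck k U (f i)" "length vs \<le> k" "x \<in> U"
  shows "iter_deriv (\<lambda>x. \<Sum>i\<in>A. f i x) vs x = (\<Sum>i\<in>A. iter_deriv (f i) vs x)"
  using assms(2,3)
proof (induction A rule: finite_induct)
  case empty
  then show ?case by (simp add: iter_deriv_zero)
next
  case (insert i A)
  have "Ck k U (\<lambda>x. \<Sum>i\<in>A. f i x)"
    using insert.hyps insert.prems by (intro Ck_sum[OF assms(1)]) auto
  from iter_deriv_add[OF assms(1) insert.prems[of i] this assms(4,5)] insert show ?case by simp
qed

text \<open>Each derivative costs one factor \<open>s\<close>. With s the inverse of |x_n| this is
  the price of a cut-off at scale |x_n|, to be paid from a correction of size o(|x_n|^r).\<close>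

lemma iter_deriv_rescale:
  assumes "Ck k UNIV f" "length vs \<le> k"
  shows "iter_deriv (\<lambda>x. f (s *\<^sub>R (x - a))) vs x = s ^ length vs *\<^sub>R iter_deriv f vs (s *\<^sub>R (x - a))"
  using assms(2)
proof (induction vs arbitrary: x)
  case (Cons v vs)
  have 1: "((\<lambda>x. s *\<^sub>R (x - a)) has_derivative (\<lambda>v. s *\<^sub>R v)) (at x)"
    by (auto intro!: derivative_eq_intros)
  have 2: "(iter_deriv f vs has_derivative (\<lambda>v. iter_deriv f (v # vs) (s *\<^sub>R (x - a)))) (at (s *\<^sub>R (x - a)))"
    using iter_deriv_has_derivative[OF assms(1)] Cons.prems by simp
  have lin: "linear (\<lambda>v. iter_deriv f (v # vs) (s *\<^sub>R (x - a)))"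
    by (rule has_derivative_linear[OF 2])
  have "((\<lambda>x. s ^ length vs *\<^sub>R iter_deriv f vs (s *\<^sub>R (x - a))) has_derivative
     (\<lambda>v. s ^ length vs *\<^sub>R iter_deriv f ((s *\<^sub>R v) # vs) (s *\<^sub>R (x - a)))) (at x)"
    by (intro has_derivative_scaleR_right has_derivative_compose[OF 1 2])
  moreover have "iter_deriv (\<lambda>x. f (s *\<^sub>R (x - a))) vs = (\<lambda>x. s ^ length vs *\<^sub>R iter_deriv f vs (s *\<^sub>R (x - a)))"
    using Cons by auto
  ultimately have "frechet_derivative (iter_deriv (\<lambda>x. f (s *\<^sub>R (x - a))) vs) (at x) =
     (\<lambda>v. s ^ length vs *\<^sub>R iter_deriv f ((s *\<^sub>R v) # vs) (s *\<^sub>R (x - a)))"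
    by (metis frechet_derivative_at)
  then have "iter_deriv (\<lambda>x. f (s *\<^sub>R (x - a))) (v # vs) x =
     s ^ length vs *\<^sub>R iter_deriv f ((s *\<^sub>R v) # vs) (s *\<^sub>R (x - a))"
    by simp
  also have "iter_deriv f ((s *\<^sub>R v) # vs) (s *\<^sub>R (x - a)) = s *\<^sub>R iter_deriv f (v # vs) (s *\<^sub>R (x - a))"
    using linear_scale[OF lin] by simp
  finally show ?case by (simp add: mult.commute)
qed simp

lemma Ck_rescale:
  assumes "Ck k UNIV f"
  shows "Ck k UNIV (\<lambda>x. f (s *\<^sub>R (x - a)))"
proof -
  have eq: "iter_deriv (\<lambda>x. f (s *\<^sub>R (x - a))) vs = (\<lambda>x. s ^ length vs *\<^sub>R iter_deriv f vs (s *\<^sub>R (x - a)))"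
    if "length vs \<le> k" for vs
    using iter_deriv_rescale[OF assms that] by blast
  show ?thesis
    unfolding Ck_def
  proof (intro conjI allI impI ballI)
    fix vs x assume l: "length (vs :: 'a list) < k"
    have "((\<lambda>x. s *\<^sub>R (x - a)) has_derivative (\<lambda>v. s *\<^sub>R v)) (at x)"
      by (auto intro!: derivative_eq_intros)
    from has_derivative_compose[OF this iter_deriv_has_derivative[OF assms l UNIV_I]]
    have "(\<lambda>x. iter_deriv f vs (s *\<^sub>R (x - a))) differentiable (at x)"
      by (auto simp: differentiable_def)
    then show "iter_deriv (\<lambda>x. f (s *\<^sub>R (x - a))) vs differentiable (at x)"
      using l by (subst eq) (auto intro!: differentiable_scaleR)
  next
    fix vs assume l: "length (vs :: 'a list) \<le> k"
    then have "continuous_on UNIV (iter_deriv f vs)" using assms by (auto simp: Ck_def)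
    then have "continuous_on UNIV (\<lambda>x. iter_deriv f vs (s *\<^sub>R (x - a)))"
      by (rule continuous_on_compose2) (auto intro!: continuous_intros)
    then show "continuous_on UNIV (iter_deriv (\<lambda>x. f (s *\<^sub>R (x - a))) vs)"
      using l by (subst eq) (auto intro!: continuous_intros)
  qed
qed

section \<open>Analytic maps are of class C^k for every k\<close>

lemma sanalytic_frechet_derivative:
  fixes f :: "'a::real_or_complex^'m \<Rightarrow> 'a"
  assumes "sanalytic f a"
  shows "f differentiable (at a)" "sanalytic (\<lambda>x. frechet_derivative f (at x) v) a"
proof -
  obtain D where D: "\<And>i. sanalytic (D i) a"
    "\<forall>\<^sub>F x in nhds a. (f has_derivative (\<lambda>h. \<Sum>i\<in>UNIV. D i x * h $ i)) (at x)"
    using sanalytic_has_derivative[OF assms] by blast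
  show "f differentiable (at a)"
    using eventually_nhds_x_imp_x[OF D(2)] by (auto simp: differentiable_def)
  have "sanalytic (\<lambda>x. \<Sum>i\<in>UNIV. D i x * v $ i) a"
    by (intro sanalytic_sum sanalytic_mult D sanalytic_const) auto
  moreover have "\<forall>\<^sub>F x in nhds a. (\<Sum>i\<in>UNIV. D i x * v $ i) = frechet_derivative f (at x) v"
    using D(2) by eventually_elim (metis frechet_derivative_at)
  ultimately show "sanalytic (\<lambda>x. frechet_derivative f (at x) v) a"
    by (rule sanalytic_cong)
qed

lemma sanalytic_imp_Ck:
  fixes f :: "'a::real_or_complex^'m \<Rightarrow> 'a"
  assumes "open U" "\<And>x. x \<in> U \<Longrightarrow> sanalytic f x"
  shows "Ck k U f"
  using assms(2)
proof (induction k arbitrary: f)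
  case 0
  then show ?case
    using assms(1) sanalytic_frechet_derivative(1)
    by (auto simp: Ck_0 continuous_on_eq_continuous_at intro!: differentiable_imp_continuous_within)
next
  case (Suc k)
  then show ?case
    unfolding Ck_Suc[OF assms(1)] using sanalytic_frechet_derivative by blast
qed

lemma bounded_linear_axis: "bounded_linear (\<lambda>y. axis i y :: 'a::euclidean_space^'l)"
  unfolding linear_conv_bounded_linear[symmetric]
  by (rule linearI) (auto simp: axis_def vec_eq_iff)

lemma sum_axis: "(\<Sum>i\<in>UNIV. axis i (x $ i)) = (x :: 'a::comm_monoid_add^'l)"
  by (simp add: vec_eq_iff axis_def if_distrib cong: if_cong)

lemma analytic_imp_Ck:
  fixes f :: "'a::real_or_complex^'m \<Rightarrow> 'a^'l"
  assumes "open U" "\<And>x. x \<in> U \<Longrightarrow> analytic_near f x"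
  shows "Ck k U f"
proof -
  have "Ck k U (\<lambda>x. \<Sum>i\<in>UNIV. axis i (f x $ i))"
    using assms by (intro Ck_sum Ck_compose_bounded_linear[OF _ bounded_linear_axis] sanalytic_imp_Ck)
      (auto simp: analytic_near_iff_sanalytic)
  then show ?thesis by (simp add: sum_axis)
qed

lemma analytic_near_eventually:
  fixes f :: "'a::real_or_complex^'m \<Rightarrow> 'a^'l"
  assumes "analytic_near f a"
  shows "\<forall>\<^sub>F x in nhds a. analytic_near f x"
  using assms unfolding analytic_near_iff_sanalytic
  by (intro eventually_all_finite) (auto intro: sanalytic_eventually)

lemma analytic_near_open:
  fixes f :: "'a::real_or_complex^'m \<Rightarrow> 'a^'l"
  assumes "analytic_near f a"
  obtains U where "open U" "a \<in> U" "\<And>x. x \<in> U \<Longrightarrow> analytic_near f x"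
  using analytic_near_eventually[OF assms] unfolding eventually_nhds by blast

text \<open>The derivative is given by a matrix over the ground field, so it is linear over that
  field and not just over the reals. Tangent spaces inherit this through the charts.\<close>

lemma analytic_near_has_derivative:
  fixes f :: "'a::real_or_complex^'m \<Rightarrow> 'a^'l"
  assumes "analytic_near f a"
  obtains D where "(f has_derivative D) (at a)" "Vector_Spaces.linear (*s) (*s) D"
proof -
  have "\<exists>d. ((\<lambda>x. f x $ i) has_derivative (\<lambda>h. \<Sum>j\<in>UNIV. d j * h $ j)) (at a)" for i
  proof -
    have "sanalytic (\<lambda>x. f x $ i) a" using assms by (simp add: analytic_near_iff_sanalytic)
    from sanalytic_has_derivative[OF this] obtain D where
      "\<forall>\<^sub>F x in nhds a. ((\<lambda>x. f x $ i) has_derivative (\<lambda>h. \<Sum>j\<in>UNIV. D j x * h $ j)) (at x)" .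
    from eventually_nhds_x_imp_x[OF this] show ?thesis by (intro exI[of _ "\<lambda>j. D j a"])
  qed
  then obtain d where d: "\<And>i. ((\<lambda>x. f x $ i) has_derivative (\<lambda>h. \<Sum>j\<in>UNIV. d i j * h $ j)) (at a)"
    by metis
  have "((\<lambda>x. \<Sum>i\<in>UNIV. axis i (f x $ i)) has_derivative (\<lambda>h. \<Sum>i\<in>UNIV. axis i (\<Sum>j\<in>UNIV. d i j * h $ j))) (at a)"
    by (intro has_derivative_sum bounded_linear.has_derivative[OF bounded_linear_axis] d)
  then have "(f has_derivative (\<lambda>h. \<Sum>i\<in>UNIV. axis i (\<Sum>j\<in>UNIV. d i j * h $ j))) (at a)"
    by (simp add: sum_axis)
  moreover have "(\<lambda>h. \<Sum>i\<in>UNIV. axis i (\<Sum>j\<in>UNIV. d i j * h $ j)) = (*v) (\<chi> i j. d i j)"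
    by (auto simp: fun_eq_iff vec_eq_iff axis_def matrix_vector_mult_def if_distrib cong: if_cong)
  ultimately show thesis using that matrix_vector_mul_linear_gen by metis
qed

lemma linear_norm_le_Basis:
  fixes L :: "'v::euclidean_space \<Rightarrow> 'w::real_normed_vector"
  assumes "linear L" "\<And>b. b \<in> Basis \<Longrightarrow> norm (L b) \<le> K / DIM('v)"
  shows "norm (L v) \<le> K * norm v"
proof -
  have "L v = (\<Sum>b\<in>Basis. (v \<bullet> b) *\<^sub>R L b)"
    by (subst euclidean_representation[of v, symmetric])
      (simp only: linear_sum[OF assms(1), unfolded o_def] linear_scale[OF assms(1)])
  also have "norm \<dots> \<le> (\<Sum>b\<in>(Basis :: 'v set). norm v * (K / DIM('v)))"
  proof (rule sum_norm_le)
    fix b :: 'v assume b: "b \<in> Basis"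
    show "norm ((v \<bullet> b) *\<^sub>R L b) \<le> norm v * (K / DIM('v))"
      unfolding norm_scaleR using Basis_le_norm[OF b, of v] assms(2)[OF b] by (intro mult_mono) auto
  qed
  finally show ?thesis by (simp add: mult.commute)
qed

text \<open>Downward induction on the order. At order r it is continuity with value 0; each lower
  order follows from the next one by the mean value inequality on the ball of radius |x|, which
  gains a factor |x|. The arbitrary \<open>\<eta>\<close> encodes o(|x|^(r-j)).\<close>

lemma zero_jet_bound:
  fixes p :: "'v::euclidean_space \<Rightarrow> 'w::real_normed_vector"
  assumes "open U" "0 \<in> U" "Ck r U p" "\<And>vs. length vs \<le> r \<Longrightarrow> iter_deriv p vs 0 = 0"
    and "length vs \<le> r" "\<eta> > 0"
  shows "\<forall>\<^sub>F x in nhds 0. norm (iter_deriv p vs x) \<le> \<eta> * norm x ^ (r - length vs)"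
  using assms(5,6)
proof (induction "r - length vs" arbitrary: vs \<eta>)
  case 0
  then have "continuous_on U (iter_deriv p vs)" using assms(3) by (auto simp: Ck_def)
  then have "continuous (at 0) (iter_deriv p vs)"
    using assms(1,2) by (simp add: continuous_on_eq_continuous_at)
  then have "(iter_deriv p vs \<longlongrightarrow> iter_deriv p vs 0) (nhds 0)"
    by (simp add: continuous_at tendsto_at_iff_tendsto_nhds)
  then have "\<forall>\<^sub>F x in nhds 0. dist (iter_deriv p vs x) (iter_deriv p vs 0) < \<eta>"
    using 0 by (intro tendstoD)
  then show ?case
    by eventually_elim (use 0 assms(4)[of vs] in \<open>simp add: dist_norm\<close>)
next
  case (Suc m)
  then have l: "length vs < r" "r - length vs = Suc m" by auto
  have "\<forall>\<^sub>F x in nhds 0. norm (iter_deriv p (b # vs) x) \<le> (\<eta> / DIM('v)) * norm x ^ m" for b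
  proof -
    have e: "r - length (b # vs) = m" "length (b # vs) \<le> r" using l by auto
    show ?thesis
      using Suc.hyps(1)[OF e(1)[symmetric] e(2), of "\<eta> / DIM('v)"] Suc.prems unfolding e(1) by simp
  qed
  then have "\<forall>\<^sub>F x in nhds 0. \<forall>b\<in>Basis. norm (iter_deriv p (b # vs) x) \<le> (\<eta> / DIM('v)) * norm x ^ m"
    by (subst eventually_ball_finite_distrib) auto
  moreover have "\<forall>\<^sub>F x in nhds 0. x \<in> U" using assms(1,2) eventually_nhds_in_open by blast
  ultimately have "\<forall>\<^sub>F x in nhds 0. x \<in> U \<and> (\<forall>b\<in>Basis. norm (iter_deriv p (b # vs) x) \<le> (\<eta> / DIM('v)) * norm x ^ m)"
    by eventually_elim auto
  from this[unfolded eventually_nhds_metric] obtain \<delta> where d: "\<delta> > 0 \<and> (\<forall>x. dist x 0 < \<delta> \<longrightarrow> x \<in> U \<and>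
      (\<forall>b\<in>Basis. norm (iter_deriv p (b # vs) x) \<le> (\<eta> / DIM('v)) * norm x ^ m))" ..
  have \<delta>: "\<delta> > 0" "\<And>x. norm x < \<delta> \<Longrightarrow> x \<in> U"
    "\<And>x b. norm x < \<delta> \<Longrightarrow> b \<in> Basis \<Longrightarrow> norm (iter_deriv p (b # vs) x) \<le> (\<eta> / DIM('v)) * norm x ^ m"
    using d by (simp_all only: dist_norm diff_zero)
  have "norm (iter_deriv p vs x) \<le> \<eta> * norm x ^ Suc m" if x: "norm x < \<delta>" for x
  proof -
    have der: "(iter_deriv p vs has_derivative (\<lambda>v. iter_deriv p (v # vs) y)) (at y within cball 0 (norm x))"
      if "y \<in> cball 0 (norm x)" for y
      by (rule has_derivative_at_withinI, rule iter_deriv_has_derivative[OF assms(3) l(1)], rule \<delta>(2))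
        (use that x in simp)
    have on: "onorm (\<lambda>v. iter_deriv p (v # vs) y) \<le> \<eta> * norm x ^ m" if y: "y \<in> cball 0 (norm x)" for y
    proof (rule onorm_bound)
      show "0 \<le> \<eta> * norm x ^ m" using Suc.prems by simp
      fix v :: 'v
      have lin: "linear (\<lambda>v. iter_deriv p (v # vs) y)"
        by (rule has_derivative_linear[OF der[OF y]])
      show "norm (iter_deriv p (v # vs) y) \<le> \<eta> * norm x ^ m * norm v"
      proof (rule linear_norm_le_Basis[OF lin])
        fix b :: 'v assume b: "b \<in> Basis"
        have "norm y < \<delta>" using y x by simp
        have "norm (iter_deriv p (b # vs) y) \<le> (\<eta> / DIM('v)) * norm y ^ m"
          by (rule \<delta>(3)[OF \<open>norm y < \<delta>\<close> b])
        also have "\<dots> \<le> (\<eta> / DIM('v)) * norm x ^ m"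
          using y Suc.prems by (intro mult_left_mono power_mono) auto
        finally show "norm (iter_deriv p (b # vs) y) \<le> \<eta> * norm x ^ m / DIM('v)" by simp
      qed
    qed
    have "norm (iter_deriv p vs x - iter_deriv p vs 0) \<le> \<eta> * norm x ^ m * norm (x - 0)"
      by (rule differentiable_bound[OF convex_cball der on]) auto
    then show ?thesis using assms(4)[of vs] l by (simp add: mult_ac)
  qed
  then show ?case
    unfolding eventually_nhds_metric l(2) using \<delta>(1) by (intro exI[of _ \<delta>]) auto
qed

section \<open>Cut-off functions of finite smoothness\<close>

lemma DERIV_max_0_power:
  "((\<lambda>t :: real. (max 0 t) ^ Suc (Suc n)) has_real_derivative real (Suc (Suc n)) * (max 0 t) ^ Suc n) (at t)"
proof -
  consider "t > 0" | "t < 0" | "t = 0" by linarith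
  then show ?thesis
  proof cases
    case 1
    have "((\<lambda>t :: real. t ^ Suc (Suc n)) has_real_derivative real (Suc (Suc n)) * t ^ Suc n) (at t)"
      using DERIV_pow[of "Suc (Suc n)" t] by simp
    then have "((\<lambda>t :: real. (max 0 t) ^ Suc (Suc n)) has_real_derivative real (Suc (Suc n)) * t ^ Suc n) (at t)"
      by (rule has_field_derivative_transform_within_open[where S = "{0<..}"]) (use 1 in auto)
    then show ?thesis using 1 by (simp add: max_def)
  next
    case 2
    have "((\<lambda>t :: real. 0) has_real_derivative 0) (at t)" by simp
    then have "((\<lambda>t :: real. (max 0 t) ^ Suc (Suc n)) has_real_derivative 0) (at t)"
      by (rule has_field_derivative_transform_within_open[where S = "{..<0}"]) (use 2 in \<open>auto simp: max_def\<close>)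
    then show ?thesis using 2 by (simp add: max_def)
  next
    case 3
    have "((\<lambda>h :: real. (max 0 h) ^ Suc (Suc n) / h) \<longlongrightarrow> 0) (at 0)"
    proof (rule Lim_null_comparison)
      show "\<forall>\<^sub>F h :: real in at 0. norm ((max 0 h) ^ Suc (Suc n) / h) \<le> \<bar>h\<bar> ^ Suc n"
        by (rule always_eventually) (auto simp: max_def power_abs intro: mult_nonpos_nonneg)
      have "((\<lambda>h :: real. \<bar>h\<bar> ^ Suc n) \<longlongrightarrow> \<bar>0\<bar> ^ Suc n) (at 0)"
        by (intro tendsto_intros)
      then show "((\<lambda>h :: real. \<bar>h\<bar> ^ Suc n) \<longlongrightarrow> 0) (at 0)" by simp
    qed
    then show ?thesis using 3 by (simp add: DERIV_def)
  qed
qed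

text \<open>Differentiation lowers the exponent by one and multiplies by a derivative of
  \<open>s\<close>, so k + 1 powers suffice for class C^k.\<close>

lemma Ck_max_0_power:
  fixes s :: "'v::real_normed_vector \<Rightarrow> real"
  assumes s: "\<And>k. Ck k UNIV s"
  shows "Ck k UNIV (\<lambda>z. (max 0 (s z)) ^ Suc k)"
proof (induction k)
  case 0
  have "continuous_on UNIV s" using s Ck_imp_continuous by blast
  then show ?case by (auto simp: Ck_0 intro!: continuous_intros)
next
  case (Suc k)
  show ?case
  proof (rule Ck_SucI)
    fix z
    show "((\<lambda>z. (max 0 (s z)) ^ Suc (Suc k)) has_derivative
      (\<lambda>v. (real (Suc (Suc k)) * (max 0 (s z)) ^ Suc k) * frechet_derivative s (at z) v)) (at z)"
      using has_derivative_compose[OF Ck_SucD(1)[OF open_UNIV s UNIV_I] DERIV_max_0_power[of k, unfolded has_field_derivative_def]]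
      by simp
  next
    fix v
    have "Ck k UNIV (\<lambda>z. (max 0 (s z)) ^ Suc k *\<^sub>R (real (Suc (Suc k)) *\<^sub>R frechet_derivative s (at z) v))"
      by (intro Ck_scaleR Suc.IH Ck_compose_bounded_linear[OF _ bounded_linear_scaleR_right] Ck_SucD(2)[OF _ s]) auto
    then show "Ck k UNIV (\<lambda>z. (real (Suc (Suc k)) * (max 0 (s z)) ^ Suc k) * frechet_derivative s (at z) v)"
      by (simp add: mult_ac)
  qed auto
qed

text \<open>A truncated polynomial is enough as a cut-off, since only finitely many derivatives are
  used. The factor 16 puts the support into radius 1/4, and the exponent k + 2 leaves at least two
  powers for \<open>DERIV_max_0_power\<close> even when k = 0.\<close>

definition bump :: "nat \<Rightarrow> 'v::euclidean_space \<Rightarrow> real" where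
  "bump k z = (max 0 (1 - 16 * (z \<bullet> z))) ^ Suc (Suc k)"

lemma Ck_bump: "Ck k UNIV (bump k)"
proof -
  have "Ck j UNIV (\<lambda>z :: 'a. z \<bullet> z)" for j
  proof (cases j)
    case 0
    then show ?thesis by (auto simp: Ck_0 intro!: continuous_intros)
  next
    case (Suc i)
    show ?thesis unfolding Suc
    proof (rule Ck_SucI)
      show "((\<lambda>z :: 'a. z \<bullet> z) has_derivative (\<lambda>v. 2 * (x \<bullet> v))) (at x)" for x
        by (auto intro!: derivative_eq_intros simp: inner_commute)
      show "Ck i UNIV (\<lambda>x. 2 * (x \<bullet> v))" for v :: 'a
        by (rule Ck_bounded_linear) (auto intro!: bounded_linear_intros)
    qed auto
  qed
  then have "Ck j UNIV (\<lambda>z :: 'a. 1 - 16 *\<^sub>R (z \<bullet> z))" for j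
    by (intro Ck_diff Ck_const Ck_compose_bounded_linear[OF _ bounded_linear_scaleR_right]) auto
  from Ck_mono[OF Ck_max_0_power[OF this, of "Suc k"]] show ?thesis
    by (simp add: bump_def[abs_def])
qed

lemma bump_0: "bump k 0 = 1"
  by (simp add: bump_def)

lemma bump_eq_0: "norm z \<ge> 1/4 \<Longrightarrow> bump k z = 0"
proof -
  assume "norm z \<ge> 1/4"
  then have "(1/4)\<^sup>2 \<le> (norm z)\<^sup>2" by (intro power_mono) auto
  then have "1/16 \<le> z \<bullet> z" by (simp add: power2_norm_eq_inner power_divide)
  then have "1 - 16 * (z \<bullet> z) \<le> 0" by simp
  then show ?thesis by (simp add: bump_def)
qed

lemma bump_derivative_0: "(bump k has_derivative (\<lambda>v. 0)) (at (0 :: 'v::euclidean_space))"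
proof -
  have 1: "((\<lambda>z :: 'v. 1 - 16 * (z \<bullet> z)) has_derivative (\<lambda>v. 0)) (at 0)"
    by (auto intro!: derivative_eq_intros)
  from has_derivative_compose[OF 1 DERIV_max_0_power[of k, unfolded has_field_derivative_def]]
  show ?thesis by (simp add: bump_def[abs_def])
qed

lemma iter_deriv_outside:
  fixes G :: "'v::euclidean_space \<Rightarrow> 'w::real_normed_vector"
  assumes "\<And>z. norm z \<ge> 1/4 \<Longrightarrow> G z = 0" "norm z > 1/4"
  shows "iter_deriv G vs z = 0"
proof -
  have "iter_deriv G vs z = iter_deriv (\<lambda>x. 0) vs z"
    by (rule iter_deriv_cong[where U = "- cball 0 (1/4)"]) (use assms in auto)
  then show ?thesis by (simp add: iter_deriv_zero)
qed

lemma iter_deriv_compact_support_bound: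
  fixes G :: "'v::euclidean_space \<Rightarrow> 'w::real_normed_vector"
  assumes "\<And>z. norm z \<ge> 1/4 \<Longrightarrow> G z = 0" "Ck k UNIV G" "length vs \<le> k"
  obtains M where "M > 0" "\<And>z. norm (iter_deriv G vs z) \<le> M"
proof -
  have "continuous_on (cball 0 (1/4)) (iter_deriv G vs)"
    using assms(2,3) unfolding Ck_def by (meson continuous_on_subset subset_UNIV)
  then have "bounded (iter_deriv G vs ` cball 0 (1/4))"
    by (intro compact_imp_bounded compact_continuous_image) auto
  then obtain M where M: "M > 0" "\<And>z. z \<in> cball 0 (1/4) \<Longrightarrow> norm (iter_deriv G vs z) \<le> M"
    unfolding bounded_pos by auto
  have "norm (iter_deriv G vs z) \<le> M" for z
    using M iter_deriv_outside[of G z vs] assms(1) by (cases "norm z > 1/4") auto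
  with M(1) that show thesis by blast
qed

section \<open>Interpolation by a map with vanishing jet\<close>

lemma Ck_bump_affine:
  fixes b :: "'w::real_normed_vector" and A :: "'v::euclidean_space \<Rightarrow> 'w"
  assumes "linear A"
  shows "Ck k UNIV (\<lambda>z. bump k z *\<^sub>R (b + A z))"
  using assms
  by (intro Ck_scaleR Ck_bump Ck_add Ck_const Ck_bounded_linear) (auto simp: linear_conv_bounded_linear)

text \<open>The point is that \<open>K\<close> depends on neither \<open>b\<close> nor
  \<open>A\<close>. Expanding \<open>A\<close> in the basis reduces the bound to finitely many fixed
  compactly supported functions: the bump and its products with the coordinates.\<close>

lemma bump_affine_deriv_bound:
  fixes vs :: "'v::euclidean_space list"
  assumes "length vs \<le> k"
  obtains K where "K > 0"
    "\<And>(b :: 'w::real_normed_vector) (A :: 'v \<Rightarrow> 'w) \<epsilon> z. \<lbrakk>linear A; norm b \<le> \<epsilon>; \<And>v. norm (A v) \<le> \<epsilon> * norm v\<rbrakk> \<Longrightarrow>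
       norm (iter_deriv (\<lambda>z. bump k z *\<^sub>R (b + A z)) vs z) \<le> K * \<epsilon>"
proof -
  obtain M0 where M0: "M0 > 0" "\<And>z :: 'v. norm (iter_deriv (bump k) vs z) \<le> M0"
    by (rule iter_deriv_compact_support_bound[OF bump_eq_0 Ck_bump assms]) auto
  have C1: "Ck k UNIV (\<lambda>z :: 'v. bump k z *\<^sub>R (z \<bullet> e))" for e
    by (intro Ck_scaleR Ck_bump Ck_bounded_linear) (auto intro: bounded_linear_inner_left)
  have "\<exists>M. M > 0 \<and> (\<forall>z :: 'v. norm (iter_deriv (\<lambda>z. bump k z *\<^sub>R (z \<bullet> e)) vs z) \<le> M)" for e
    using iter_deriv_compact_support_bound[OF _ C1 assms, of e] bump_eq_0 by (metis scaleR_zero_left)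
  then obtain M where M: "\<And>e. M e > 0" "\<And>e z :: 'v. norm (iter_deriv (\<lambda>z. bump k z *\<^sub>R (z \<bullet> e)) vs z) \<le> M e"
    by metis
  have Msum: "(\<Sum>e\<in>Basis. M e) \<ge> 0" by (rule sum_nonneg) (use M in \<open>auto intro: less_imp_le\<close>)
  show thesis
  proof (rule that[of "M0 + (\<Sum>e\<in>Basis. M e)"])
    show "M0 + (\<Sum>e\<in>Basis. M e) > 0" using M0(1) Msum by simp
    fix b :: 'w and A :: "'v \<Rightarrow> 'w" and \<epsilon> and z :: 'v
    assume A: "linear A" "norm b \<le> \<epsilon>" "\<And>v. norm (A v) \<le> \<epsilon> * norm v"
    have "\<epsilon> \<ge> 0" using A(2) norm_ge_zero order_trans by blast
    have e: "(\<lambda>z. bump k z *\<^sub>R (b + A z)) = (\<lambda>z. bump k z *\<^sub>R b + (\<Sum>e\<in>Basis. (bump k z *\<^sub>R (z \<bullet> e)) *\<^sub>R A e))"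
    proof
      fix z :: 'v
      have "A z = (\<Sum>e\<in>Basis. (z \<bullet> e) *\<^sub>R A e)"
        by (subst euclidean_representation[of z, symmetric])
          (simp only: linear_sum[OF A(1), unfolded o_def] linear_scale[OF A(1)])
      then show "bump k z *\<^sub>R (b + A z) = bump k z *\<^sub>R b + (\<Sum>e\<in>Basis. (bump k z *\<^sub>R (z \<bullet> e)) *\<^sub>R A e)"
        by (simp add: scaleR_add_right scaleR_sum_right)
    qed
    have bl: "bounded_linear (\<lambda>t. t *\<^sub>R (w :: 'w))" for w by (rule bounded_linear_scaleR_left)
    have Cs: "Ck k UNIV (\<lambda>z. bump k z *\<^sub>R b)"
      "\<And>e. Ck k UNIV (\<lambda>z. (bump k z *\<^sub>R (z \<bullet> e)) *\<^sub>R A e)"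
      by (intro Ck_compose_bounded_linear[OF open_UNIV bl] Ck_bump C1)+
    have "iter_deriv (\<lambda>z. bump k z *\<^sub>R (b + A z)) vs z =
      iter_deriv (bump k) vs z *\<^sub>R b + (\<Sum>e\<in>Basis. iter_deriv (\<lambda>z. bump k z *\<^sub>R (z \<bullet> e)) vs z *\<^sub>R A e)"
    proof -
      have "iter_deriv (\<lambda>z. bump k z *\<^sub>R (b + A z)) vs z = iter_deriv (\<lambda>z. bump k z *\<^sub>R b) vs z +
          iter_deriv (\<lambda>z. \<Sum>e\<in>Basis. (bump k z *\<^sub>R (z \<bullet> e)) *\<^sub>R A e) vs z"
        unfolding e by (rule iter_deriv_add[OF open_UNIV Cs(1) Ck_sum[OF open_UNIV finite_Basis Cs(2)] assms UNIV_I])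
      also have "iter_deriv (\<lambda>z. bump k z *\<^sub>R b) vs z = iter_deriv (bump k) vs z *\<^sub>R b"
        by (rule iter_deriv_compose_bounded_linear[OF open_UNIV Ck_bump bl assms UNIV_I])
      also have "iter_deriv (\<lambda>z. \<Sum>e\<in>Basis. (bump k z *\<^sub>R (z \<bullet> e)) *\<^sub>R A e) vs z =
          (\<Sum>e\<in>Basis. iter_deriv (\<lambda>z. (bump k z *\<^sub>R (z \<bullet> e)) *\<^sub>R A e) vs z)"
        by (rule iter_deriv_sum[OF open_UNIV finite_Basis Cs(2) assms UNIV_I])
      also have "\<dots> = (\<Sum>e\<in>Basis. iter_deriv (\<lambda>z. bump k z *\<^sub>R (z \<bullet> e)) vs z *\<^sub>R A e)"
        by (rule sum.cong[OF refl iter_deriv_compose_bounded_linear[OF open_UNIV C1 bl assms UNIV_I]])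
      finally show ?thesis .
    qed
    also have "norm \<dots> \<le> M0 * \<epsilon> + (\<Sum>e\<in>Basis. M e * \<epsilon>)"
    proof (intro norm_triangle_mono sum_norm_le)
      show "norm (iter_deriv (bump k) vs z *\<^sub>R b) \<le> M0 * \<epsilon>"
        using M0 A(2) unfolding norm_scaleR by (intro mult_mono) (auto intro: less_imp_le)
      fix e :: 'v assume "e \<in> Basis"
      then have "norm (A e) \<le> \<epsilon>" using A(3)[of e] by simp
      then show "norm (iter_deriv (\<lambda>z. bump k z *\<^sub>R (z \<bullet> e)) vs z *\<^sub>R A e) \<le> M e * \<epsilon>"
        using M[of e] unfolding norm_scaleR by (intro mult_mono) (auto intro: less_imp_le)
    qed
    finally show "norm (iter_deriv (\<lambda>z. bump k z *\<^sub>R (b + A z)) vs z) \<le> (M0 + (\<Sum>e\<in>Basis. M e)) * \<epsilon>"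
      by (simp add: distrib_right sum_distrib_right)
  qed
qed

text \<open>Local corrections \<open>b + A (x - x\<^sub>n)\<close>, cut off at scale \<open>norm x\<^sub>n\<close>, along a sequence
  of points tending to \<open>0\<close> so fast that their supports are disjoint.\<close>

lemma zero_jet_interpolation:
  fixes P :: "'v::euclidean_space \<Rightarrow> 'w::real_normed_vector \<Rightarrow> ('v \<Rightarrow> 'w) \<Rightarrow> bool"
  assumes "r > 0"
    and ex: "\<And>\<epsilon>. \<epsilon> > 0 \<Longrightarrow> \<exists>x b A. x \<noteq> 0 \<and> norm x < \<epsilon> \<and> norm b \<le> \<epsilon> * norm x ^ r \<and> linear A \<and>
      (\<forall>v. norm (A v) \<le> \<epsilon> * norm x ^ (r - 1) * norm v) \<and> P x b A"
  obtains p where "Ck r UNIV p" "\<And>vs. length vs \<le> r \<Longrightarrow> iter_deriv p vs 0 = 0"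
    "\<And>\<epsilon>. \<epsilon> > 0 \<Longrightarrow> \<exists>x A. x \<noteq> 0 \<and> norm x < \<epsilon> \<and> (p has_derivative A) (at x) \<and> P x (p x) A"
proof -
  define Q where "Q n t \<longleftrightarrow> (case t of (x, b, A) \<Rightarrow> x \<noteq> 0 \<and> norm x < 1 / Suc n \<and>
      norm b \<le> 1 / Suc n * norm x ^ r \<and> linear A \<and>
      (\<forall>v. norm (A v) \<le> 1 / Suc n * norm x ^ (r - 1) * norm v) \<and> P x b A)" for n :: nat and t
  have Qex: "\<exists>t. Q n t \<and> norm (fst t) < \<delta>" if "\<delta> > 0" for n \<delta>
  proof -
    define \<epsilon> where "\<epsilon> = min \<delta> (1 / Suc n)"
    have "\<epsilon> > 0" using that by (simp add: \<epsilon>_def)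
    from ex[OF this] obtain x b A where t: "x \<noteq> 0" "norm x < \<epsilon>" "norm b \<le> \<epsilon> * norm x ^ r" "linear A"
      "\<And>v. norm (A v) \<le> \<epsilon> * norm x ^ (r - 1) * norm v" "P x b A" by blast
    have le: "\<epsilon> \<le> 1 / Suc n" by (simp add: \<epsilon>_def)
    have "norm b \<le> 1 / Suc n * norm x ^ r"
      by (rule order_trans[OF t(3)]) (intro mult_right_mono le, simp)
    moreover have "norm (A v) \<le> 1 / Suc n * norm x ^ (r - 1) * norm v" for v
      by (rule order_trans[OF t(5)]) (intro mult_right_mono le, simp_all)
    ultimately have "Q n (x, b, A)"
      using t le unfolding Q_def by auto
    then show ?thesis using t(2) by (intro exI[of _ "(x, b, A)"]) (simp add: \<epsilon>_def)
  qed
  \<comment> \<open>Every point is chosen more than four times closer to 0 than its predecessor; the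
    n-th choice uses tolerance 1 / (n + 1).\<close>
  have "\<exists>f. \<forall>n. Q n (f n) \<and> norm (fst (f (Suc n))) < norm (fst (f n)) / 4"
  proof (rule dependent_nat_choice)
    show "\<exists>t. Q 0 t" using Qex[of 1 0] by auto
    fix t n assume "Q n t"
    then have "norm (fst t) / 4 > 0" by (auto simp: Q_def split: prod.splits)
    from Qex[OF this] show "\<exists>u. Q (Suc n) u \<and> norm (fst u) < norm (fst t) / 4" .
  qed
  then obtain f where f: "\<And>n. Q n (f n)" "\<And>n. norm (fst (f (Suc n))) < norm (fst (f n)) / 4"
    by blast
  define c b A s where "c n = fst (f n)" and "b n = fst (snd (f n))" and "A n = snd (snd (f n))"
    and "s n = norm (fst (f n))" for n
  have c: "norm (c n) = s n" "s n > 0" "s n < 1 / Suc n" "norm (b n) \<le> 1 / Suc n * s n ^ r"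
    "linear (A n)" "norm (A n v) \<le> 1 / Suc n * s n ^ (r - 1) * norm v" "P (c n) (b n) (A n)" for n v
    using f(1)[of n] unfolding Q_def c_def b_def A_def s_def by (auto split: prod.splits)
  have sS: "s (Suc n) < s n / 4" for n using f(2) by (simp add: s_def)
  have s4: "s m < s n / 4" if "n < m" for n m
    using that
  proof (induction m)
    case (Suc m)
    show ?case
    proof (cases "n = m")
      case False
      then have "s m < s n / 4" using Suc by simp
      moreover have "s (Suc m) < s m / 4" "s m > 0" using sS c by auto
      ultimately show ?thesis by linarith
    qed (use sS in simp)
  qed simp
  \<comment> \<open>The linear part is brought to unit scale. It and \<open>b n\<close> then have
    the same size s_n^r / (n + 1), as required by the uniform bound on the pieces.\<close>
  define A' where "A' n v = A n (s n *\<^sub>R v)" for n v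
  have A': "linear (A' n)" "norm (b n) \<le> s n ^ r / Suc n" "norm (A' n v) \<le> s n ^ r / Suc n * norm v" for n v
  proof -
    show "linear (A' n)" using linear_compose[OF linear_scaleR c(5)[of n]] by (simp add: A'_def[abs_def] o_def)
    show "norm (b n) \<le> s n ^ r / Suc n" using c(4)[of n] by simp
    have "s n ^ r = s n ^ (r - 1) * s n" using \<open>r > 0\<close> by (metis Suc_pred' power_Suc2)
    then show "norm (A' n v) \<le> s n ^ r / Suc n * norm v"
      using c(6)[of n "s n *\<^sub>R v"] c(2)[of n] by (simp add: A'_def mult_ac)
  qed
  define G where "G n z = bump r z *\<^sub>R (b n + A' n z)" for n z
  define piece where "piece n x = G n ((1 / s n) *\<^sub>R (x - c n))" for n x
  \<comment> \<open>The balls are pairwise disjoint, so the sum has at most one term at every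
    point.\<close>
  define p where "p x = (\<Sum>n | x \<in> ball (c n) (s n / 4). piece n x)" for x
  have CG: "Ck r UNIV (G n)" for n unfolding G_def[abs_def] by (rule Ck_bump_affine[OF A'(1)])
  have Cpiece: "Ck r UNIV (piece n)" for n unfolding piece_def[abs_def] by (rule Ck_rescale[OF CG])
  have piece0: "piece n x = 0" if "x \<notin> ball (c n) (s n / 4)" for n x
  proof -
    have "norm ((1 / s n) *\<^sub>R (x - c n)) = norm (x - c n) / s n" using c(2)[of n] by simp
    moreover have "norm (x - c n) \<ge> s n / 4" using that by (simp add: dist_norm norm_minus_commute)
    ultimately have "norm ((1 / s n) *\<^sub>R (x - c n)) \<ge> 1/4" using c(2)[of n] by (simp add: pos_le_divide_eq)
    then show ?thesis by (simp add: piece_def G_def bump_eq_0)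
  qed
  have annulus: "3/4 * s n < norm y" "norm y < 5/4 * s n" if "y \<in> ball (c n) (s n / 4)" for n y
    using that c(1)[of n] norm_triangle_ineq2[of "c n" y] norm_triangle_ineq2[of y "c n"]
    by (auto simp: dist_norm norm_minus_commute)
  \<comment> \<open>Radii of different indices differ by a factor of more than 4, so comparable
    radii belong to the same index.\<close>
  have near: "n = m" if "s n < 4 * s m" "s m < 4 * s n" for n m
    using s4[of n m] s4[of m n] that by (cases n m rule: linorder_cases) auto
  have p_eq: "p y = piece n y" if "\<And>m. y \<in> ball (c m) (s m / 4) \<Longrightarrow> m = n" for y n
  proof (cases "y \<in> ball (c n) (s n / 4)")
    case True
    then have "{m. y \<in> ball (c m) (s m / 4)} = {n}" using that by blast
    then show ?thesis unfolding p_def by simp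
  next
    case False
    then have e: "{m. y \<in> ball (c m) (s m / 4)} = {}" using that by blast
    show ?thesis unfolding p_def e using piece0[OF False] by simp
  qed
  \<comment> \<open>A piece that meets the ball of radius |x|/4 around x has s_n between 3/5 |x| and
    5/3 |x|. Two such radii have ratio below 25/9 < 4, so only one piece is visible near x and p is
    locally that piece or 0.\<close>
  have near_cases: "(\<forall>y\<in>ball x (norm x / 4). p y = 0) \<or>
     (\<exists>n. s n < 2 * norm x \<and> (\<forall>y\<in>ball x (norm x / 4). p y = piece n y))" if "x \<noteq> 0" for x
  proof -
    have R: "s n < 5/3 * norm x \<and> 3/5 * norm x < s n" if "y \<in> ball x (norm x / 4)" "y \<in> ball (c n) (s n / 4)" for y n
    proof -
      have "3/4 * norm x < norm y" "norm y < 5/4 * norm x"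
        using that(1) norm_triangle_ineq2[of x y] norm_triangle_ineq2[of y x]
        by (auto simp: dist_norm norm_minus_commute)
      then show ?thesis using annulus[OF that(2)] by linarith
    qed
    show ?thesis
    proof (cases "\<exists>n. \<exists>y\<in>ball x (norm x / 4). y \<in> ball (c n) (s n / 4)")
      case True
      then obtain n y where n: "y \<in> ball x (norm x / 4)" "y \<in> ball (c n) (s n / 4)" by blast
      have "p z = piece n z" if "z \<in> ball x (norm x / 4)" for z
      proof (rule p_eq)
        fix m assume m: "z \<in> ball (c m) (s m / 4)"
        have "norm x > 0" using \<open>x \<noteq> 0\<close> by simp
        with R[OF n] R[OF that m] have "s m < 4 * s n" "s n < 4 * s m" by linarith+
        then show "m = n" by (rule near)
      qed
      moreover have "s n < 2 * norm x" using R[OF n] \<open>x \<noteq> 0\<close> zero_less_norm_iff[of x] by linarith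
      ultimately show ?thesis by blast
    next
      case False
      have "p z = 0" if "z \<in> ball x (norm x / 4)" for z
      proof -
        have e: "{m. z \<in> ball (c m) (s m / 4)} = {}" using False that by blast
        show ?thesis unfolding p_def e by simp
      qed
      then show ?thesis by blast
    qed
  qed
  have bound: "\<exists>\<delta>>0. \<forall>x. x \<noteq> 0 \<longrightarrow> norm x < \<delta> \<longrightarrow> norm (iter_deriv p vs x) \<le> \<eta> * norm x ^ (r - length vs)"
    if l: "length vs \<le> r" and "\<eta> > 0" for vs \<eta>
  proof -
    obtain K where K: "K > 0" "\<And>(b :: 'w) (A :: 'v \<Rightarrow> 'w) \<epsilon> z. \<lbrakk>linear A; norm b \<le> \<epsilon>; \<And>v. norm (A v) \<le> \<epsilon> * norm v\<rbrakk> \<Longrightarrow>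
       norm (iter_deriv (\<lambda>z. bump r z *\<^sub>R (b + A z)) vs z) \<le> K * \<epsilon>"
      using bump_affine_deriv_bound[OF l, where 'w = 'w] by blast
    \<comment> \<open>The cost s_n^(-j) of j derivatives is taken from s_n^r / (n + 1). The
      remaining factor 1 / (n + 1) is what makes the jet at 0 vanish also at the top order j =
      r.\<close>
    have piece_le: "norm (iter_deriv (piece n) vs x) \<le> K / Suc n * s n ^ (r - length vs)" for n x
    proof -
      have "norm (iter_deriv (piece n) vs x) = (1 / s n) ^ length vs * norm (iter_deriv (G n) vs ((1 / s n) *\<^sub>R (x - c n)))"
        unfolding piece_def[abs_def] iter_deriv_rescale[OF CG l] using c(2)[of n] by simp
      also have "\<dots> \<le> (1 / s n) ^ length vs * (K * (s n ^ r / Suc n))"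
        using K(2)[OF A'(1,2,3)] c(2)[of n] unfolding G_def[abs_def]
        by (intro mult_left_mono) auto
      also have "\<dots> = K / Suc n * s n ^ (r - length vs)"
        using c(2)[of n] l by (simp add: power_diff power_divide)
      finally show ?thesis .
    qed
    obtain N where N: "K * 2 ^ (r - length vs) / Suc N < \<eta>"
    proof -
      obtain N where "K * 2 ^ (r - length vs) / \<eta> < real N" using reals_Archimedean2 by blast
      then have "K * 2 ^ (r - length vs) < \<eta> * real N" using \<open>\<eta> > 0\<close> by (simp add: field_simps)
      also have "\<dots> \<le> \<eta> * Suc N" using \<open>\<eta> > 0\<close> by simp
      finally show thesis by (intro that[of N]) (simp add: field_simps)
    qed
    have "norm (iter_deriv p vs x) \<le> \<eta> * norm x ^ (r - length vs)" if x: "x \<noteq> 0" "norm x < s N / 2" for x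
    proof -
      have xb: "x \<in> ball x (norm x / 4)" using x by simp
      from near_cases[OF x(1)] show ?thesis
      proof
        assume "\<forall>y\<in>ball x (norm x / 4). p y = 0"
        then have "iter_deriv p vs x = iter_deriv (\<lambda>x. 0) vs x"
          using iter_deriv_cong[OF open_ball _ xb, of p "\<lambda>x. 0"] by simp
        then show ?thesis using \<open>\<eta> > 0\<close> by (simp add: iter_deriv_zero)
      next
        assume "\<exists>n. s n < 2 * norm x \<and> (\<forall>y\<in>ball x (norm x / 4). p y = piece n y)"
        then obtain n where n: "s n < 2 * norm x" "\<forall>y\<in>ball x (norm x / 4). p y = piece n y" by blast
        have "N \<le> n"
        proof (rule ccontr)
          assume "\<not> N \<le> n"
          then have "s N < s n / 4" by (intro s4) simp
          moreover have "s n < s N" using n(1) x(2) by linarith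
          ultimately show False using c(2)[of N] by linarith
        qed
        have "iter_deriv p vs x = iter_deriv (piece n) vs x"
          using iter_deriv_cong[OF open_ball _ xb, of p "piece n"] n(2) by simp
        then have "norm (iter_deriv p vs x) \<le> K / Suc n * s n ^ (r - length vs)"
          using piece_le by simp
        also have "\<dots> \<le> K / Suc N * (2 * norm x) ^ (r - length vs)"
          using \<open>N \<le> n\<close> K(1) n(1) c(2)[of n]
          by (intro mult_mono power_mono divide_left_mono) auto
        also have "\<dots> = K * 2 ^ (r - length vs) / Suc N * norm x ^ (r - length vs)"
          by (simp add: power_mult_distrib)
        also have "\<dots> \<le> \<eta> * norm x ^ (r - length vs)"
          using N by (intro mult_right_mono) auto
        finally show ?thesis .
      qed
    qed
    then show ?thesis using c(2)[of N] by (intro exI[of _ "s N / 2"]) auto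
  qed
  have p0: "p 0 = 0"
  proof -
    have e: "{m. 0 \<in> ball (c m) (s m / 4)} = {}"
    proof -
      have "\<not> s m < s m / 4" for m using c(2)[of m] by linarith
      then show ?thesis using c(1) by simp
    qed
    show ?thesis unfolding p_def e by simp
  qed
  \<comment> \<open>Below order r the exponent r - j is at least 1, so the bound says that the
    function is o(|x|) at 0 and its derivative there vanishes.\<close>
  have der0: "(iter_deriv p vs has_derivative (\<lambda>v. 0)) (at 0)"
    if l: "length vs < r" and z: "iter_deriv p vs 0 = 0" for vs
    unfolding has_derivative_at_alt
  proof (intro conjI allI impI)
    fix e :: real assume "e > 0"
    obtain \<delta> where \<delta>: "\<delta> > 0" "\<And>x. \<lbrakk>x \<noteq> 0; norm x < \<delta>\<rbrakk> \<Longrightarrow> norm (iter_deriv p vs x) \<le> e * norm x ^ (r - length vs)"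
      using bound[of vs e] l \<open>e > 0\<close> by auto
    have "norm (iter_deriv p vs y) \<le> e * norm y" if "norm y < min \<delta> 1" for y
    proof (cases "y = 0")
      case False
      have "norm (iter_deriv p vs y) \<le> e * norm y ^ (r - length vs)" using \<delta>(2)[OF False] that by simp
      also have "\<dots> \<le> e * norm y ^ 1"
        using \<open>e > 0\<close> l that by (intro mult_left_mono power_decreasing) auto
      finally show ?thesis by simp
    qed (use z in simp)
    then show "\<exists>d>0. \<forall>y. norm (y - 0) < d \<longrightarrow> norm (iter_deriv p vs y - iter_deriv p vs 0 - 0) \<le> e * norm (y - 0)"
      using \<delta>(1) z by (intro exI[of _ "min \<delta> 1"]) auto
  qed auto
  have jet0: "iter_deriv p vs 0 = 0" if "length vs \<le> r" for vs
    using that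
  proof (induction vs)
    case (Cons v vs)
    then have "(iter_deriv p vs has_derivative (\<lambda>v. 0)) (at 0)" by (intro der0) auto
    from fun_cong[OF frechet_derivative_at[OF this], of v] show ?case by simp
  qed (use p0 in simp)
  have Cp: "Ck r UNIV p"
    unfolding Ck_def
  proof (intro conjI allI impI ballI)
    fix vs :: "'v list" and x assume l: "length vs < r"
    show "iter_deriv p vs differentiable (at x)"
    proof (cases "x = 0")
      case True
      then show ?thesis using der0[OF l jet0] l by (auto simp: differentiable_def)
    next
      case False
      then have xb: "x \<in> ball x (norm x / 4)" by simp
      from near_cases[OF False] obtain q where q: "q = (\<lambda>x. 0) \<or> q \<in> range piece" "\<And>y. y \<in> ball x (norm x / 4) \<Longrightarrow> p y = q y"
        by (elim disjE exE) auto
      have "Ck r UNIV q" using q(1) Cpiece Ck_const[OF open_UNIV] by auto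
      then have "iter_deriv q vs differentiable (at x)" using l by (simp add: Ck_def)
      then show ?thesis
        by (rule differentiable_cong_open[OF open_ball xb, rotated])
          (rule iter_deriv_cong[OF open_ball q(2)[symmetric]])
    qed
  next
    fix vs :: "'v list" assume l: "length vs \<le> r"
    show "continuous_on UNIV (iter_deriv p vs)"
      unfolding continuous_on_eq_continuous_at[OF open_UNIV]
    proof
      fix x :: 'v
      show "isCont (iter_deriv p vs) x"
      proof (cases "x = 0")
        case True
        have *: "\<forall>\<^sub>F y in at 0. norm (iter_deriv p vs y) \<le> \<eta>" if "\<eta> > 0" for \<eta>
        proof -
          obtain \<delta> where \<delta>: "\<delta> > 0" "\<And>x. \<lbrakk>x \<noteq> 0; norm x < \<delta>\<rbrakk> \<Longrightarrow> norm (iter_deriv p vs x) \<le> \<eta> * norm x ^ (r - length vs)"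
            using bound[OF l \<open>\<eta> > 0\<close>] by auto
          have "norm (iter_deriv p vs y) \<le> \<eta>" if "y \<noteq> 0" "norm y < min \<delta> 1" for y
          proof -
            have "norm (iter_deriv p vs y) \<le> \<eta> * norm y ^ (r - length vs)" using \<delta>(2) that by simp
            also have "\<dots> \<le> \<eta> * 1" using \<open>\<eta> > 0\<close> that by (intro mult_left_mono power_le_one) auto
            finally show ?thesis by simp
          qed
          then show ?thesis unfolding eventually_at using \<delta>(1)
            by (intro exI[of _ "min \<delta> 1"]) (auto simp: dist_norm)
        qed
        have "(iter_deriv p vs \<longlongrightarrow> 0) (at 0)"
          unfolding tendsto_iff dist_norm diff_zero
        proof (intro allI impI)
          fix e :: real assume "e > 0"
          then have "\<forall>\<^sub>F y in at 0. norm (iter_deriv p vs y) \<le> e / 2" by (intro *) simp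
          then show "\<forall>\<^sub>F y in at 0. norm (iter_deriv p vs y) < e"
            by (rule eventually_mono) (use \<open>e > 0\<close> in simp)
        qed
        then show ?thesis using True jet0[OF l] by (simp add: isCont_def)
      next
        case False
        then have xb: "x \<in> ball x (norm x / 4)" by simp
        from near_cases[OF False] obtain q where q: "q = (\<lambda>x. 0) \<or> q \<in> range piece" "\<And>y. y \<in> ball x (norm x / 4) \<Longrightarrow> p y = q y"
          by (elim disjE exE) auto
        have "Ck r UNIV q" using q(1) Cpiece Ck_const[OF open_UNIV] by auto
        then have "isCont (iter_deriv q vs) x" using l by (simp add: Ck_def continuous_on_eq_continuous_at)
        moreover have "\<forall>\<^sub>F y in nhds x. iter_deriv p vs y = iter_deriv q vs y"
          by (rule eventually_mono[OF eventually_nhds_in_open[OF open_ball xb]])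
            (rule iter_deriv_cong[OF open_ball q(2)])
        ultimately show ?thesis by (simp add: isCont_cong)
      qed
    qed
  qed
  have "\<exists>x A. x \<noteq> 0 \<and> norm x < \<epsilon> \<and> (p has_derivative A) (at x) \<and> P x (p x) A" if "\<epsilon> > 0" for \<epsilon>
  proof -
    obtain n where n: "1 / Suc n < \<epsilon>" using \<open>\<epsilon> > 0\<close> nat_approx_posE by blast
    have cb: "c n \<in> ball (c n) (s n / 4)" using c(2)[of n] by simp
    have eq: "piece n y = p y" if "y \<in> ball (c n) (s n / 4)" for y
    proof (rule p_eq[symmetric])
      fix m assume m: "y \<in> ball (c m) (s m / 4)"
      have "s m < 4 * s n" "s n < 4 * s m" using annulus[OF that] annulus[OF m] by linarith+
      then show "m = n" by (rule near)
    qed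
    have z: "(1 / s n) *\<^sub>R (c n - c n) = 0" by simp
    have "((\<lambda>x. (1 / s n) *\<^sub>R (x - c n)) has_derivative (\<lambda>v. (1 / s n) *\<^sub>R v)) (at (c n))"
      by (auto intro!: derivative_eq_intros)
    \<comment> \<open>The bump has value 1 and derivative 0 at its centre, so the cut-off leaves
      value and derivative of the affine correction unchanged there.\<close>
    moreover have "(G n has_derivative (A' n)) (at ((1 / s n) *\<^sub>R (c n - c n)))"
      unfolding G_def[abs_def] z
      using has_derivative_scaleR[OF bump_derivative_0 has_derivative_add[OF has_derivative_const
          linear_imp_has_derivative[OF A'(1)[of n]]], of r "b n"]
      by (simp add: bump_0)
    ultimately have "(piece n has_derivative (\<lambda>v. A' n ((1 / s n) *\<^sub>R v))) (at (c n))"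
      unfolding piece_def[abs_def] by (rule has_derivative_compose)
    then have "(piece n has_derivative A n) (at (c n))"
      using c(2)[of n] by (simp add: A'_def)
    then have "(p has_derivative A n) (at (c n))"
      by (rule has_derivative_transform_within_open[OF _ open_ball cb eq])
    moreover have "p (c n) = b n"
      using eq[OF cb] linear_0[OF A'(1)[of n]] by (simp add: piece_def G_def bump_0)
    moreover have "norm (c n) < \<epsilon>" "c n \<noteq> 0" using c(1,2,3)[of n] n by auto
    ultimately show ?thesis using c(7)[of n] by (intro exI[of _ "c n"] exI[of _ "A n"]) auto
  qed
  with that Cp jet0 show thesis by blast
qed

section \<open>Orthogonality and tangent spaces\<close>

lemma inner_split_vec:
  fixes z w :: "'a::real_or_complex^('m::finite + 'l::finite)"
  shows "z \<bullet> w = fst_vec z \<bullet> fst_vec w + snd_vec z \<bullet> snd_vec w"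
  by (simp add: inner_vec_def sum_UNIV_Plus fst_vec_def snd_vec_def)

lemma norm_split_vec:
  fixes z :: "'a::real_or_complex^('m::finite + 'l::finite)"
  shows "(norm z)\<^sup>2 = (norm (fst_vec z))\<^sup>2 + (norm (snd_vec z))\<^sup>2"
  by (simp add: power2_norm_eq_inner inner_split_vec)

lemma norm_fst_vec_le: "norm (fst_vec z) \<le> norm (z :: 'a::real_or_complex^('m::finite + 'l::finite))"
  by (rule power2_le_imp_le) (simp_all add: norm_split_vec)

lemma norm_snd_vec_le: "norm (snd_vec z) \<le> norm (z :: 'a::real_or_complex^('m::finite + 'l::finite))"
  by (rule power2_le_imp_le) (simp_all add: norm_split_vec)

lemma norm_pair_vec_le: "norm (pair_vec x y :: 'a::real_or_complex^('m::finite + 'l::finite)) \<le> norm x + norm y"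
  by (rule power2_le_imp_le) (simp_all add: norm_split_vec power2_sum)

lemma bounded_linear_fst_vec: "bounded_linear (fst_vec :: 'a::real_or_complex^('m::finite + 'l::finite) \<Rightarrow> _)"
  by (rule bounded_linear_intro[of _ 1]) (auto simp: fst_vec_def vec_eq_iff norm_fst_vec_le[unfolded fst_vec_def])

lemma bounded_linear_snd_vec: "bounded_linear (snd_vec :: 'a::real_or_complex^('m::finite + 'l::finite) \<Rightarrow> _)"
  by (rule bounded_linear_intro[of _ 1]) (auto simp: snd_vec_def vec_eq_iff norm_snd_vec_le[unfolded snd_vec_def])

lemma pair_vec_add: "pair_vec (x + x') (y + y') = pair_vec x y + pair_vec x' (y' :: 'a::comm_monoid_add^'l::finite)"
  by (simp add: pair_vec_def vec_eq_iff split: sum.split)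

lemma pair_vec_diff: "pair_vec (x - x') (y - y') = pair_vec x y - pair_vec x' (y' :: 'a::ab_group_add^'l::finite)"
  by (simp add: pair_vec_def vec_eq_iff split: sum.split)

lemma pair_vec_scaleR: "pair_vec (c *\<^sub>R x) (c *\<^sub>R y) = c *\<^sub>R pair_vec x (y :: 'a::real_vector^'l::finite)"
  by (simp add: pair_vec_def vec_eq_iff split: sum.split)

lemma fst_vec_zero [simp]: "fst_vec 0 = 0" and snd_vec_zero [simp]: "snd_vec 0 = 0"
  by (simp_all add: fst_vec_def snd_vec_def vec_eq_iff)

lemma pair_vec_zero [simp]: "pair_vec 0 0 = 0"
  by (simp add: pair_vec_def vec_eq_iff split: sum.split)

lemma in_vertical_iff: "z \<in> vertical \<longleftrightarrow> fst_vec z = 0"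
  unfolding vertical_def by (auto intro: exI[of _ "snd_vec z"]) (metis pair_vec_collapse)

lemma has_derivative_pair_vec:
  fixes f :: "'v::real_normed_vector \<Rightarrow> 'a::real_or_complex^'m::finite" and g :: "'v \<Rightarrow> 'a^'l::finite"
  assumes "(f has_derivative f') F" "(g has_derivative g') F"
  shows "((\<lambda>x. pair_vec (f x) (g x)) has_derivative (\<lambda>v. pair_vec (f' v) (g' v))) F"
proof -
  have 1: "bounded_linear (\<lambda>x :: 'a^'m. pair_vec x (0 :: 'a^'l))"
    by (rule bounded_linear_intro[of _ 1])
      (use norm_pair_vec_le[of _ "0 :: 'a^'l"] in \<open>auto simp: pair_vec_add[symmetric] pair_vec_scaleR[symmetric]\<close>)
  have 2: "bounded_linear (\<lambda>y :: 'a^'l. pair_vec (0 :: 'a^'m) y)"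
    by (rule bounded_linear_intro[of _ 1])
      (use norm_pair_vec_le[of "0 :: 'a^'m"] in \<open>auto simp: pair_vec_add[symmetric] pair_vec_scaleR[symmetric]\<close>)
  from has_derivative_add[OF bounded_linear.has_derivative[OF 1 assms(1)] bounded_linear.has_derivative[OF 2 assms(2)]]
  show ?thesis by (simp add: pair_vec_add[symmetric])
qed

lemma has_vector_derivative_pair_vec:
  fixes f :: "real \<Rightarrow> 'a::real_or_complex^'m::finite" and g :: "real \<Rightarrow> 'a^'l::finite"
  assumes "(f has_vector_derivative v) F" "(g has_vector_derivative w) F"
  shows "((\<lambda>x. pair_vec (f x) (g x)) has_vector_derivative pair_vec v w) F"
  using has_derivative_pair_vec[OF assms[unfolded has_vector_derivative_def]]
  by (simp add: has_vector_derivative_def pair_vec_scaleR)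

lemma has_vector_derivative_compose:
  assumes "(\<gamma> has_vector_derivative v) (at t)" "(\<psi> has_derivative B) (at (\<gamma> t))"
  shows "((\<lambda>s. \<psi> (\<gamma> s)) has_vector_derivative B v) (at t)"
  using has_derivative_compose[OF assms(1)[unfolded has_vector_derivative_def] assms(2)]
    linear_scale[OF has_derivative_linear[OF assms(2)]]
  by (simp add: has_vector_derivative_def)

lemma has_vector_derivative_eventually_eq:
  assumes "(f has_vector_derivative v) (at t)" "\<forall>\<^sub>F s in nhds t. f s = g s"
  shows "(g has_vector_derivative v) (at t)"
proof -
  have "\<forall>\<^sub>F s in nhds t. s \<in> UNIV \<longrightarrow> f s = g s" using assms(2) by simp
  from has_vector_derivative_cong_ev[OF this eventually_nhds_x_imp_x[OF assms(2)]] assms(1)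
  show ?thesis by simp
qed

lemma velocity_in_subspace:
  fixes \<gamma> :: "real \<Rightarrow> 'v::euclidean_space"
  assumes "subspace L" "(\<gamma> has_vector_derivative v) (at t)" "\<forall>\<^sub>F s in nhds t. \<gamma> s \<in> L"
  shows "v \<in> L"
proof -
  have "z \<bullet> v = 0" if "z \<in> L\<^sup>\<bottom>" for z
  proof -
    have "((\<lambda>s. z \<bullet> \<gamma> s) has_vector_derivative z \<bullet> v) (at t)"
      by (rule bounded_linear.has_vector_derivative[OF bounded_linear_inner_right assms(2)])
    moreover have "\<forall>\<^sub>F s in nhds t. z \<bullet> \<gamma> s = 0"
      using assms(3) by eventually_elim (use that in \<open>auto simp: orthogonal_comp_def orthogonal_def inner_commute\<close>)
    ultimately have "((\<lambda>s. 0) has_vector_derivative z \<bullet> v) (at t)"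
      by (rule has_vector_derivative_eventually_eq)
    then show ?thesis using vector_derivative_unique_at has_vector_derivative_const by blast
  qed
  then have "v \<in> L\<^sup>\<bottom>\<^sup>\<bottom>" by (auto simp: orthogonal_comp_def orthogonal_def inner_commute)
  then show ?thesis using orthogonal_comp_self[OF assms(1)] by simp
qed

text \<open>The class relates the embedding to the norm but not to the inner product; polarization
  recovers the real inner product from the norm.\<close>

lemma conjugate_embedding:
  obtains \<phi> :: "'a::real_or_complex \<Rightarrow> complex" where
    "\<And>x y. \<phi> (x + y) = \<phi> x + \<phi> y" "\<And>x y. \<phi> (x * y) = \<phi> x * \<phi> y" "\<And>x. cmod (\<phi> x) = norm x"
    "\<And>x. \<phi> (conjugate x) = cnj (\<phi> x)" "\<And>x y. x \<bullet> y = Re (\<phi> (x * conjugate y))"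
proof -
  obtain \<phi> :: "'a \<Rightarrow> complex" where \<phi>: "\<And>x y. \<phi> (x + y) = \<phi> x + \<phi> y" "\<And>x y. \<phi> (x * y) = \<phi> x * \<phi> y"
    "\<And>x. cmod (\<phi> x) = norm x" "\<And>x. \<phi> (conjugate x) = cnj (\<phi> x)"
    using embedding_ex by blast
  have "x \<bullet> y = Re (\<phi> (x * conjugate y))" for x y
  proof -
    have "2 * (x \<bullet> y) = (norm (x + y))\<^sup>2 - (norm x)\<^sup>2 - (norm y)\<^sup>2"
      by (simp add: power2_norm_eq_inner inner_add inner_commute)
    also have "\<dots> = (cmod (\<phi> x + \<phi> y))\<^sup>2 - (cmod (\<phi> x))\<^sup>2 - (cmod (\<phi> y))\<^sup>2"
      by (simp only: \<phi>(1)[symmetric] \<phi>(3))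
    also have "\<dots> = 2 * Re (\<phi> x * cnj (\<phi> y))"
      by (simp add: cmod_power2 power2_sum)
    finally show ?thesis by (simp add: \<phi>)
  qed
  with \<phi> that show thesis by blast
qed

lemma norm_conjugate: "norm (conjugate x) = norm (x :: 'a::real_or_complex)"
proof -
  obtain \<phi> :: "'a \<Rightarrow> complex" where "\<And>x. cmod (\<phi> x) = norm x" "\<And>x. \<phi> (conjugate x) = cnj (\<phi> x)"
    by (rule conjugate_embedding) blast
  then show ?thesis by (metis complex_mod_cnj)
qed

lemma norm_herm_le: "norm (herm u v) \<le> norm u * norm (v :: 'a::real_or_complex^'m)"
proof -
  have "norm (herm u v) \<le> (\<Sum>i\<in>UNIV. norm (u $ i * conjugate (v $ i)))"
    unfolding herm_def by (rule norm_sum)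
  also have "\<dots> = (\<Sum>i\<in>UNIV. \<bar>norm (u $ i)\<bar> * \<bar>norm (v $ i)\<bar>)"
    by (simp add: norm_mult norm_conjugate)
  also have "\<dots> \<le> norm u * norm v"
    unfolding norm_vec_def by (rule L2_set_mult_ineq)
  finally show ?thesis .
qed

lemma embedding_herm:
  fixes \<phi> :: "'a::real_or_complex \<Rightarrow> complex"
  assumes "\<And>x y. \<phi> (x + y) = \<phi> x + \<phi> y" "\<And>x y. \<phi> (x * y) = \<phi> x * \<phi> y"
    "\<And>x. \<phi> (conjugate x) = cnj (\<phi> x)"
  shows "\<phi> (herm u (v :: 'a^'b)) = (\<Sum>i\<in>UNIV. \<phi> (u $ i) * cnj (\<phi> (v $ i)))"
proof -
  have "\<phi> 0 = 0" using assms(1)[of 0 0] by simp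
  have "\<phi> (sum g A) = (\<Sum>i\<in>A. \<phi> (g i))" if "finite A" for g and A :: "'b set"
    using that by (induction A rule: finite_induct) (auto simp: assms(1) \<open>\<phi> 0 = 0\<close>)
  then show ?thesis by (simp add: herm_def assms)
qed

lemma inner_zero_if_herm_zero:
  fixes u v :: "'a::real_or_complex^'m"
  assumes "herm u v = 0"
  shows "u \<bullet> v = 0"
proof -
  obtain \<phi> :: "'a \<Rightarrow> complex" where \<phi>: "\<And>x y. \<phi> (x + y) = \<phi> x + \<phi> y" "\<And>x y. \<phi> (x * y) = \<phi> x * \<phi> y"
    "\<And>x. \<phi> (conjugate x) = cnj (\<phi> x)" "\<And>x y. x \<bullet> y = Re (\<phi> (x * conjugate y))"
    by (rule conjugate_embedding) blast
  have "u \<bullet> v = Re (\<phi> (herm u v))"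
    by (simp add: embedding_herm[of \<phi>] inner_vec_def \<phi>)
  moreover have "\<phi> 0 = 0" using \<phi>(1)[of 0 0] by simp
  ultimately show ?thesis using assms by simp
qed

lemma inner_herm_scale:
  fixes u v :: "'a::real_or_complex^'m"
  shows "u \<bullet> (herm u v *s v) = (norm (herm u v))\<^sup>2"
proof -
  obtain \<phi> :: "'a \<Rightarrow> complex" where \<phi>: "\<And>x y. \<phi> (x + y) = \<phi> x + \<phi> y" "\<And>x y. \<phi> (x * y) = \<phi> x * \<phi> y"
    "\<And>x. cmod (\<phi> x) = norm x" "\<And>x. \<phi> (conjugate x) = cnj (\<phi> x)" "\<And>x y. x \<bullet> y = Re (\<phi> (x * conjugate y))"
    by (rule conjugate_embedding) blast
  define c where "c = herm u v"
  have "u \<bullet> (c *s v) = Re (\<Sum>i\<in>UNIV. \<phi> (u $ i) * cnj (\<phi> (c * v $ i)))"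
    by (simp add: inner_vec_def \<phi>(2,4,5))
  also have "\<dots> = Re (cnj (\<phi> c) * \<phi> (herm u v))"
    by (simp add: embedding_herm[of \<phi>] \<phi> sum_distrib_left mult_ac)
  also have "\<dots> = (norm c)\<^sup>2"
    by (simp add: c_def[symmetric] \<phi>(3)[symmetric] cmod_power2) (simp add: power2_eq_square)
  finally show ?thesis by (simp add: c_def)
qed

text \<open>A subspace over the ground field contains with v also the multiple of v by
  \<open>herm u v\<close>, and the real inner product of u with that multiple is |herm u v|^2. Real
  orthogonality therefore already implies Hermitian orthogonality.\<close>

lemma herm_compl_iff_inner:
  fixes T :: "('a::real_or_complex^'m) set"
  assumes "vec.subspace T"
  shows "u \<in> herm_compl T \<longleftrightarrow> (\<forall>v\<in>T. u \<bullet> v = 0)"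
proof
  assume *: "\<forall>v\<in>T. u \<bullet> v = 0"
  have "herm u v = 0" if "v \<in> T" for v
  proof -
    have "herm u v *s v \<in> T" using assms that by (rule vec.subspace_scale)
    with * have "u \<bullet> (herm u v *s v) = 0" by blast
    then show ?thesis by (simp add: inner_herm_scale)
  qed
  then show "u \<in> herm_compl T" by (simp add: herm_compl_def)
qed (auto simp: herm_compl_def inner_zero_if_herm_zero)

text \<open>The squared form needs no division and also covers t \<ge> 1, where the left side is
  infinite and the right side fails.\<close>

lemma tan_arcsin_le_iff:
  assumes "t \<ge> 0" "D \<ge> 0"
  shows "tan_arcsin t \<le> ereal D \<longleftrightarrow> t\<^sup>2 * (1 + D\<^sup>2) \<le> D\<^sup>2"
proof (cases "t < 1")
  case True
  then have t2: "t\<^sup>2 < 1" using assms by (simp add: power_less_one_iff)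
  have "tan (arcsin t) = t / sqrt (1 - t\<^sup>2)"
    using True assms by (simp add: tan_def cos_arcsin)
  then have "tan_arcsin t \<le> ereal D \<longleftrightarrow> t \<le> D * sqrt (1 - t\<^sup>2)"
    using True t2 by (simp add: tan_arcsin_def pos_divide_le_eq)
  also have "\<dots> \<longleftrightarrow> t\<^sup>2 \<le> (D * sqrt (1 - t\<^sup>2))\<^sup>2"
    using assms t2 by (simp add: power2_le_iff_abs_le abs_mult)
  also have "\<dots> \<longleftrightarrow> t\<^sup>2 \<le> D\<^sup>2 * (1 - t\<^sup>2)"
    using t2 by (simp add: power_mult_distrib)
  finally show ?thesis by (simp add: algebra_simps)
next
  case False
  then have "t\<^sup>2 \<ge> 1" by simp
  then have "1 * (1 + D\<^sup>2) \<le> t\<^sup>2 * (1 + D\<^sup>2)" by (intro mult_right_mono) auto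
  then show ?thesis using False by (simp add: tan_arcsin_def)
qed

text \<open>For a fixed normal vector u the largest angle against \<open>vertical\<close> is reached
  at the vertical part of u. Its sine is |u_2| / |u|, so its tangent is |u_2| / |u_1|. This turns
  (w) into an inequality between the components of normal vectors.\<close>

lemma subspace_dist_vertical_le_iff:
  fixes T :: "('a::real_or_complex^('n::finite + 'c::finite)) set"
  assumes "D \<ge> 0"
  shows "subspace_dist vertical T \<le> ereal D \<longleftrightarrow>
    (\<forall>u\<in>herm_compl T. norm (snd_vec u) \<le> D * norm (fst_vec u))"
proof
  assume le: "subspace_dist vertical T \<le> ereal D"
  show "\<forall>u\<in>herm_compl T. norm (snd_vec u) \<le> D * norm (fst_vec u)"
  proof
    fix u assume u: "u \<in> herm_compl T"
    show "norm (snd_vec u) \<le> D * norm (fst_vec u)"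
    proof (cases "snd_vec u = 0")
      case False
      \<comment> \<open>The test vector at which the supremum for this u is attained.\<close>
      define v :: "'a^('n + 'c)" where "v = pair_vec 0 (snd_vec u)"
      have v: "v \<in> vertical" "v \<noteq> 0" using False by (auto simp: v_def in_vertical_iff) (metis snd_vec_pair_vec snd_vec_zero)
      have u0: "u \<noteq> 0" using False by auto
      have nv: "norm v = norm (snd_vec u)"
        by (rule power2_eq_imp_eq) (simp_all add: norm_split_vec v_def)
      have hv: "norm (herm u v) = (norm (snd_vec u))\<^sup>2"
      proof -
        have vv: "u \<bullet> v = (norm (snd_vec u))\<^sup>2" by (simp add: inner_split_vec v_def power2_norm_eq_inner)
        obtain \<phi> :: "'a \<Rightarrow> complex" where \<phi>: "\<And>x y. \<phi> (x + y) = \<phi> x + \<phi> y" "\<And>x y. \<phi> (x * y) = \<phi> x * \<phi> y"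
          "\<And>x. cmod (\<phi> x) = norm x" "\<And>x. \<phi> (conjugate x) = cnj (\<phi> x)" "\<And>x y. x \<bullet> y = Re (\<phi> (x * conjugate y))"
          by (rule conjugate_embedding) blast
        have "u \<bullet> v = Re (\<phi> (herm u v))" by (simp add: embedding_herm[of \<phi>] inner_vec_def \<phi>)
        also have "\<dots> \<le> norm (herm u v)" using complex_Re_le_cmod[of "\<phi> (herm u v)"] by (simp add: \<phi>)
        finally have "(norm (snd_vec u))\<^sup>2 \<le> norm (herm u v)" using vv by simp
        moreover have "norm (herm u v) \<le> (norm (snd_vec u))\<^sup>2"
        proof -
          have "conjugate (0 :: 'a) = 0" using norm_conjugate[of "0 :: 'a"] by simp
          then have "herm u v = herm (snd_vec u) (snd_vec u)"
            by (simp add: herm_def sum_UNIV_Plus v_def snd_vec_def)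
          then show ?thesis using norm_herm_le[of "snd_vec u" "snd_vec u"] by (simp add: power2_eq_square)
        qed
        ultimately show ?thesis by simp
      qed
      define t where "t = norm (herm u v) / (norm u * norm v)"
      have "tan_arcsin t \<le> subspace_dist vertical T"
        unfolding subspace_dist_def t_def by (rule Sup_upper) (use u u0 v in blast)
      then have "tan_arcsin t \<le> ereal D" using le by (rule order_trans)
      moreover have "t \<ge> 0" by (simp add: t_def)
      ultimately have "t\<^sup>2 * (1 + D\<^sup>2) \<le> D\<^sup>2" using tan_arcsin_le_iff assms by blast
      moreover have "t = norm (snd_vec u) / norm u"
        using False by (simp add: t_def hv nv power2_eq_square)
      ultimately have "(norm (snd_vec u))\<^sup>2 * (1 + D\<^sup>2) \<le> D\<^sup>2 * (norm u)\<^sup>2"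
        using u0 by (simp add: power_divide divide_simps)
      then have "(norm (snd_vec u))\<^sup>2 \<le> (D * norm (fst_vec u))\<^sup>2"
        by (simp add: norm_split_vec algebra_simps power_mult_distrib)
      then show ?thesis by (rule power2_le_imp_le) (use assms in simp)
    qed (use assms in simp)
  qed
next
  assume *: "\<forall>u\<in>herm_compl T. norm (snd_vec u) \<le> D * norm (fst_vec u)"
  show "subspace_dist vertical T \<le> ereal D"
    unfolding subspace_dist_def
  proof (rule Sup_least)
    fix s assume "s \<in> insert 0 {tan_arcsin (norm (herm u v) / (norm u * norm v)) |u v.
        u \<in> herm_compl T \<and> u \<noteq> 0 \<and> v \<in> vertical \<and> v \<noteq> 0}"
    then consider "s = 0" | u v where "s = tan_arcsin (norm (herm u v) / (norm u * norm v))"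
      "u \<in> herm_compl T" "u \<noteq> 0" "v \<in> vertical" "v \<noteq> 0" by blast
    then show "s \<le> ereal D"
    proof cases
      case 1
      then show ?thesis using assms by simp
    next
      case 2
      define t where "t = norm (herm u v) / (norm u * norm v)"
      have "conjugate (0 :: 'a) = 0" using norm_conjugate[of "0 :: 'a"] by simp
      moreover have "v $ Inl i = 0" for i
        using 2(4) unfolding in_vertical_iff by (simp add: fst_vec_def vec_eq_iff)
      ultimately have "herm u v = herm (snd_vec u) (snd_vec v)"
        by (simp add: herm_def sum_UNIV_Plus snd_vec_def)
      then have "norm (herm u v) \<le> norm (snd_vec u) * norm v"
        using norm_herm_le[of "snd_vec u" "snd_vec v"] mult_left_mono[OF norm_snd_vec_le[of v], of "norm (snd_vec u)"]
        by simp
      then have "t \<le> norm (snd_vec u) / norm u"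
        using 2(3,5) by (simp add: t_def divide_simps mult_ac)
      moreover have "t \<ge> 0" by (simp add: t_def)
      ultimately have "t\<^sup>2 \<le> (norm (snd_vec u) / norm u)\<^sup>2" by (intro power_mono)
      then have "t\<^sup>2 * (1 + D\<^sup>2) \<le> (norm (snd_vec u) / norm u)\<^sup>2 * (1 + D\<^sup>2)"
        by (intro mult_right_mono) auto
      also have "\<dots> \<le> D\<^sup>2"
      proof -
        have "(norm (snd_vec u))\<^sup>2 \<le> (D * norm (fst_vec u))\<^sup>2"
          using * 2(2) by (intro power_mono) auto
        then have "(norm (snd_vec u))\<^sup>2 * (1 + D\<^sup>2) \<le> D\<^sup>2 * (norm u)\<^sup>2"
          by (simp add: norm_split_vec algebra_simps power_mult_distrib)
        then show ?thesis using 2(3) by (simp add: power_divide divide_simps)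
      qed
      finally show ?thesis
        using tan_arcsin_le_iff[OF \<open>t \<ge> 0\<close> assms] 2(1) by (simp add: t_def)
    qed
  qed
qed

section \<open>Tangent spaces of submanifolds and of graphs\<close>

lemma subspace_of_vec_subspace:
  fixes T :: "('a::real_or_complex^'m) set"
  assumes "vec.subspace T"
  shows "subspace T"
proof (rule subspaceI)
  show "0 \<in> T" by (rule vec.subspace_0[OF assms])
  show "x + y \<in> T" if "x \<in> T" "y \<in> T" for x y using that by (rule vec.subspace_add[OF assms])
  show "c *\<^sub>R x \<in> T" if "x \<in> T" for c x
  proof -
    have "of_real c *s x \<in> T" using that by (rule vec.subspace_scale[OF assms])
    moreover have "of_real c *s x = c *\<^sub>R x" by (simp add: vec_eq_iff of_real_def)
    ultimately show ?thesis by simp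
  qed
qed

text \<open>In a chart curves in M are curves in the linear space L, and straight lines in L give
  every velocity. The set of velocities is thus the image of L under the derivative of the inverse
  chart, which is linear over the ground field.\<close>

lemma tangent_space_subspace:
  fixes M :: "('a::real_or_complex^'m) set"
  assumes "submanifold_at d M p" "p \<in> M"
  shows "vec.subspace (tangent_space M p)"
proof -
  from assms(1)[unfolded submanifold_at_def] obtain U V L and \<phi> \<psi> :: "'a^'m \<Rightarrow> 'a^'m" where H:
    "open U \<and> p \<in> U \<and> open V \<and> homeomorphism U V \<phi> \<psi> \<and> (\<forall>z\<in>U. analytic_near \<phi> z) \<and>
     (\<forall>z\<in>V. analytic_near \<psi> z) \<and> vec.subspace L \<and> vec.dim L = d \<and> \<phi> ` (M \<inter> U) = V \<inter> L"
    by (elim exE)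
  have *: "open U" "p \<in> U" "open V" "homeomorphism U V \<phi> \<psi>"
    "\<And>z. z \<in> U \<Longrightarrow> analytic_near \<phi> z" "\<And>z. z \<in> V \<Longrightarrow> analytic_near \<psi> z"
    "vec.subspace L" "\<phi> ` (M \<inter> U) = V \<inter> L"
    using H by simp_all
  have inv: "\<And>z. z \<in> U \<Longrightarrow> \<psi> (\<phi> z) = z" "\<And>z. z \<in> V \<Longrightarrow> \<phi> (\<psi> z) = z" "\<phi> p \<in> V"
    using *(2,4) by (auto simp: homeomorphism_def)
  obtain A where A: "(\<phi> has_derivative A) (at p)" by (rule analytic_near_has_derivative[OF *(5)[OF *(2)]])
  obtain B where B: "(\<psi> has_derivative B) (at (\<phi> p))" "Vector_Spaces.linear (*s) (*s) B"
    by (rule analytic_near_has_derivative[OF *(6)[OF inv(3)]])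
  have linB: "linear B" by (rule has_derivative_linear[OF B(1)])
  have subL: "subspace L" by (rule subspace_of_vec_subspace[OF *(7)])
  have "tangent_space M p = B ` L"
  proof (intro equalityI subsetI)
    fix v assume "v \<in> tangent_space M p"
    then obtain \<gamma> :: "real \<Rightarrow> 'a^'m" where \<gamma>: "\<gamma> 0 = p" "\<forall>\<^sub>F t in nhds 0. \<gamma> t \<in> M" "(\<gamma> has_vector_derivative v) (at 0)"
      unfolding tangent_space_def by blast
    have "(\<gamma> \<longlongrightarrow> \<gamma> 0) (nhds 0)"
      using has_vector_derivative_continuous[OF \<gamma>(3)]
      by (simp add: continuous_at tendsto_at_iff_tendsto_nhds)
    then have "(\<gamma> \<longlongrightarrow> p) (nhds 0)" using \<gamma>(1) by simp
    then have evU: "\<forall>\<^sub>F t in nhds 0. \<gamma> t \<in> U" using *(1,2) by (simp add: topological_tendstoD)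
    have d1: "((\<lambda>t. \<phi> (\<gamma> t)) has_vector_derivative A v) (at 0)"
      by (rule has_vector_derivative_compose[OF \<gamma>(3)]) (use A \<gamma>(1) in simp)
    have inL: "\<forall>\<^sub>F t in nhds 0. \<phi> (\<gamma> t) \<in> L"
      using evU \<gamma>(2) by eventually_elim (use *(8) in blast)
    have "A v \<in> L" by (rule velocity_in_subspace[OF subL d1 inL])
    moreover have "B (A v) = v"
    proof -
      have "((\<lambda>t. \<psi> (\<phi> (\<gamma> t))) has_vector_derivative B (A v)) (at 0)"
        by (rule has_vector_derivative_compose[OF d1]) (use B(1) \<gamma>(1) in simp)
      moreover have "\<forall>\<^sub>F t in nhds 0. \<psi> (\<phi> (\<gamma> t)) = \<gamma> t"
        using evU by eventually_elim (use inv in simp)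
      ultimately have "(\<gamma> has_vector_derivative B (A v)) (at 0)"
        by (rule has_vector_derivative_eventually_eq)
      then show ?thesis using \<gamma>(3) vector_derivative_unique_at by blast
    qed
    ultimately show "v \<in> B ` L" by (metis imageI)
  next
    fix v assume "v \<in> B ` L"
    then obtain l where l: "l \<in> L" "v = B l" by blast
    define \<gamma> where "\<gamma> t = \<psi> (\<phi> p + t *\<^sub>R l)" for t :: real
    have \<phi>p: "\<phi> p \<in> L" using *(2,8) assms(2) by blast
    have line: "((\<lambda>t :: real. \<phi> p + t *\<^sub>R l) has_vector_derivative l) (at 0)"
      by (auto intro!: derivative_eq_intros)
    have "(\<gamma> has_vector_derivative B l) (at 0)"
      unfolding \<gamma>_def[abs_def]
      by (rule has_vector_derivative_compose[OF line]) (use B(1) in simp)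
    moreover have "\<forall>\<^sub>F t in nhds 0. \<gamma> t \<in> M"
    proof -
      have "((\<lambda>t :: real. \<phi> p + t *\<^sub>R l) \<longlongrightarrow> \<phi> p) (nhds 0)"
        by (rule tendsto_eq_intros refl filterlim_ident | simp)+
      then have "\<forall>\<^sub>F t :: real in nhds 0. \<phi> p + t *\<^sub>R l \<in> V" using *(3) inv(3) by (simp add: topological_tendstoD)
      then show ?thesis
      proof eventually_elim
        case (elim t)
        have "\<phi> p + t *\<^sub>R l \<in> L" using subL \<phi>p l(1) by (intro subspace_add subspace_scale)
        then have "\<phi> p + t *\<^sub>R l \<in> \<phi> ` (M \<inter> U)" using elim *(8) by blast
        then show ?case using inv(1) by (auto simp: \<gamma>_def)
      qed
    qed
    moreover have "\<gamma> 0 = p" using inv *(2) by (simp add: \<gamma>_def)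
    ultimately show "v \<in> tangent_space M p" unfolding tangent_space_def l(2) by blast
  qed
  then show ?thesis
    using vec.linear_subspace_image[OF B(2) *(7)] by simp
qed

text \<open>A curve in the graph is determined by its first component, so its velocity is too; lines
  in the first component realise every vector on the right.\<close>

lemma tangent_space_graph:
  fixes g :: "'a::real_or_complex^'n::finite \<Rightarrow> 'a^'k::finite"
  assumes "(g has_derivative g') (at x)"
  shows "tangent_space (graph_of g) (pair_vec x (g x)) = range (\<lambda>v. pair_vec v (g' v))"
proof (intro equalityI subsetI)
  fix w assume "w \<in> tangent_space (graph_of g) (pair_vec x (g x))"
  then obtain \<gamma> :: "real \<Rightarrow> _" where \<gamma>: "\<gamma> 0 = pair_vec x (g x)" "\<forall>\<^sub>F t in nhds 0. \<gamma> t \<in> graph_of g"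
    "(\<gamma> has_vector_derivative w) (at 0)"
    unfolding tangent_space_def by blast
  have 1: "((\<lambda>t. fst_vec (\<gamma> t)) has_vector_derivative fst_vec w) (at 0)"
    by (rule bounded_linear.has_vector_derivative[OF bounded_linear_fst_vec \<gamma>(3)])
  have 2: "((\<lambda>t. g (fst_vec (\<gamma> t))) has_vector_derivative g' (fst_vec w)) (at 0)"
    by (rule has_vector_derivative_compose[OF 1]) (use assms \<gamma>(1) in simp)
  have eq: "\<forall>\<^sub>F t in nhds 0. pair_vec (fst_vec (\<gamma> t)) (g (fst_vec (\<gamma> t))) = \<gamma> t"
    using \<gamma>(2) by eventually_elim (auto simp: graph_of_def)
  have "(\<gamma> has_vector_derivative pair_vec (fst_vec w) (g' (fst_vec w))) (at 0)"
    by (rule has_vector_derivative_eventually_eq[OF has_vector_derivative_pair_vec[OF 1 2] eq])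
  then have "w = pair_vec (fst_vec w) (g' (fst_vec w))" using \<gamma>(3) vector_derivative_unique_at by blast
  then show "w \<in> range (\<lambda>v. pair_vec v (g' v))" by (metis rangeI)
next
  fix w assume "w \<in> range (\<lambda>v. pair_vec v (g' v))"
  then obtain v where v: "w = pair_vec v (g' v)" by blast
  have line: "((\<lambda>t :: real. x + t *\<^sub>R v) has_vector_derivative v) (at 0)"
    by (auto intro!: derivative_eq_intros)
  have "((\<lambda>t :: real. g (x + t *\<^sub>R v)) has_vector_derivative g' v) (at 0)"
    by (rule has_vector_derivative_compose[OF line]) (use assms in simp)
  from has_vector_derivative_pair_vec[OF line this]
  show "w \<in> tangent_space (graph_of g) (pair_vec x (g x))"
    unfolding tangent_space_def v graph_of_def
    by (intro CollectI exI[of _ "\<lambda>t :: real. pair_vec (x + t *\<^sub>R v) (g (x + t *\<^sub>R v))"]) (auto intro!: always_eventually)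
qed

section \<open>The universal family of homogeneous perturbations\<close>

lemma smult_axis: "t *s axis i 1 = (axis i t :: 'a::real_or_complex^'k)"
  by (simp add: vec_eq_iff axis_def)

lemma norm_axis_le: "norm (axis i t :: 'a::real_normed_vector^'k) \<le> norm t"
proof -
  have "norm (axis i t :: 'a^'k) \<le> (\<Sum>j\<in>UNIV. norm ((axis i t :: 'a^'k) $ j))" by (rule norm_vec_le_sum)
  also have "\<dots> = (\<Sum>j\<in>UNIV. if j = i then norm t else 0)"
    by (intro sum.cong) (auto simp: axis_def)
  finally show ?thesis by simp
qed

text \<open>When \<open>\<omega> i = 0\<close> the truncated exponent \<open>\<omega> i - 1\<close>
  does no harm, since the term carries the factor 0.\<close>

definition monom_deriv :: "('m::finite \<Rightarrow> nat) \<Rightarrow> 'a::real_or_complex^'m \<Rightarrow> 'a^'m \<Rightarrow> 'a" where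
  "monom_deriv \<omega> x v =
     (\<Sum>i\<in>UNIV. (of_nat (\<omega> i) * v $ i * (x $ i) ^ (\<omega> i - 1)) * (\<Prod>j\<in>UNIV - {i}. (x $ j) ^ \<omega> j))"

lemma monom_vec_has_derivative:
  fixes x :: "'a::real_or_complex^'m"
  shows "((\<lambda>x. monom_vec x \<omega>) has_derivative monom_deriv \<omega> x) (at x)"
  unfolding monom_vec_def monom_deriv_def[abs_def]
  by (intro has_derivative_prod has_derivative_power bounded_linear_imp_has_derivative bounded_linear_vec_nth)

lemma norm_monom_deriv_le:
  fixes x :: "'a::real_or_complex^'m"
  shows "norm (monom_deriv \<omega> x v) \<le> degree_of \<omega> * norm x ^ (degree_of \<omega> - 1) * norm v"
proof -
  have "norm ((of_nat (\<omega> i) * v $ i * (x $ i) ^ (\<omega> i - 1)) * (\<Prod>j\<in>UNIV - {i}. (x $ j) ^ \<omega> j)) \<le>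
    \<omega> i * (norm x ^ (degree_of \<omega> - 1) * norm v)" for i
  proof (cases "\<omega> i = 0")
    case False
    have d: "degree_of \<omega> = \<omega> i + sum \<omega> (UNIV - {i})"
      unfolding degree_of_def by (rule sum.remove) auto
    have "norm (\<Prod>j\<in>UNIV - {i}. (x $ j) ^ \<omega> j) = (\<Prod>j\<in>UNIV - {i}. norm (x $ j) ^ \<omega> j)"
      by (simp add: norm_power flip: prod_norm)
    also have "\<dots> \<le> (\<Prod>j\<in>UNIV - {i}. norm x ^ \<omega> j)"
      by (intro prod_mono) (auto intro: power_mono Finite_Cartesian_Product.norm_nth_le)
    also have "\<dots> = norm x ^ sum \<omega> (UNIV - {i})" by (simp add: power_sum)
    finally have p: "norm (\<Prod>j\<in>UNIV - {i}. (x $ j) ^ \<omega> j) \<le> norm x ^ sum \<omega> (UNIV - {i})" .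
    have "norm ((of_nat (\<omega> i) * v $ i * (x $ i) ^ (\<omega> i - 1)) * (\<Prod>j\<in>UNIV - {i}. (x $ j) ^ \<omega> j)) \<le>
      (real (\<omega> i) * norm v * norm x ^ (\<omega> i - 1)) * norm x ^ sum \<omega> (UNIV - {i})"
      unfolding norm_mult norm_power norm_of_nat
      by (intro mult_mono p power_mono Finite_Cartesian_Product.norm_nth_le) auto
    also have "\<dots> = \<omega> i * (norm x ^ (\<omega> i - 1 + sum \<omega> (UNIV - {i})) * norm v)"
      by (simp add: power_add mult_ac)
    also have "\<omega> i - 1 + sum \<omega> (UNIV - {i}) = degree_of \<omega> - 1" using d False by simp
    finally show ?thesis .
  qed simp
  then have "norm (monom_deriv \<omega> x v) \<le> (\<Sum>i\<in>UNIV. \<omega> i * (norm x ^ (degree_of \<omega> - 1) * norm v))"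
    unfolding monom_deriv_def by (intro sum_norm_le)
  also have "\<dots> = degree_of \<omega> * norm x ^ (degree_of \<omega> - 1) * norm v"
    by (simp add: degree_of_def sum_distrib_right mult.assoc)
  finally show ?thesis .
qed

text \<open>Being linear in u, this is at fixed x also the derivative in u of the family, the map
  h(x) of the overview.\<close>

definition hom_part :: "('c \<Rightarrow> ('n \<Rightarrow> nat) \<times> 'k) \<Rightarrow> 'a::real_or_complex^'c::finite \<Rightarrow> 'a^'n::finite \<Rightarrow> 'a^'k::finite" where
  "hom_part \<iota> u x = (\<Sum>j\<in>UNIV. axis (snd (\<iota> j)) (u $ j * monom_vec x (fst (\<iota> j))))"

definition hom_deriv :: "('c \<Rightarrow> ('n \<Rightarrow> nat) \<times> 'k) \<Rightarrow> 'a::real_or_complex^'c::finite \<Rightarrow> 'a^'n::finite \<Rightarrow> 'a^'n \<Rightarrow> 'a^'k::finite" where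
  "hom_deriv \<iota> u x v = (\<Sum>j\<in>UNIV. axis (snd (\<iota> j)) (u $ j * monom_deriv (fst (\<iota> j)) x v))"

lemma perturbed_family_eq: "perturbed_family f\<^sub>0 \<iota> u x = f\<^sub>0 x + hom_part \<iota> u x"
  by (simp add: perturbed_family_def hom_part_def smult_axis)

lemma axis_add: "axis i (s + t) = (axis i s + axis i t :: 'a::monoid_add^'k)"
  by (simp add: vec_eq_iff axis_def)

lemma axis_diff: "axis i (s - t) = (axis i s - axis i t :: 'a::ab_group_add^'k)"
  by (simp add: vec_eq_iff axis_def)

lemma axis_scaleR: "axis i (c *\<^sub>R t) = (c *\<^sub>R axis i t :: 'a::real_vector^'k)"
  by (simp add: vec_eq_iff axis_def)

lemma hom_part_add: "hom_part \<iota> (u + v) x = hom_part \<iota> u x + hom_part \<iota> v x"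
  by (simp add: hom_part_def distrib_right axis_add sum.distrib)

lemma hom_part_diff: "hom_part \<iota> (u - v) x = hom_part \<iota> u x - hom_part \<iota> v x"
  by (simp add: hom_part_def left_diff_distrib axis_diff sum_subtractf)

lemma hom_part_scaleR: "hom_part \<iota> (c *\<^sub>R u) x = c *\<^sub>R hom_part \<iota> u x"
  by (simp add: hom_part_def axis_scaleR scaleR_sum_right)

lemma hom_part_zero_left [simp]: "hom_part \<iota> 0 x = 0"
  using hom_part_scaleR[of \<iota> 0 0 x] by simp

lemma hom_deriv_add: "hom_deriv \<iota> (u + v) x w = hom_deriv \<iota> u x w + hom_deriv \<iota> v x w"
  by (simp add: hom_deriv_def distrib_right axis_add sum.distrib)

lemma hom_deriv_diff: "hom_deriv \<iota> (u - v) x w = hom_deriv \<iota> u x w - hom_deriv \<iota> v x w"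
  by (simp add: hom_deriv_def left_diff_distrib axis_diff sum_subtractf)

lemma hom_part_has_derivative_joint:
  assumes "(p has_derivative p') (at z)" "(q has_derivative q') (at z)"
  shows "((\<lambda>z. hom_part \<iota> (p z) (q z)) has_derivative
    (\<lambda>v. hom_deriv \<iota> (p z) (q z) (q' v) + hom_part \<iota> (p' v) (q z))) (at z)"
proof -
  have "((\<lambda>z. p z $ j * monom_vec (q z) (fst (\<iota> j))) has_derivative
      (\<lambda>v. p z $ j * monom_deriv (fst (\<iota> j)) (q z) (q' v) + p' v $ j * monom_vec (q z) (fst (\<iota> j)))) (at z)" for j
    by (intro has_derivative_mult bounded_linear.has_derivative[OF bounded_linear_vec_nth]
        has_derivative_compose[OF assms(2) monom_vec_has_derivative] assms(1))
  from has_derivative_sum[OF bounded_linear.has_derivative[OF bounded_linear_axis this]]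
  show ?thesis unfolding hom_part_def hom_deriv_def by (simp add: axis_add sum.distrib)
qed

lemma hom_part_has_derivative: "(hom_part \<iota> u has_derivative hom_deriv \<iota> u x) (at x)"
  using hom_part_has_derivative_joint[OF has_derivative_const[of u] has_derivative_ident, of \<iota> x] by simp

lemma linear_hom_deriv: "linear (hom_deriv \<iota> u x)"
  by (rule has_derivative_linear[OF hom_part_has_derivative])

lemma sanalytic_monom_vec: "sanalytic (\<lambda>x. monom_vec x \<omega>) a"
  unfolding monom_vec_def by (intro sanalytic_prod sanalytic_power sanalytic_nth) auto

lemma sanalytic_if: "sanalytic f a \<Longrightarrow> sanalytic g a \<Longrightarrow> sanalytic (\<lambda>z. if c then f z else g z) a"
  by (cases c) simp_all

lemma hom_part_nth: "hom_part \<iota> u x $ i = (\<Sum>j\<in>UNIV. if snd (\<iota> j) = i then u $ j * monom_vec x (fst (\<iota> j)) else 0)"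
  unfolding hom_part_def by (simp add: axis_def if_distrib cong: if_cong) (intro sum.cong, auto)

lemma analytic_near_compose:
  fixes F :: "'a::real_or_complex^'m \<Rightarrow> 'a^'l" and g :: "'a^'l \<Rightarrow> 'a^'q"
  assumes "analytic_near g (F a)" "analytic_near F a"
  shows "analytic_near (\<lambda>x. g (F x)) a"
  using assms sanalytic_compose[of "\<lambda>y. g y $ _" F a] unfolding analytic_near_iff_sanalytic by blast

lemma analytic_near_add:
  assumes "analytic_near f a" "analytic_near g a"
  shows "analytic_near (\<lambda>x. f x + g x) a"
  using assms unfolding analytic_near_iff_sanalytic by (auto intro: sanalytic_add)

lemma analytic_near_diff:
  assumes "analytic_near f a" "analytic_near g a"
  shows "analytic_near (\<lambda>x. f x - g x) a"
  using assms unfolding analytic_near_iff_sanalytic by (auto intro: sanalytic_diff)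

lemma analytic_near_fst_vec: "analytic_near fst_vec a"
  unfolding analytic_near_iff_sanalytic fst_vec_def by (simp add: sanalytic_nth)

lemma analytic_near_snd_vec: "analytic_near snd_vec a"
  unfolding analytic_near_iff_sanalytic snd_vec_def by (simp add: sanalytic_nth)

lemma analytic_near_pair_vec:
  assumes "analytic_near f a" "analytic_near g a"
  shows "analytic_near (\<lambda>x. pair_vec (f x) (g x)) a"
  unfolding analytic_near_iff_sanalytic
proof
  fix i
  show "sanalytic (\<lambda>x. pair_vec (f x) (g x) $ i) a"
    using assms unfolding analytic_near_iff_sanalytic by (cases i) simp_all
qed

lemma analytic_near_hom_part:
  assumes "analytic_near p a" "analytic_near q a"
  shows "analytic_near (\<lambda>z. hom_part \<iota> (p z) (q z)) a"
  unfolding analytic_near_iff_sanalytic hom_part_nth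
proof
  fix i
  have "sanalytic (\<lambda>z. if snd (\<iota> j) = i then p z $ j * monom_vec (q z) (fst (\<iota> j)) else 0) a" for j
    using assms unfolding analytic_near_iff_sanalytic
    by (intro sanalytic_if sanalytic_mult sanalytic_const sanalytic_compose[OF sanalytic_monom_vec]) auto
  then show "sanalytic (\<lambda>z. \<Sum>j\<in>UNIV. if snd (\<iota> j) = i then p z $ j * monom_vec (q z) (fst (\<iota> j)) else 0) a"
    by (intro sanalytic_sum) auto
qed

lemma analytic_near_continuous: "analytic_near f a \<Longrightarrow> isCont f a"
  by (metis analytic_near_has_derivative has_derivative_continuous)

section \<open>The derivative in the parameters and its right inverse\<close>

locale homogeneous_parameters =
  fixes \<iota> :: "'c::finite \<Rightarrow> ('n::finite \<Rightarrow> nat) \<times> 'k::finite" and r :: nat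
  assumes bij: "bij_betw \<iota> UNIV (degree_pairs r)" and r_pos: "r > 0"
begin

lemma degree_of_\<iota>: "degree_of (fst (\<iota> j)) = r"
proof -
  have "\<iota> j \<in> degree_pairs r" using bij by (auto simp: bij_betw_def)
  then show ?thesis by (simp add: degree_pairs_def degree_of_def case_prod_unfold)
qed

lemma norm_hom_part_le: "norm (hom_part \<iota> u x) \<le> CARD('c) * (norm u * norm x ^ r)"
proof -
  have "norm (axis (snd (\<iota> j)) (u $ j * monom_vec x (fst (\<iota> j)))) \<le> norm u * norm x ^ r" for j
    by (rule order_trans[OF norm_axis_le])
      (use norm_monom_vec_le[of x "norm x" "fst (\<iota> j)"] in
       \<open>auto simp: norm_mult degree_of_\<iota> Finite_Cartesian_Product.norm_nth_le intro!: mult_mono\<close>)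
  then have "norm (hom_part \<iota> u x) \<le> (\<Sum>j\<in>(UNIV :: 'c set). norm u * norm x ^ r)"
    unfolding hom_part_def by (intro sum_norm_le)
  then show ?thesis by simp
qed

lemma norm_hom_deriv_le: "norm (hom_deriv \<iota> u x v) \<le> CARD('c) * r * (norm u * norm x ^ (r - 1) * norm v)"
proof -
  have "norm (axis (snd (\<iota> j)) (u $ j * monom_deriv (fst (\<iota> j)) x v)) \<le> norm u * (r * norm x ^ (r - 1) * norm v)" for j
    by (rule order_trans[OF norm_axis_le])
      (use norm_monom_deriv_le[of "fst (\<iota> j)" x v] in
       \<open>auto simp: norm_mult degree_of_\<iota> Finite_Cartesian_Product.norm_nth_le intro!: mult_mono\<close>)
  then have "norm (hom_deriv \<iota> u x v) \<le> (\<Sum>j\<in>(UNIV :: 'c set). norm u * (r * norm x ^ (r - 1) * norm v))"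
    unfolding hom_deriv_def by (intro sum_norm_le)
  then show ?thesis by (simp add: mult_ac)
qed

text \<open>The label of the coefficient of x_m^r e_i.\<close>

definition idx :: "'n \<Rightarrow> 'k \<Rightarrow> 'c" where
  "idx m i = inv_into UNIV \<iota> ((\<lambda>j. if j = m then r else 0), i)"

lemma \<iota>_idx: "\<iota> (idx m i) = ((\<lambda>j. if j = m then r else 0), i)"
  unfolding idx_def using bij
  by (intro f_inv_into_f) (auto simp: bij_betw_def degree_pairs_def)

lemma inj_idx: "inj (idx m)"
  by (rule injI) (metis \<iota>_idx snd_conv)

lemma inv_idx [simp]: "inv (idx m) (idx m i) = i"
  by (simp add: inj_idx)

definition off_slots :: "'n \<Rightarrow> 'a::real_or_complex^'c \<Rightarrow> 'a^'c" where
  "off_slots m u = (\<chi> j. if j \<in> range (idx m) then 0 else u $ j)"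

definition slots :: "'n \<Rightarrow> 'a::real_or_complex^'c \<Rightarrow> 'a^'k" where
  "slots m u = (\<chi> i. u $ idx m i)"

text \<open>The coefficients of the x_m^r e_i contribute x_m^r times an arbitrary vector. This is
  the part that can be inverted wherever x_m is nonzero.\<close>

lemma hom_part_split:
  "hom_part \<iota> u x = hom_part \<iota> (off_slots m u) x + (x $ m) ^ r *s slots m u"
proof (subst vec_eq_iff, intro allI)
  fix i
  let ?t = "\<lambda>u j. if snd (\<iota> j) = i then u $ j * monom_vec x (fst (\<iota> j)) else 0"
  have mon: "monom_vec x (\<lambda>j. if j = m then r else 0) = (x $ m) ^ r"
    by (simp add: monom_vec_def if_distrib[of "\<lambda>n. _ ^ n"] cong: if_cong)
  have "(\<Sum>j\<in>UNIV. ?t u j) = (\<Sum>j\<in>UNIV - range (idx m). ?t u j) + (\<Sum>j\<in>range (idx m). ?t u j)"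
    by (rule sum.subset_diff) auto
  also have "(\<Sum>j\<in>range (idx m). ?t u j) = (\<Sum>i'\<in>UNIV. ?t u (idx m i'))"
    using inj_idx by (simp add: sum.reindex)
  also have "\<dots> = u $ idx m i * (x $ m) ^ r"
    by (simp add: \<iota>_idx mon)
  also have "(\<Sum>j\<in>UNIV - range (idx m). ?t u j) = (\<Sum>j\<in>UNIV. ?t (off_slots m u) j)"
    by (rule sum.mono_neutral_cong_left) (auto simp: off_slots_def)
  finally show "hom_part \<iota> u x $ i = (hom_part \<iota> (off_slots m u) x + (x $ m) ^ r *s slots m u) $ i"
    by (simp add: hom_part_nth slots_def mult.commute)
qed

text \<open>With x_m of largest modulus, division by x_m^r solves the equation using the pure powers
  of x_m alone. As |x| \<le> n |x_m|, the loss against |x|^r is at most n^r, and passing from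
  entries to the norm of u costs the number of parameters; so K does not depend on x.\<close>

lemma hom_part_surj:
  obtains K where "K > 0"
    "\<And>(x :: 'a::real_or_complex^'n) y. x \<noteq> 0 \<Longrightarrow> \<exists>u. hom_part \<iota> u x = y \<and> norm u * norm x ^ r \<le> K * norm y"
proof -
  have "\<exists>u. hom_part \<iota> u x = y \<and> norm u * norm x ^ r \<le> CARD('c) * CARD('n) ^ r * norm y"
    if "x \<noteq> 0" for x :: "'a^'n" and y
  proof -
    obtain m where m: "\<And>j. norm (x $ j) \<le> norm (x $ m)"
    proof -
      have "Max (range (\<lambda>j. norm (x $ j))) \<in> range (\<lambda>j. norm (x $ j))" by (intro Max_in) auto
      then obtain m where "norm (x $ m) = Max (range (\<lambda>j. norm (x $ j)))" by (metis imageE)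
      then show thesis by (intro that[of m]) simp
    qed
    have "norm x \<le> (\<Sum>j\<in>UNIV. norm (x $ j))" by (rule norm_vec_le_sum)
    also have "\<dots> \<le> (\<Sum>j\<in>(UNIV :: 'n set). norm (x $ m))" by (intro sum_mono m)
    finally have xm: "norm x \<le> CARD('n) * norm (x $ m)" by simp
    then have m0: "x $ m \<noteq> 0" using that by auto
    define u :: "'a^'c" where "u = (\<chi> j. if j \<in> range (idx m) then y $ snd (\<iota> j) / (x $ m) ^ r else 0)"
    have "off_slots m u = 0" by (simp add: off_slots_def u_def vec_eq_iff)
    moreover have "(x $ m) ^ r *s slots m u = y"
      using m0 by (simp add: slots_def u_def vec_eq_iff \<iota>_idx)
    ultimately have "hom_part \<iota> u x = y" using hom_part_split[of u x m] by simp
    moreover have "norm u * norm x ^ r \<le> CARD('c) * CARD('n) ^ r * norm y"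
    proof -
      have "norm (u $ j) \<le> norm y / norm (x $ m) ^ r" for j
        by (auto simp: u_def norm_divide norm_power intro!: divide_right_mono Finite_Cartesian_Product.norm_nth_le)
      then have "norm u \<le> (\<Sum>j\<in>(UNIV :: 'c set). norm y / norm (x $ m) ^ r)"
        by (intro order_trans[OF norm_vec_le_sum] sum_mono)
      then have "norm u \<le> CARD('c) * (norm y / norm (x $ m) ^ r)" by simp
      moreover have "norm x ^ r \<le> (CARD('n) * norm (x $ m)) ^ r" using xm by (intro power_mono) auto
      ultimately have "norm u * norm x ^ r \<le> (CARD('c) * (norm y / norm (x $ m) ^ r)) * (CARD('n) * norm (x $ m)) ^ r"
        by (intro mult_mono) auto
      also have "\<dots> = CARD('c) * CARD('n) ^ r * norm y" using m0 by (simp add: power_mult_distrib)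
      finally show ?thesis .
    qed
    ultimately show ?thesis by blast
  qed
  then show thesis by (intro that[of "CARD('c) * CARD('n) ^ r"]) auto
qed

abbreviation \<beta> :: "('a::real_or_complex^'n \<Rightarrow> 'a^'k) \<Rightarrow> 'a^('n + 'c) \<Rightarrow> 'a^('n + 'k)" where
  "\<beta> f\<^sub>0 \<equiv> family_map (perturbed_family f\<^sub>0 \<iota>)"

lemma \<beta>_eq: "\<beta> f\<^sub>0 z = pair_vec (fst_vec z) (f\<^sub>0 (fst_vec z) + hom_part \<iota> (snd_vec z) (fst_vec z))"
  by (simp add: family_map_def perturbed_family_eq)

lemma analytic_near_\<beta>:
  assumes "analytic_near f\<^sub>0 (fst_vec z)"
  shows "analytic_near (\<beta> f\<^sub>0) z"
  unfolding \<beta>_eq[abs_def]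
  by (intro analytic_near_pair_vec analytic_near_add analytic_near_hom_part analytic_near_fst_vec
      analytic_near_snd_vec analytic_near_compose[where F = fst_vec and g = f\<^sub>0, OF assms])

lemma \<beta>_has_derivative:
  assumes "(f\<^sub>0 has_derivative f') (at (fst_vec z))"
  shows "(\<beta> f\<^sub>0 has_derivative (\<lambda>v. pair_vec (fst_vec v)
     (f' (fst_vec v) + hom_deriv \<iota> (snd_vec z) (fst_vec z) (fst_vec v) + hom_part \<iota> (snd_vec v) (fst_vec z)))) (at z)"
  unfolding \<beta>_eq[abs_def] add.assoc
  by (intro has_derivative_pair_vec has_derivative_add hom_part_has_derivative_joint
      has_derivative_compose[where f = fst_vec and g = f\<^sub>0, OF _ assms] bounded_linear_imp_has_derivative bounded_linear_fst_vec bounded_linear_snd_vec)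

text \<open>Near a point with \<open>x\<^sub>m \<noteq> 0\<close> the values \<open>y = f\<^sub>u(x)\<close> can replace the coefficients of
  \<open>x\<^sub>m\<^sup>r e\<^sub>i\<close> as coordinates, which straightens \<open>\<beta>\<close> to a projection.\<close>

definition to_y :: "'n \<Rightarrow> 'a::real_or_complex^('n + 'c) \<Rightarrow> 'a^('n + 'k)" where
  "to_y m z = pair_vec (fst_vec z) (slots m (snd_vec z))"

text \<open>It overwrites exactly the coordinates that \<open>to_y m\<close> reads and keeps the
  remaining coefficients of \<open>z\<close>.\<close>

definition put_y :: "'n \<Rightarrow> 'a::real_or_complex^('n + 'k) \<Rightarrow> 'a^('n + 'c) \<Rightarrow> 'a^('n + 'c)" where
  "put_y m q z = pair_vec (fst_vec q)
     (\<chi> j. if j \<in> range (idx m) then snd_vec q $ inv (idx m) j else snd_vec z $ j)"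

lemma to_y_put_y [simp]: "to_y m (put_y m q z) = q"
  by (simp add: to_y_def put_y_def slots_def vec_lambda_eta)

lemma put_y_to_y [simp]: "put_y m (to_y m z) z = z"
proof -
  have "(\<chi> j. if j \<in> range (idx m) then slots m (snd_vec z) $ inv (idx m) j else snd_vec z $ j) = snd_vec z"
    by (auto simp: vec_eq_iff slots_def f_inv_into_f)
  then show ?thesis by (simp add: to_y_def put_y_def cong: if_cong)
qed

lemma put_y_put_y [simp]: "put_y m q (put_y m q' z) = put_y m q z"
  by (simp add: put_y_def cong: if_cong)

lemma off_slots_put_y [simp]: "off_slots m (snd_vec (put_y m q z)) = off_slots m (snd_vec z)"
  by (simp add: put_y_def off_slots_def vec_eq_iff)

lemma fst_vec_put_y [simp]: "fst_vec (put_y m q z) = fst_vec q"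
  by (simp add: put_y_def)

lemma slots_put_y [simp]: "slots m (snd_vec (put_y m q z)) = snd_vec q"
  by (simp add: put_y_def slots_def)

lemma analytic_near_to_y: "analytic_near (to_y m) a"
proof -
  have "analytic_near (\<lambda>z :: 'a::real_or_complex^('n + 'c). slots m (snd_vec z)) a" for a
    unfolding analytic_near_iff_sanalytic by (simp add: slots_def snd_vec_def sanalytic_nth)
  then show ?thesis unfolding to_y_def[abs_def]
    by (intro analytic_near_pair_vec analytic_near_fst_vec)
qed

lemma analytic_near_put_y:
  assumes "analytic_near q a"
  shows "analytic_near (\<lambda>z. put_y m (q z) z) a"
proof -
  have "analytic_near (\<lambda>z. snd_vec (q z)) a"
    by (rule analytic_near_compose[OF analytic_near_snd_vec assms])
  then have "analytic_near (\<lambda>z. \<chi> j. if j \<in> range (idx m) then snd_vec (q z) $ inv (idx m) j else snd_vec z $ j) a"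
    using analytic_near_snd_vec[of a] unfolding analytic_near_iff_sanalytic vec_lambda_beta
    by (intro allI sanalytic_if) auto
  then show ?thesis unfolding put_y_def
    by (intro analytic_near_pair_vec analytic_near_compose[OF analytic_near_fst_vec assms])
qed

lemma analytic_near_off_slots: "analytic_near (\<lambda>z. off_slots m (snd_vec z)) a"
proof -
  have "sanalytic (\<lambda>z. if j \<in> range (idx m) then 0 else snd_vec z $ j) a" for j
    using analytic_near_snd_vec[of a] unfolding analytic_near_iff_sanalytic
    by (intro sanalytic_if sanalytic_const) auto
  then show ?thesis unfolding analytic_near_iff_sanalytic by (simp add: off_slots_def)
qed

text \<open>For q = (x, y) this computes the slots for which f_u(x) = y while the other coefficients
  stay as in \<open>z\<close>. It returns x along with them, in the form that \<open>put_y\<close>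
  accepts.\<close>

definition solve_y :: "('a::real_or_complex^'n \<Rightarrow> 'a^'k) \<Rightarrow> 'n \<Rightarrow> 'a^('n + 'k) \<Rightarrow> 'a^('n + 'c) \<Rightarrow> 'a^('n + 'k)" where
  "solve_y f\<^sub>0 m q z = pair_vec (fst_vec q)
     (inverse (fst_vec q $ m) ^ r *s (snd_vec q - f\<^sub>0 (fst_vec q) - hom_part \<iota> (off_slots m (snd_vec z)) (fst_vec q)))"

lemma solve_y_put_y [simp]: "solve_y f\<^sub>0 m q (put_y m q' z) = solve_y f\<^sub>0 m q z"
  by (simp add: solve_y_def)

lemma fst_vec_solve_y [simp]: "fst_vec (solve_y f\<^sub>0 m q z) = fst_vec q"
  by (simp add: solve_y_def)

lemma solve_y_\<beta>:
  assumes "fst_vec z $ m \<noteq> 0"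
  shows "solve_y f\<^sub>0 m (\<beta> f\<^sub>0 z) z = to_y m z"
proof -
  have "inverse (fst_vec z $ m) ^ r *s ((fst_vec z $ m) ^ r *s slots m (snd_vec z)) = slots m (snd_vec z)"
    using assms by (simp add: vec_eq_iff power_inverse)
  then show ?thesis
    by (simp add: solve_y_def \<beta>_eq to_y_def hom_part_split[of "snd_vec z" _ m])
qed

lemma \<beta>_put_y_solve_y:
  fixes f\<^sub>0 :: "'a::real_or_complex^'n \<Rightarrow> 'a^'k"
  assumes "fst_vec q $ m \<noteq> 0"
  shows "\<beta> f\<^sub>0 (put_y m (solve_y f\<^sub>0 m q z) z) = q"
proof -
  have "(fst_vec q $ m) ^ r *s (inverse (fst_vec q $ m) ^ r *s w) = w" for w :: "'a^'k"
    using assms by (simp add: vec_eq_iff power_inverse)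
  then have "hom_part \<iota> (snd_vec (put_y m (solve_y f\<^sub>0 m q z) z)) (fst_vec q) = snd_vec q - f\<^sub>0 (fst_vec q)"
    by (simp add: hom_part_split[of "snd_vec (put_y m (solve_y f\<^sub>0 m q z) z)" _ m]) (simp add: solve_y_def)
  then show ?thesis by (simp add: \<beta>_eq)
qed

lemma analytic_near_solve_y:
  assumes "analytic_near q a" "analytic_near f\<^sub>0 (fst_vec (q a))" "fst_vec (q a) $ m \<noteq> 0"
  shows "analytic_near (\<lambda>z. solve_y f\<^sub>0 m (q z) z) a"
proof -
  have 1: "analytic_near (\<lambda>z. fst_vec (q z)) a" "analytic_near (\<lambda>z. snd_vec (q z)) a"
    by (intro analytic_near_compose[OF _ assms(1)] analytic_near_fst_vec analytic_near_snd_vec)+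
  have 2: "analytic_near (\<lambda>z. snd_vec (q z) - f\<^sub>0 (fst_vec (q z)) - hom_part \<iota> (off_slots m (snd_vec z)) (fst_vec (q z))) a"
    by (intro analytic_near_diff 1 analytic_near_hom_part analytic_near_off_slots
      analytic_near_compose[where F = "\<lambda>z. fst_vec (q z)" and g = f\<^sub>0, OF assms(2)])
  have 3: "sanalytic (\<lambda>z. inverse (fst_vec (q z) $ m) ^ r) a"
    using 1(1) assms(3) unfolding analytic_near_iff_sanalytic by (intro sanalytic_power sanalytic_inverse) auto
  have "analytic_near (\<lambda>z. inverse (fst_vec (q z) $ m) ^ r *s
      (snd_vec (q z) - f\<^sub>0 (fst_vec (q z)) - hom_part \<iota> (off_slots m (snd_vec z)) (fst_vec (q z)))) a"
    unfolding analytic_near_iff_sanalytic vector_smult_component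
    by (intro allI sanalytic_mult 3) (use 2 in \<open>simp add: analytic_near_iff_sanalytic\<close>)
  then show ?thesis unfolding solve_y_def by (intro analytic_near_pair_vec 1)
qed

text \<open>In the straightened coordinates \<open>\<beta>\<close> is a projection, so a chart of W
  on the coordinates (x, y), completed by the untouched coefficients, is a chart of the preimage.
  Its linear model consists of the points that \<open>to_y m\<close> sends into the model of
  W.\<close>

lemma submanifold_at_preimage:
  fixes f\<^sub>0 :: "'a::real_or_complex^'n \<Rightarrow> 'a^'k"
  assumes W: "submanifold_at d W (\<beta> f\<^sub>0 p)" and x0: "fst_vec p \<noteq> 0" and f\<^sub>0: "analytic_near f\<^sub>0 (fst_vec p)"
  shows "\<exists>d. submanifold_at d (\<beta> f\<^sub>0 -` W) p"
proof -
  from W[unfolded submanifold_at_def] obtain U V L and \<phi> \<psi> :: "'a^('n + 'k) \<Rightarrow> 'a^('n + 'k)" where H: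
    "open U \<and> \<beta> f\<^sub>0 p \<in> U \<and> open V \<and> homeomorphism U V \<phi> \<psi> \<and> (\<forall>z\<in>U. analytic_near \<phi> z) \<and>
     (\<forall>z\<in>V. analytic_near \<psi> z) \<and> vec.subspace L \<and> vec.dim L = d \<and> \<phi> ` (W \<inter> U) = V \<inter> L"
    by (elim exE)
  have *: "open U" "\<beta> f\<^sub>0 p \<in> U" "open V" "homeomorphism U V \<phi> \<psi>"
    "\<And>z. z \<in> U \<Longrightarrow> analytic_near \<phi> z" "\<And>z. z \<in> V \<Longrightarrow> analytic_near \<psi> z"
    "vec.subspace L" "\<phi> ` (W \<inter> U) = V \<inter> L"
    using H by simp_all
  have inv: "\<And>z. z \<in> U \<Longrightarrow> \<psi> (\<phi> z) = z" "\<And>z. z \<in> V \<Longrightarrow> \<phi> (\<psi> z) = z"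
    "\<And>z. z \<in> U \<Longrightarrow> \<phi> z \<in> V" "\<And>z. z \<in> V \<Longrightarrow> \<psi> z \<in> U"
    using *(4) by (auto simp: homeomorphism_def)
  obtain m where m: "fst_vec p $ m \<noteq> 0" using x0 by (auto simp: vec_eq_iff)
  obtain N where N: "open N" "fst_vec p \<in> N" "\<And>x. x \<in> N \<Longrightarrow> analytic_near f\<^sub>0 x"
    using analytic_near_open[OF f\<^sub>0] by blast
  define N' where "N' = N \<inter> {x. x $ m \<noteq> 0}"
  have "open {x :: 'a^'n. x $ m \<noteq> 0}" by (intro open_Collect_neq continuous_intros)
  then have N': "open N'" "fst_vec p \<in> N'" using N m by (auto simp: N'_def)
  define U' where "U' = {z. fst_vec z \<in> N'} \<inter> \<beta> f\<^sub>0 -` U"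
  define V' where "V' = to_y m -` V \<inter> {z. fst_vec (\<psi> (to_y m z)) \<in> N'}"
  \<comment> \<open>The chart value of \<open>\<beta>\<close> at z replaces both x and the slots.
    The inverse \<open>\<Psi>\<close> undoes the chart of W and then solves for the slots, which
    requires x_m to be nonzero and explains \<open>N'\<close>.\<close>
  define \<Phi> where "\<Phi> z = put_y m (\<phi> (\<beta> f\<^sub>0 z)) z" for z
  define \<Psi> where "\<Psi> z = put_y m (solve_y f\<^sub>0 m (\<psi> (to_y m z)) z) z" for z
  have an\<beta>: "analytic_near (\<beta> f\<^sub>0) z" if "fst_vec z \<in> N'" for z
    using that N(3) by (intro analytic_near_\<beta>) (auto simp: N'_def)
  have openN: "open {z :: 'a^('n + 'c). fst_vec z \<in> N'}"
    using open_vimage[OF N'(1) linear_continuous_on[OF bounded_linear_fst_vec]] by (simp add: vimage_def)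
  have U': "open U'"
    unfolding U'_def using an\<beta> analytic_near_continuous
    by (intro continuous_open_preimage[OF _ openN *(1)] continuous_at_imp_continuous_on) auto
  have openV: "open (to_y m -` V)"
    using analytic_near_to_y analytic_near_continuous
    by (intro open_vimage[OF *(3)] continuous_at_imp_continuous_on) auto
  have an\<psi>: "analytic_near (\<lambda>z. \<psi> (to_y m z)) z" if "to_y m z \<in> V" for z
    by (rule analytic_near_compose[OF *(6)[OF that] analytic_near_to_y])
  have V': "open V'"
  proof -
    have "continuous_on (to_y m -` V) (\<lambda>z. fst_vec (\<psi> (to_y m z)))"
      using analytic_near_compose[OF analytic_near_fst_vec an\<psi>] analytic_near_continuous
      by (intro continuous_at_imp_continuous_on) auto
    from continuous_open_preimage[OF this openV N'(1)] show ?thesis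
      by (simp add: V'_def vimage_def Int_def)
  qed
  have an\<Phi>: "analytic_near \<Phi> z" if "z \<in> U'" for z
    unfolding \<Phi>_def[abs_def]
    by (intro analytic_near_put_y analytic_near_compose[OF *(5) an\<beta>]) (use that in \<open>auto simp: U'_def\<close>)
  have an\<Psi>: "analytic_near \<Psi> z" if "z \<in> V'" for z
    unfolding \<Psi>_def[abs_def]
    by (intro analytic_near_put_y analytic_near_solve_y an\<psi>) (use that N(3) in \<open>auto simp: V'_def N'_def\<close>)
  have \<Psi>\<Phi>: "\<Psi> (\<Phi> z) = z" and \<Phi>V: "\<Phi> z \<in> V'" if "z \<in> U'" for z
  proof -
    have z: "\<beta> f\<^sub>0 z \<in> U" "fst_vec z \<in> N'" "fst_vec z $ m \<noteq> 0" using that by (auto simp: U'_def N'_def)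
    have f: "fst_vec (\<beta> f\<^sub>0 z) = fst_vec z" by (simp add: \<beta>_eq)
    show "\<Phi> z \<in> V'" using z inv(1,3) f by (simp add: V'_def \<Phi>_def)
    show "\<Psi> (\<Phi> z) = z"
      using z by (simp add: \<Psi>_def \<Phi>_def inv(1) solve_y_\<beta>)
  qed
  have \<beta>\<Psi>: "\<beta> f\<^sub>0 (\<Psi> z) = \<psi> (to_y m z)" if "z \<in> V'" for z
    using that by (auto simp: V'_def N'_def \<Psi>_def \<beta>_put_y_solve_y)
  have \<Phi>\<Psi>: "\<Phi> (\<Psi> z) = z" and \<Psi>U: "\<Psi> z \<in> U'" if "z \<in> V'" for z
  proof -
    have z: "to_y m z \<in> V" "fst_vec (\<psi> (to_y m z)) \<in> N'" using that by (auto simp: V'_def)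
    show "\<Psi> z \<in> U'" unfolding U'_def using \<beta>\<Psi>[OF that] z inv(4) by (simp add: \<Psi>_def)
    show "\<Phi> (\<Psi> z) = z" using \<beta>\<Psi>[OF that] z(1) inv(2) unfolding \<Phi>_def by (simp add: \<Psi>_def)
  qed
  define L' where "L' = {z :: 'a^('n + 'c). to_y m z \<in> L}"
  have L': "vec.subspace L'"
  proof -
    have "to_y m (0 :: 'a^('n + 'c)) = 0" "to_y m (x + y) = to_y m x + to_y m y" "to_y m (c *s x) = c *s to_y m x"
      for x y :: "'a^('n + 'c)" and c
      by (auto simp: to_y_def slots_def fst_vec_def snd_vec_def pair_vec_def vec_eq_iff split: sum.splits)
    then show ?thesis
      unfolding vec.subspace_def L'_def
      using vec.subspace_0[OF *(7)] vec.subspace_add[OF *(7)] vec.subspace_scale[OF *(7)] by simp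
  qed
  have img: "\<Phi> ` (\<beta> f\<^sub>0 -` W \<inter> U') = V' \<inter> L'"
  proof (intro equalityI subsetI)
    fix y assume "y \<in> \<Phi> ` (\<beta> f\<^sub>0 -` W \<inter> U')"
    then obtain z where z: "y = \<Phi> z" "\<beta> f\<^sub>0 z \<in> W" "z \<in> U'" by blast
    have "\<phi> (\<beta> f\<^sub>0 z) \<in> L" using z *(8) by (auto simp: U'_def)
    then show "y \<in> V' \<inter> L'" using \<Phi>V[OF z(3)] z(1) by (simp add: L'_def \<Phi>_def)
  next
    fix y assume y: "y \<in> V' \<inter> L'"
    then have "to_y m y \<in> V \<inter> L" by (auto simp: V'_def L'_def)
    then obtain q where q: "q \<in> W \<inter> U" "to_y m y = \<phi> q" using *(8) by (metis imageE)
    then have "\<beta> f\<^sub>0 (\<Psi> y) \<in> W" using \<beta>\<Psi>[of y] y inv(1)[of q] by simp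
    then show "y \<in> \<Phi> ` (\<beta> f\<^sub>0 -` W \<inter> U')"
      using \<Phi>\<Psi>[of y] \<Psi>U[of y] y by (metis IntD1 IntI image_eqI vimageI2)
  qed
  have hom: "homeomorphism U' V' \<Phi> \<Psi>"
    using an\<Phi> an\<Psi> analytic_near_continuous \<Phi>V \<Psi>U \<Phi>\<Psi> \<Psi>\<Phi>
    by (intro homeomorphismI continuous_at_imp_continuous_on) auto
  have "p \<in> U'" using N'(2) *(2) by (simp add: U'_def)
  with U' V' hom an\<Phi> an\<Psi> L' img have "submanifold_at (vec.dim L') (\<beta> f\<^sub>0 -` W) p"
    unfolding submanifold_at_def
    by (intro exI[of _ U'] exI[of _ V'] exI[of _ \<Phi>] exI[of _ \<Psi>] exI[of _ L']) auto
  then show ?thesis by blast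
qed

text \<open>One inclusion is the chain rule. For the other, a curve in W with velocity B v is lifted
  through \<open>\<beta>\<close>: its x-component is kept, the parameter starts as the line with
  velocity v_2, and the bounded right inverse removes the remaining error, which is o(t).\<close>

lemma tangent_space_preimage:
  fixes f\<^sub>0 :: "'a::real_or_complex^'n \<Rightarrow> 'a^'k"
  assumes f\<^sub>0: "(f\<^sub>0 has_derivative f') (at (fst_vec z))" and x0: "fst_vec z \<noteq> 0"
    and B: "(\<beta> f\<^sub>0 has_derivative B) (at z)"
  shows "tangent_space (\<beta> f\<^sub>0 -` W) z = {v. B v \<in> tangent_space W (\<beta> f\<^sub>0 z)}"
proof (intro equalityI subsetI CollectI)
  fix v assume "v \<in> tangent_space (\<beta> f\<^sub>0 -` W) z"
  then obtain \<gamma> :: "real \<Rightarrow> _" where \<gamma>: "\<gamma> 0 = z" "\<forall>\<^sub>F t in nhds 0. \<gamma> t \<in> \<beta> f\<^sub>0 -` W"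
    "(\<gamma> has_vector_derivative v) (at 0)"
    unfolding tangent_space_def by blast
  have "((\<lambda>t. \<beta> f\<^sub>0 (\<gamma> t)) has_vector_derivative B v) (at 0)"
    by (rule has_vector_derivative_compose[OF \<gamma>(3)]) (use B \<gamma>(1) in simp)
  then show "B v \<in> tangent_space W (\<beta> f\<^sub>0 z)"
    unfolding tangent_space_def using \<gamma>(1,2) by (intro CollectI exI[of _ "\<lambda>t. \<beta> f\<^sub>0 (\<gamma> t)"]) auto
next
  fix v assume "v \<in> {v. B v \<in> tangent_space W (\<beta> f\<^sub>0 z)}"
  then obtain \<delta> :: "real \<Rightarrow> _" where \<delta>: "\<delta> 0 = \<beta> f\<^sub>0 z" "\<forall>\<^sub>F t in nhds 0. \<delta> t \<in> W"
    "(\<delta> has_vector_derivative B v) (at 0)"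
    unfolding tangent_space_def by blast
  have Beq: "B v = pair_vec (fst_vec v)
     (f' (fst_vec v) + hom_deriv \<iota> (snd_vec z) (fst_vec z) (fst_vec v) + hom_part \<iota> (snd_vec v) (fst_vec z))"
    using has_derivative_unique[OF B \<beta>_has_derivative[OF f\<^sub>0]] by simp
  obtain K where K: "K > 0" "\<And>(x :: 'a^'n) y. x \<noteq> 0 \<Longrightarrow> \<exists>u. hom_part \<iota> u x = y \<and> norm u * norm x ^ r \<le> K * norm y"
    using hom_part_surj[where 'a = 'a] by blast
  define x where "x t = fst_vec (\<delta> t)" for t
  \<comment> \<open>The amount by which the linear guess for the parameter misses the curve in W.
    Its value and velocity at 0 vanish by the choice of B v.\<close>
  define e where "e t = snd_vec (\<delta> t) - f\<^sub>0 (x t) - hom_part \<iota> (snd_vec z + t *\<^sub>R snd_vec v) (x t)" for t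
  have "\<exists>w. x t \<noteq> 0 \<longrightarrow> hom_part \<iota> w (x t) = e t \<and> norm w * norm (x t) ^ r \<le> K * norm (e t)" for t
    using K(2) by blast
  \<comment> \<open>The corrections are chosen separately for each t. The norm bound alone yields
    derivative 0 at t = 0, and a velocity requires no more.\<close>
  then obtain w where w: "\<And>t. x t \<noteq> 0 \<Longrightarrow> hom_part \<iota> (w t) (x t) = e t"
    "\<And>t. x t \<noteq> 0 \<Longrightarrow> norm (w t) * norm (x t) ^ r \<le> K * norm (e t)"
    by metis
  \<comment> \<open>Near t = 0 the curve stays at |x(t)| > a, so K / a^r bounds the right inverse
    uniformly.\<close>
  define a where "a = norm (fst_vec z) / 2"
  have a: "a > 0" "a < norm (fst_vec z)" using x0 by (auto simp: a_def)
  have xz: "x 0 = fst_vec z" using \<delta>(1) by (simp add: x_def \<beta>_eq)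
  have dx: "(x has_vector_derivative fst_vec v) (at 0)"
    using bounded_linear.has_vector_derivative[OF bounded_linear_fst_vec \<delta>(3)] by (simp add: x_def[abs_def] Beq)
  have e0: "e 0 = 0" using \<delta>(1) by (simp add: e_def xz \<beta>_eq)
  have de: "(e has_vector_derivative 0) (at 0)"
  proof -
    have 1: "((\<lambda>t. snd_vec (\<delta> t)) has_vector_derivative snd_vec (B v)) (at 0)"
      by (rule bounded_linear.has_vector_derivative[OF bounded_linear_snd_vec \<delta>(3)])
    have 2: "((\<lambda>t. f\<^sub>0 (x t)) has_vector_derivative f' (fst_vec v)) (at 0)"
      by (rule has_vector_derivative_compose[OF dx]) (use f\<^sub>0 xz in simp)
    have line: "((\<lambda>t :: real. snd_vec z + t *\<^sub>R snd_vec v) has_vector_derivative snd_vec v) (at 0)"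
      by (auto intro!: derivative_eq_intros)
    have 3: "((\<lambda>t. hom_part \<iota> (snd_vec z + t *\<^sub>R snd_vec v) (x t)) has_vector_derivative
       (hom_deriv \<iota> (snd_vec z) (fst_vec z) (fst_vec v) + hom_part \<iota> (snd_vec v) (fst_vec z))) (at 0)"
      using hom_part_has_derivative_joint[OF line[unfolded has_vector_derivative_def] dx[unfolded has_vector_derivative_def], of \<iota>]
      by (simp add: has_vector_derivative_def xz hom_part_scaleR linear_scale[OF linear_hom_deriv] scaleR_add_right)
    from has_vector_derivative_diff[OF has_vector_derivative_diff[OF 1 2] 3]
    show ?thesis by (simp add: e_def[abs_def] Beq algebra_simps)
  qed
  have evx: "\<forall>\<^sub>F t in nhds 0. norm (x t) > a"
  proof -
    have "((\<lambda>t. norm (x t)) \<longlongrightarrow> norm (x 0)) (nhds 0)"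
      using has_vector_derivative_continuous[OF dx]
      by (intro tendsto_norm) (simp add: continuous_at tendsto_at_iff_tendsto_nhds)
    then show ?thesis by (rule order_tendstoD) (use a xz in simp)
  qed
  have wle: "norm (w t) \<le> (K / a ^ r) * norm (e t)" if "norm (x t) > a" for t
  proof -
    have "norm (w t) * a ^ r \<le> norm (w t) * norm (x t) ^ r"
      using that a by (intro mult_left_mono power_mono) auto
    also have "\<dots> \<le> K * norm (e t)" by (rule w(2)) (use that a in auto)
    finally show ?thesis using a by (simp add: field_simps)
  qed
  have w0: "w 0 = 0" using wle[of 0] a xz e0 by simp
  have dw: "(w has_vector_derivative 0) (at 0)"
  proof -
    have "((\<lambda>h. norm (e h) / norm h) \<longlongrightarrow> 0) (at 0)"
      using de unfolding has_vector_derivative_def has_derivative_at by (simp add: e0)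
    then have "((\<lambda>h. (K / a ^ r) * (norm (e h) / norm h)) \<longlongrightarrow> 0) (at 0)"
      using tendsto_mult_right_zero by blast
    moreover have "\<forall>\<^sub>F h in at 0. norm (norm (w h) / norm h) \<le> (K / a ^ r) * (norm (e h) / norm h)"
      using filter_leD[OF at_within_le_nhds evx]
    proof eventually_elim
      case (elim h)
      from divide_right_mono[OF wle[OF elim], of "norm h"] show ?case by simp
    qed
    ultimately have "((\<lambda>h. norm (w h) / norm h) \<longlongrightarrow> 0) (at 0)"
      by (rule Lim_null_comparison[rotated])
    then show ?thesis unfolding has_vector_derivative_def has_derivative_at by (simp add: w0)
  qed
  define \<gamma> where "\<gamma> t = pair_vec (x t) (snd_vec z + t *\<^sub>R snd_vec v + w t)" for t
  have "((\<lambda>t. snd_vec z + t *\<^sub>R snd_vec v + w t) has_vector_derivative snd_vec v) (at 0)"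
    by (auto intro!: derivative_eq_intros dw)
  from has_vector_derivative_pair_vec[OF dx this]
  have "(\<gamma> has_vector_derivative v) (at 0)" by (simp add: \<gamma>_def[abs_def])
  moreover have "\<gamma> 0 = z" by (simp add: \<gamma>_def xz w0)
  moreover have "\<forall>\<^sub>F t in nhds 0. \<gamma> t \<in> \<beta> f\<^sub>0 -` W"
    using evx \<delta>(2)
  proof eventually_elim
    case (elim t)
    then have "x t \<noteq> 0" using a by auto
    then have "\<beta> f\<^sub>0 (\<gamma> t) = \<delta> t"
      using w(1)[of t] by (simp add: \<beta>_eq \<gamma>_def hom_part_add e_def) (simp add: x_def)
    then show ?case using elim by simp
  qed
  ultimately show "v \<in> tangent_space (\<beta> f\<^sub>0 -` W) z"
    unfolding tangent_space_def by blast
qed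

end

section \<open>Jet transversality and Verdier regularity\<close>

text \<open>Orders 0 and 1 of \<open>zero_jet_bound\<close> for g - f; order 1 is available because
  r > 0.\<close>

lemma jet_competitor_difference:
  fixes f g :: "'v::euclidean_space \<Rightarrow> 'w::real_normed_vector"
  assumes "Cr_near r f 0" and g: "jet_competitor r f g" and "r > 0" "\<eta> > 0"
  shows "\<forall>\<^sub>F x in nhds 0. norm (g x - f x) \<le> \<eta> * norm x ^ r \<and>
    (\<exists>p'. ((\<lambda>x. g x - f x) has_derivative p') (at x) \<and> (\<forall>v. norm (p' v) \<le> \<eta> * norm x ^ (r - 1) * norm v))"
proof -
  obtain U where U: "open U" "0 \<in> U" "Ck r U f" using assms(1) by (auto simp: Cr_near_iff_Ck)
  obtain V where V: "open V" "0 \<in> V" "Ck r V g" using g by (auto simp: jet_competitor_def Cr_near_iff_Ck)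
  define N where "N = U \<inter> V"
  have N: "open N" "0 \<in> N" "Ck r N f" "Ck r N g"
    using U V by (auto simp: N_def intro: Ck_subset)
  define p where "p x = g x - f x" for x
  have Cp: "Ck r N p" unfolding p_def[abs_def] by (rule Ck_diff[OF N(1,4,3)])
  have jet: "iter_deriv p vs 0 = 0" if "length vs \<le> r" for vs
    unfolding p_def[abs_def] using iter_deriv_diff[OF N(1,4,3) that N(2)] g that
    by (simp add: jet_competitor_def same_jet_def)
  have 0: "\<forall>\<^sub>F x in nhds 0. norm (p x) \<le> \<eta> * norm x ^ r"
    using zero_jet_bound[OF N(1,2) Cp jet, of "[]" \<eta>] \<open>\<eta> > 0\<close> by simp
  have "\<forall>\<^sub>F x in nhds 0. norm (iter_deriv p [b] x) \<le> (\<eta> / DIM('v)) * norm x ^ (r - 1)" for b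
    using zero_jet_bound[OF N(1,2) Cp jet, of "[b]" "\<eta> / DIM('v)"] \<open>\<eta> > 0\<close> \<open>r > 0\<close> by simp
  then have 1: "\<forall>\<^sub>F x in nhds 0. \<forall>b\<in>Basis. norm (iter_deriv p [b] x) \<le> (\<eta> / DIM('v)) * norm x ^ (r - 1)"
    by (subst eventually_ball_finite_distrib) auto
  have 2: "\<forall>\<^sub>F x in nhds 0. x \<in> N" using N(1,2) eventually_nhds_in_open by blast
  show ?thesis
    using 0 1 2
  proof eventually_elim
    case (elim x)
    have d: "(p has_derivative (\<lambda>v. iter_deriv p [v] x)) (at x)"
      using iter_deriv_has_derivative[OF Cp, of "[]" x] elim(3) \<open>r > 0\<close> by simp
    have lin: "linear (\<lambda>v. iter_deriv p [v] x)" by (rule has_derivative_linear[OF d])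
    have "norm (iter_deriv p [v] x) \<le> \<eta> * norm x ^ (r - 1) * norm v" for v
    proof -
      show ?thesis by (rule linear_norm_le_Basis[OF lin]) (use elim(2) in simp)
    qed
    with d elim(1) show ?case unfolding p_def[abs_def] by blast
  qed
qed

text \<open>The predicate \<open>P\<close> is kept abstract because two different obstructions are
  interpolated: non-transversality to W, and membership of the graph point in S.\<close>

lemma jet_competitor_interpolation:
  fixes f :: "'v::euclidean_space \<Rightarrow> 'w::real_normed_vector"
  assumes "Cr_near r f 0" "f 0 = 0" "r > 0"
    and ex: "\<And>\<epsilon>. \<epsilon> > 0 \<Longrightarrow> \<exists>x b A. x \<noteq> 0 \<and> norm x < \<epsilon> \<and> norm b \<le> \<epsilon> * norm x ^ r \<and> linear A \<and>
      (\<forall>v. norm (A v) \<le> \<epsilon> * norm x ^ (r - 1) * norm v) \<and> P x b A"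
  obtains g where "jet_competitor r f g" "isCont g 0"
    "\<And>\<epsilon>. \<epsilon> > 0 \<Longrightarrow> \<exists>x A. x \<noteq> 0 \<and> norm x < \<epsilon> \<and> ((\<lambda>x. g x - f x) has_derivative A) (at x) \<and> P x (g x - f x) A"
proof -
  obtain p where p: "Ck r UNIV p" "\<And>vs. length vs \<le> r \<Longrightarrow> iter_deriv p vs 0 = 0"
    "\<And>\<epsilon>. \<epsilon> > 0 \<Longrightarrow> \<exists>x A. x \<noteq> 0 \<and> norm x < \<epsilon> \<and> (p has_derivative A) (at x) \<and> P x (p x) A"
    using zero_jet_interpolation[where P = P, OF \<open>r > 0\<close> ex] by blast
  obtain U where U: "open U" "0 \<in> U" "Ck r U f" using assms(1) by (auto simp: Cr_near_iff_Ck)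
  have pU: "Ck r U p" by (rule Ck_subset[OF p(1)]) simp
  define g where "g x = f x + p x" for x
  have gU: "Ck r U g" unfolding g_def[abs_def] by (rule Ck_add[OF U(1,3) pU])
  show thesis
  proof (rule that[of g])
    have "iter_deriv g vs 0 = iter_deriv f vs 0" if "length vs \<le> r" for vs
      unfolding g_def[abs_def] using iter_deriv_add[OF U(1,3) pU that U(2)] p(2)[OF that] by simp
    then show "jet_competitor r f g"
      using gU U(1,2) assms(2) p(2)[of "[]"]
      by (auto simp: jet_competitor_def same_jet_def Cr_near_iff_Ck g_def)
    show "isCont g 0" using Ck_imp_continuous[OF gU] U(1,2) by (simp add: continuous_on_eq_continuous_at)
    fix \<epsilon> :: real assume "\<epsilon> > 0"
    moreover have "(\<lambda>x. g x - f x) = p" by (simp add: g_def fun_eq_iff)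
    ultimately show "\<exists>x A. x \<noteq> 0 \<and> norm x < \<epsilon> \<and> ((\<lambda>x. g x - f x) has_derivative A) (at x) \<and> P x (g x - f x) A"
      using p(3) by (simp add: g_def)
  qed
qed

lemma eventually_nhds_pair_vec:
  fixes x\<^sub>0 :: "'a::real_or_complex^'m::finite" and y\<^sub>0 :: "'a^'l::finite"
  assumes "\<forall>\<^sub>F w in nhds (pair_vec x\<^sub>0 y\<^sub>0). Q w"
  obtains \<delta> where "\<delta> > 0" "\<And>x y. norm (x - x\<^sub>0) < \<delta> \<Longrightarrow> norm (y - y\<^sub>0) < \<delta> \<Longrightarrow> Q (pair_vec x y)"
proof -
  obtain d where d: "d > 0" "\<And>w. dist w (pair_vec x\<^sub>0 y\<^sub>0) < d \<Longrightarrow> Q w"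
    using assms unfolding eventually_nhds_metric by blast
  show thesis
  proof (rule that[of "d / 2"])
    fix x y assume "norm (x - x\<^sub>0) < d / 2" "norm (y - y\<^sub>0) < d / 2"
    then have "norm (pair_vec (x - x\<^sub>0) (y - y\<^sub>0)) < d"
      using norm_pair_vec_le[of "x - x\<^sub>0" "y - y\<^sub>0"] by simp
    then show "Q (pair_vec x y)" by (intro d(2)) (simp add: dist_norm pair_vec_diff)
  qed (use d in simp)
qed

lemma frequently_nhds_pair_vec:
  fixes x\<^sub>0 :: "'a::real_or_complex^'m::finite" and y\<^sub>0 :: "'a^'l::finite"
  assumes "\<not> (\<forall>\<^sub>F w in nhds (pair_vec x\<^sub>0 y\<^sub>0). \<not> Q w)" "\<delta> > 0"
  obtains x y where "norm (x - x\<^sub>0) < \<delta>" "norm (y - y\<^sub>0) < \<delta>" "Q (pair_vec x y)"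
proof -
  obtain w where w: "dist w (pair_vec x\<^sub>0 y\<^sub>0) < \<delta>" "Q w"
    using assms unfolding eventually_nhds_metric by blast
  have "w - pair_vec x\<^sub>0 y\<^sub>0 = pair_vec (fst_vec w - x\<^sub>0) (snd_vec w - y\<^sub>0)"
    by (simp add: pair_vec_diff)
  then have "norm (fst_vec w - x\<^sub>0) < \<delta>" "norm (snd_vec w - y\<^sub>0) < \<delta>"
    using norm_fst_vec_le[of "w - pair_vec x\<^sub>0 y\<^sub>0"] norm_snd_vec_le[of "w - pair_vec x\<^sub>0 y\<^sub>0"] w(1)
    by (auto simp: dist_norm)
  then show thesis using w(2) by (intro that[of "fst_vec w" "snd_vec w"]) auto
qed

lemma orthogonal_to_proper_subspace:
  fixes S :: "'v::euclidean_space set"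
  assumes "subspace S" "S \<noteq> UNIV"
  obtains \<zeta> where "\<zeta> \<noteq> 0" "\<And>v. v \<in> S \<Longrightarrow> \<zeta> \<bullet> v = 0"
proof -
  have "S\<^sup>\<bottom> \<noteq> {0}" using orthogonal_comp_self[OF assms(1)] assms(2) by (metis orthogonal_comp_null)
  moreover have "0 \<in> S\<^sup>\<bottom>" by (simp add: orthogonal_comp_def orthogonal_def)
  ultimately obtain \<zeta> where "\<zeta> \<in> S\<^sup>\<bottom>" "\<zeta> \<noteq> 0" by blast
  then show thesis by (intro that[of \<zeta>]) (auto simp: orthogonal_comp_def orthogonal_def inner_commute)
qed

text \<open>The orthogonal complement of the kernel is the range of the adjoint. It lets a normal
  vector of the preimage be written as the pullback of a vector in the ambient space of W.\<close>

lemma in_range_adjoint: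
  fixes B :: "'v::euclidean_space \<Rightarrow> 'w::euclidean_space"
  assumes "linear B" "\<And>v. B v = 0 \<Longrightarrow> \<nu> \<bullet> v = 0"
  obtains \<zeta> where "\<And>v. \<nu> \<bullet> v = \<zeta> \<bullet> B v"
proof -
  have "\<nu> \<in> (B -` {0})\<^sup>\<bottom>" using assms(2) by (auto simp: orthogonal_comp_def orthogonal_def inner_commute)
  also have "(B -` {0})\<^sup>\<bottom> = range (adjoint B)"
    unfolding ker_orthogonal_comp_adjoint[OF assms(1)]
    by (intro orthogonal_comp_self linear_subspace_image adjoint_linear assms subspace_UNIV)
  finally obtain \<zeta> where "\<nu> = adjoint B \<zeta>" by blast
  then show thesis using that[of \<zeta>] adjoint_works[OF assms(1)] by (simp add: inner_commute)
qed

lemma hom_deriv_zero_right [simp]: "hom_deriv \<iota> u x 0 = 0"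
  by (rule linear_0[OF linear_hom_deriv])

lemma isCont_eventually:
  assumes "isCont g a" "\<forall>\<^sub>F y in nhds (g a). Q y"
  shows "\<forall>\<^sub>F x in nhds a. Q (g x)"
proof -
  have "filterlim g (nhds (g a)) (nhds a)"
    using assms(1) by (simp add: continuous_at tendsto_at_iff_tendsto_nhds)
  then show ?thesis using assms(2) unfolding filterlim_iff by blast
qed

lemma zero_in_tangent_space: "p \<in> M \<Longrightarrow> 0 \<in> tangent_space M p"
  unfolding tangent_space_def by (intro CollectI exI[of _ "\<lambda>_. p"]) auto

section \<open>The equivalence at a fixed parameter\<close>

locale jet_transversality = homogeneous_parameters \<iota> r
  for \<iota> :: "'c::finite \<Rightarrow> ('n::finite \<Rightarrow> nat) \<times> 'k::finite" and r +
  fixes f\<^sub>0 :: "'a::real_or_complex^'n \<Rightarrow> 'a^'k" and W :: "('a^('n + 'k)) set" and u\<^sub>0 :: "'a^'c"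
  assumes f\<^sub>0: "analytic_near f\<^sub>0 0" "f\<^sub>0 0 = 0"
    and W_smooth: "smooth_submanifold_near W 0" and W_off: "W \<inter> vertical = {}"
begin

abbreviation f where "f \<equiv> perturbed_family f\<^sub>0 \<iota> u\<^sub>0"

abbreviation \<beta>\<^sub>0 where "\<beta>\<^sub>0 \<equiv> family_map (perturbed_family f\<^sub>0 \<iota>)"

lemma hom_part_0 [simp]: "hom_part \<iota> u (0 :: 'a^'n) = 0"
  using norm_hom_part_le[of u "0 :: 'a^'n"] r_pos by (simp add: power_0_left)

lemma f_0: "f 0 = 0" by (simp add: perturbed_family_eq f\<^sub>0)

lemma f_eq: "f = (\<lambda>x. f\<^sub>0 x + hom_part \<iota> u\<^sub>0 x)" by (simp add: perturbed_family_eq fun_eq_iff)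

lemma f_Cr: "Cr_near s f 0"
proof -
  obtain U where U: "open U" "0 \<in> U" "\<And>x. x \<in> U \<Longrightarrow> analytic_near f\<^sub>0 x"
    using analytic_near_open[OF f\<^sub>0(1)] by blast
  have "analytic_near (\<lambda>x. x) (a :: 'a^'n)" "analytic_near (\<lambda>x. u\<^sub>0) (a :: 'a^'n)" for a
    by (simp_all add: analytic_near_iff_sanalytic sanalytic_nth sanalytic_const)
  then have "Ck s U f"
    unfolding f_eq by (intro analytic_imp_Ck U(1) analytic_near_add U(3) analytic_near_hom_part)
  then show ?thesis using U by (auto simp: Cr_near_iff_Ck)
qed

lemma f_has_derivative:
  assumes "(f\<^sub>0 has_derivative f') (at x)"
  shows "(f has_derivative (\<lambda>v. f' v + hom_deriv \<iota> u\<^sub>0 x v)) (at x)"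
  unfolding f_eq by (intro has_derivative_add assms hom_part_has_derivative)

lemma f\<^sub>0_differentiable: "\<forall>\<^sub>F x in nhds 0. \<exists>f'. (f\<^sub>0 has_derivative f') (at x)"
  using analytic_near_eventually[OF f\<^sub>0(1)]
  by eventually_elim (metis analytic_near_has_derivative)

text \<open>\<open>\<beta>\<close> preserves x and W avoids x = 0. The preimage of W therefore
  misses the axis x = 0, which is where \<open>\<beta>\<close> fails to be a submersion.\<close>

lemma fst_vec_nonzero: "\<beta>\<^sub>0 z \<in> W \<Longrightarrow> fst_vec z \<noteq> 0"
  using W_off by (auto simp: \<beta>_eq in_vertical_iff disjoint_iff)

lemma eventually_fst_vec:
  assumes "\<forall>\<^sub>F x in nhds 0. Q x"
  shows "\<forall>\<^sub>F z in nhds (pair_vec 0 y :: 'a^('n + 'l::finite)). Q (fst_vec z)"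
proof -
  have "isCont fst_vec (pair_vec 0 y :: 'a^('n + 'l))"
    by (rule linear_continuous_at[OF bounded_linear_fst_vec])
  then show ?thesis by (rule isCont_eventually) (use assms in simp)
qed

lemma eventually_\<beta>:
  assumes "\<forall>\<^sub>F q in nhds 0. Q q"
  shows "\<forall>\<^sub>F z in nhds (pair_vec 0 u). Q (\<beta>\<^sub>0 z)"
proof -
  have "isCont \<beta>\<^sub>0 (pair_vec 0 u)"
    by (intro analytic_near_continuous analytic_near_\<beta>) (simp add: f\<^sub>0)
  moreover have "\<beta>\<^sub>0 (pair_vec 0 u) = 0" by (simp add: \<beta>_eq f\<^sub>0)
  ultimately show ?thesis using isCont_eventually[where g = \<beta>\<^sub>0 and a = "pair_vec 0 u" and Q = Q] assms by simp
qed

lemma smooth_preimage: "smooth_submanifold_near (\<beta>\<^sub>0 -` W) (pair_vec 0 u)"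
  unfolding smooth_submanifold_near_def
  using eventually_\<beta>[OF W_smooth[unfolded smooth_submanifold_near_def]]
    eventually_fst_vec[OF analytic_near_eventually[OF f\<^sub>0(1)]]
proof eventually_elim
  case (elim p)
  then show ?case using submanifold_at_preimage fst_vec_nonzero by blast
qed

lemma \<beta>_derivative:
  assumes "(f\<^sub>0 has_derivative f') (at x)"
  obtains B where "(\<beta>\<^sub>0 has_derivative B) (at (pair_vec x u))"
    "\<And>v w. B (pair_vec v w) = pair_vec v (f' v + hom_deriv \<iota> u x v + hom_part \<iota> w x)"
  using \<beta>_has_derivative[of f\<^sub>0 f' "pair_vec x u"] assms by simp

text \<open>The components of the pulled-back normal vector are read off by testing with horizontal
  and vertical vectors, in the real inner product and without adjoint matrices.\<close>

lemma conormal_pullback: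
  fixes \<nu> :: "'a^('n + 'c)"
  assumes "linear f'" "\<And>v w. B (pair_vec v w) = pair_vec v (f' v + hom_deriv \<iota> u x v + hom_part \<iota> w x)"
    and \<nu>: "\<And>v. \<nu> \<bullet> v = \<zeta> \<bullet> B v"
  shows "fst_vec \<nu> \<bullet> v = fst_vec \<zeta> \<bullet> v + snd_vec \<zeta> \<bullet> (f' v + hom_deriv \<iota> u x v)"
    and "snd_vec \<nu> \<bullet> w = snd_vec \<zeta> \<bullet> hom_part \<iota> w x"
  using \<nu>[of "pair_vec v 0"] \<nu>[of "pair_vec 0 w"] assms(2)[of v 0] assms(2)[of 0 w] linear_0[OF assms(1)]
  by (simp_all add: inner_split_vec)

text \<open>The equation h(x) d = g(x) - f(x) has right side o(|x|^r) and the right inverse costs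
  |x|^(-r), so d tends to 0. The tolerance \<open>\<eta> / K\<close> absorbs the constant of the
  right inverse.\<close>

lemma competitor_lift:
  assumes "jet_competitor r f g" "\<eta> > 0"
  shows "\<forall>\<^sub>F x in nhds 0. x \<noteq> 0 \<longrightarrow> (\<exists>d. norm d \<le> \<eta> \<and> \<beta>\<^sub>0 (pair_vec x (u\<^sub>0 + d)) = pair_vec x (g x))"
proof -
  obtain K where K: "K > 0" "\<And>(x :: 'a^'n) y. x \<noteq> 0 \<Longrightarrow> \<exists>u. hom_part \<iota> u x = y \<and> norm u * norm x ^ r \<le> K * norm y"
    using hom_part_surj[where 'a = 'a] by blast
  have "\<eta> / K > 0" using K(1) assms(2) by simp
  from jet_competitor_difference[OF f_Cr assms(1) r_pos this] show ?thesis
  proof eventually_elim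
    case (elim x)
    show ?case
    proof
      assume x: "x \<noteq> 0"
      obtain d where d: "hom_part \<iota> d x = g x - f x" "norm d * norm x ^ r \<le> K * norm (g x - f x)"
        using K(2)[OF x] by blast
      have "K * norm (g x - f x) \<le> K * (\<eta> / K * norm x ^ r)"
        using elim K(1) by (intro mult_left_mono) auto
      also have "\<dots> = \<eta> * norm x ^ r" using K(1) by simp
      finally have "norm d * norm x ^ r \<le> \<eta> * norm x ^ r" using d(2) by simp
      then have "norm d \<le> \<eta>" using x by simp
      moreover have "\<beta>\<^sub>0 (pair_vec x (u\<^sub>0 + d)) = pair_vec x (g x)"
        using d(1) by (simp add: \<beta>_eq hom_part_add perturbed_family_eq)
      ultimately show "\<exists>d. norm d \<le> \<eta> \<and> \<beta>\<^sub>0 (pair_vec x (u\<^sub>0 + d)) = pair_vec x (g x)" by blast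
    qed
  qed
qed

lemma competitor_lift_eventually:
  assumes "jet_competitor r f g" "\<eta> > 0" "\<forall>\<^sub>F w in nhds (pair_vec 0 u\<^sub>0). Q w"
  shows "\<forall>\<^sub>F x in nhds 0. x \<noteq> 0 \<longrightarrow>
    (\<exists>d. norm d \<le> \<eta> \<and> \<beta>\<^sub>0 (pair_vec x (u\<^sub>0 + d)) = pair_vec x (g x) \<and> Q (pair_vec x (u\<^sub>0 + d)))"
proof -
  obtain \<delta> where \<delta>: "\<delta> > 0" "\<And>x y. norm (x - 0) < \<delta> \<Longrightarrow> norm (y - u\<^sub>0) < \<delta> \<Longrightarrow> Q (pair_vec x y)"
    using eventually_nhds_pair_vec[OF assms(3)] by blast
  have "min \<eta> (\<delta> / 2) > 0" using \<delta> assms by simp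
  have "\<forall>\<^sub>F x :: 'a^'n in nhds 0. x \<in> ball 0 \<delta>"
    using \<delta>(1) by (intro eventually_nhds_in_open) auto
  with competitor_lift[OF assms(1) \<open>min \<eta> (\<delta> / 2) > 0\<close>] show ?thesis
  proof eventually_elim
    case (elim x)
    show ?case
    proof
      assume "x \<noteq> 0"
      then obtain d where d: "norm d \<le> min \<eta> (\<delta> / 2)" "\<beta>\<^sub>0 (pair_vec x (u\<^sub>0 + d)) = pair_vec x (g x)"
        using elim by blast
      have "Q (pair_vec x (u\<^sub>0 + d))" by (rule \<delta>(2)) (use elim d \<delta>(1) in auto)
      with d show "\<exists>d. norm d \<le> \<eta> \<and> \<beta>\<^sub>0 (pair_vec x (u\<^sub>0 + d)) = pair_vec x (g x) \<and> Q (pair_vec x (u\<^sub>0 + d))"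
        by auto
    qed
  qed
qed

lemma w_regular_imp_transverse:
  assumes w: "w_regular_W (\<beta>\<^sub>0 -` W) (pair_vec 0 u\<^sub>0)"
  shows "tr_W r W f"
  unfolding tr_W_def
proof (intro allI impI)
  fix g assume g: "jet_competitor r f g"
  obtain C where C: "C > 0" "\<forall>\<^sub>F w in nhds (pair_vec 0 u\<^sub>0). w \<in> \<beta>\<^sub>0 -` W \<longrightarrow>
     subspace_dist vertical (tangent_space (\<beta>\<^sub>0 -` W) w) \<le> ereal (C * norm (fst_vec w))"
    using w unfolding w_regular_W_def by blast
  obtain K where K: "K > 0" "\<And>(x :: 'a^'n) y. x \<noteq> 0 \<Longrightarrow> \<exists>u. hom_part \<iota> u x = y \<and> norm u * norm x ^ r \<le> K * norm y"
    using hom_part_surj[where 'a = 'a] by blast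
  define M where "M = real (CARD('c) * r)"
  \<comment> \<open>Two errors appear in the derivative: that of f_u - f, at most M \<eta>
    |x|^(r-1), and that of g - f, at most \<eta> |x|^(r-1). Through (w) and the right inverse they
    are multiplied by C K, and this choice makes the product 1/2.\<close>
  define \<eta> where "\<eta> = 1 / (2 * (C * K * (M + 1)))"
  have M0: "M \<ge> 0" by (simp add: M_def)
  have \<eta>: "\<eta> > 0" "C * K * ((M + 1) * \<eta>) < 1"
  proof -
    have pos: "C * K * (M + 1) > 0" using C(1) K(1) M0 by simp
    then show "\<eta> > 0" by (simp add: \<eta>_def)
    have "C * K * ((M + 1) * \<eta>) = (C * K * (M + 1)) * (1 / (2 * (C * K * (M + 1))))"
      unfolding \<eta>_def by (simp only: mult.assoc)
    also have "\<dots> = 1 / 2" using less_imp_neq[OF pos] by (simp del: mult_eq_0_iff)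
    finally show "C * K * ((M + 1) * \<eta>) < 1" by simp
  qed
  have near: "\<forall>\<^sub>F w in nhds (pair_vec 0 u\<^sub>0).
     (w \<in> \<beta>\<^sub>0 -` W \<longrightarrow> subspace_dist vertical (tangent_space (\<beta>\<^sub>0 -` W) w) \<le> ereal (C * norm (fst_vec w))) \<and>
     (w \<in> \<beta>\<^sub>0 -` W \<longrightarrow> (\<exists>d. submanifold_at d (\<beta>\<^sub>0 -` W) w)) \<and>
     (\<beta>\<^sub>0 w \<in> W \<longrightarrow> (\<exists>d. submanifold_at d W (\<beta>\<^sub>0 w)))"
    using C(2) smooth_preimage[of u\<^sub>0] eventually_\<beta>[OF W_smooth[unfolded smooth_submanifold_near_def]]
    unfolding smooth_submanifold_near_def by (simp only: eventually_conj_iff simp_thms)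
  have "\<forall>\<^sub>F x in nhds 0. x \<noteq> 0 \<longrightarrow> transverse_at (graph_of g) W (pair_vec x (g x))"
    using competitor_lift_eventually[OF g \<eta>(1) near] jet_competitor_difference[OF f_Cr g r_pos \<eta>(1)] f\<^sub>0_differentiable
  proof eventually_elim
    case (elim x)
    show ?case
    proof
      assume x: "x \<noteq> 0"
      obtain d where d: "norm d \<le> \<eta>" "\<beta>\<^sub>0 (pair_vec x (u\<^sub>0 + d)) = pair_vec x (g x)"
        and dw: "pair_vec x (u\<^sub>0 + d) \<in> \<beta>\<^sub>0 -` W \<Longrightarrow>
            subspace_dist vertical (tangent_space (\<beta>\<^sub>0 -` W) (pair_vec x (u\<^sub>0 + d))) \<le> ereal (C * norm (fst_vec (pair_vec x (u\<^sub>0 + d))))"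
          "pair_vec x (u\<^sub>0 + d) \<in> \<beta>\<^sub>0 -` W \<Longrightarrow> \<exists>e. submanifold_at e (\<beta>\<^sub>0 -` W) (pair_vec x (u\<^sub>0 + d))"
          "pair_vec x (g x) \<in> W \<Longrightarrow> \<exists>e. submanifold_at e W (pair_vec x (g x))"
        using elim(1) x by metis
      obtain p' where p': "((\<lambda>x. g x - f x) has_derivative p') (at x)" "\<And>v. norm (p' v) \<le> \<eta> * norm x ^ (r - 1) * norm v"
        using elim(2) by blast
      obtain f' where f': "(f\<^sub>0 has_derivative f') (at x)" using elim(3) by blast
      define g' where "g' v = f' v + hom_deriv \<iota> u\<^sub>0 x v + p' v" for v
      have g': "(g has_derivative g') (at x)"
        using has_derivative_add[OF f_has_derivative[OF f'] p'(1)] by (simp add: g'_def[abs_def])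
      obtain B where B: "(\<beta>\<^sub>0 has_derivative B) (at (pair_vec x (u\<^sub>0 + d)))"
        "\<And>v w. B (pair_vec v w) = pair_vec v (f' v + hom_deriv \<iota> (u\<^sub>0 + d) x v + hom_part \<iota> w x)"
        using \<beta>_derivative[OF f'] by blast
      show "transverse_at (graph_of g) W (pair_vec x (g x))"
        unfolding transverse_at_def
      proof (intro impI, rule ccontr)
        let ?S = "{a + b |a b. a \<in> tangent_space (graph_of g) (pair_vec x (g x)) \<and> b \<in> tangent_space W (pair_vec x (g x))}"
        assume "pair_vec x (g x) \<in> graph_of g \<inter> W" and ne: "?S \<noteq> UNIV"
        then have inW: "pair_vec x (g x) \<in> W" "pair_vec x (u\<^sub>0 + d) \<in> \<beta>\<^sub>0 -` W" using d(2) by auto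
        have TW: "subspace (tangent_space W (pair_vec x (g x)))"
          using dw(3) inW(1) tangent_space_subspace subspace_of_vec_subspace by blast
        have Tg: "tangent_space (graph_of g) (pair_vec x (g x)) = range (\<lambda>v. pair_vec v (g' v))"
          by (rule tangent_space_graph[OF g'])
        have "linear (\<lambda>v. pair_vec v (g' v))"
          using has_derivative_linear[OF has_derivative_pair_vec[OF has_derivative_ident g']] .
        then have "subspace (tangent_space (graph_of g) (pair_vec x (g x)))"
          unfolding Tg by (intro linear_subspace_image subspace_UNIV)
        from orthogonal_to_proper_subspace[OF subspace_sums[OF this TW] ne]
        obtain \<zeta> where \<zeta>: "\<zeta> \<noteq> 0" "\<And>v. v \<in> ?S \<Longrightarrow> \<zeta> \<bullet> v = 0" by blast
        have \<zeta>g: "\<zeta> \<bullet> pair_vec v (g' v) = 0" for v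
        proof (rule \<zeta>(2), intro CollectI exI conjI)
          show "pair_vec v (g' v) = pair_vec v (g' v) + 0" by simp
        qed (use Tg zero_in_tangent_space[OF inW(1)] in auto)
        have \<zeta>W: "\<zeta> \<bullet> \<tau> = 0" if "\<tau> \<in> tangent_space W (pair_vec x (g x))" for \<tau>
        proof (rule \<zeta>(2), intro CollectI exI conjI)
          show "\<tau> = 0 + \<tau>" by simp
          show "0 \<in> tangent_space (graph_of g) (pair_vec x (g x))"
            by (rule zero_in_tangent_space) (auto simp: graph_of_def)
        qed (use that in auto)
        \<comment> \<open>The pullback of a common normal \<open>\<zeta>\<close> of the graph and W
          is normal to the preimage of W, so (w) applies to it.\<close>
        define \<nu> where "\<nu> = adjoint B \<zeta>"
        have \<nu>: "\<nu> \<bullet> v = \<zeta> \<bullet> B v" for v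
          using adjoint_works[OF has_derivative_linear[OF B(1)]] by (simp add: \<nu>_def inner_commute)
        have T: "tangent_space (\<beta>\<^sub>0 -` W) (pair_vec x (u\<^sub>0 + d)) = {v. B v \<in> tangent_space W (pair_vec x (g x))}"
          using tangent_space_preimage[of f\<^sub>0 f' "pair_vec x (u\<^sub>0 + d)" B W] f' x B(1) d(2) by simp
        have "vec.subspace (tangent_space (\<beta>\<^sub>0 -` W) (pair_vec x (u\<^sub>0 + d)))"
          using dw(2)[OF inW(2)] tangent_space_subspace[OF _ inW(2)] by blast
        then have "\<nu> \<in> herm_compl (tangent_space (\<beta>\<^sub>0 -` W) (pair_vec x (u\<^sub>0 + d)))"
          unfolding herm_compl_iff_inner[OF \<open>vec.subspace _\<close>] using \<nu> \<zeta>W T by simp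
        moreover have "C * norm x \<ge> 0" using C(1) by simp
        note subspace_dist_vertical_le_iff[OF this, THEN iffD1, OF dw(1)[OF inW(2), unfolded fst_vec_pair_vec]]
        ultimately have \<nu>le: "norm (snd_vec \<nu>) \<le> C * norm x * norm (fst_vec \<nu>)" by blast
        define \<xi> \<eta>' where "\<xi> = fst_vec \<zeta>" and "\<eta>' = snd_vec \<zeta>"
        \<comment> \<open>As \<open>\<zeta>\<close> annihilates the tangent vectors of the graph of
          g, only the difference between the derivatives of f_u and of g survives.\<close>
        have \<nu>1: "fst_vec \<nu> \<bullet> v = \<eta>' \<bullet> (hom_deriv \<iota> d x v - p' v)" for v
        proof -
          have "fst_vec \<nu> \<bullet> v = \<xi> \<bullet> v + \<eta>' \<bullet> (f' v + hom_deriv \<iota> (u\<^sub>0 + d) x v)"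
            unfolding \<xi>_def \<eta>'_def by (rule conormal_pullback(1)[OF has_derivative_linear[OF f'] B(2) \<nu>])
          moreover have "\<xi> \<bullet> v + \<eta>' \<bullet> g' v = 0"
            using \<zeta>g[of v] by (simp add: inner_split_vec \<xi>_def \<eta>'_def)
          ultimately show ?thesis by (simp add: g'_def hom_deriv_add inner_add_right inner_diff_right)
        qed
        have \<nu>2: "snd_vec \<nu> \<bullet> v = \<eta>' \<bullet> hom_part \<iota> v x" for v
          unfolding \<eta>'_def by (rule conormal_pullback(2)[OF has_derivative_linear[OF f'] B(2) \<nu>])
        \<comment> \<open>Tangent vectors of a graph have arbitrary x-component, so a normal vector
          of it with no y-component would be 0.\<close>
        have "\<eta>' \<noteq> 0"
        proof
          assume "\<eta>' = 0"
          then have "\<xi> \<bullet> \<xi> = 0" using \<zeta>g[of \<xi>] by (simp add: inner_split_vec \<xi>_def \<eta>'_def)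
          then have "\<zeta> = 0" using \<open>\<eta>' = 0\<close> pair_vec_collapse[of \<zeta>] by (simp add: \<xi>_def \<eta>'_def)
          with \<zeta>(1) show False by simp
        qed
        have le1: "norm (fst_vec \<nu>) \<le> norm \<eta>' * ((M + 1) * \<eta> * norm x ^ (r - 1))"
        proof (cases "fst_vec \<nu> = 0")
          case True
          then show ?thesis using M0 \<eta>(1) by simp
        next
          case False
          let ?v = "fst_vec \<nu>"
          have "norm (hom_deriv \<iota> d x ?v - p' ?v) \<le> norm (hom_deriv \<iota> d x ?v) + norm (p' ?v)"
            by (rule norm_triangle_ineq4)
          also have "\<dots> \<le> M * (norm d * norm x ^ (r - 1) * norm ?v) + \<eta> * norm x ^ (r - 1) * norm ?v"
            using norm_hom_deriv_le[of d x ?v] p'(2)[of ?v] by (simp add: M_def)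
          also have "\<dots> \<le> M * (\<eta> * norm x ^ (r - 1) * norm ?v) + \<eta> * norm x ^ (r - 1) * norm ?v"
            using M0 d(1) by (intro add_right_mono mult_left_mono mult_right_mono) auto
          also have "\<dots> = ((M + 1) * \<eta> * norm x ^ (r - 1)) * norm ?v" by (simp add: algebra_simps)
          finally have "norm (hom_deriv \<iota> d x ?v - p' ?v) \<le> ((M + 1) * \<eta> * norm x ^ (r - 1)) * norm ?v" .
          then have "norm \<eta>' * norm (hom_deriv \<iota> d x ?v - p' ?v) \<le> norm \<eta>' * (((M + 1) * \<eta> * norm x ^ (r - 1)) * norm ?v)"
            by (intro mult_left_mono) auto
          moreover have "norm ?v * norm ?v \<le> norm \<eta>' * norm (hom_deriv \<iota> d x ?v - p' ?v)"
            using \<nu>1[of ?v] norm_cauchy_schwarz[of \<eta>' "hom_deriv \<iota> d x ?v - p' ?v"]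
            by (simp add: dot_square_norm power2_eq_square)
          ultimately have "norm ?v * norm ?v \<le> (norm \<eta>' * ((M + 1) * \<eta> * norm x ^ (r - 1))) * norm ?v"
            by (simp only: mult.assoc)
          then show ?thesis using False by simp
        qed
        \<comment> \<open>Testing the parameter component of \<open>\<nu>\<close> with a preimage of
          \<open>\<eta>'\<close> bounds it from below by |\<eta>'| |x|^r / K. Combined with (w) and
          \<open>le1\<close>, a positive number would be at most half of itself.\<close>
        obtain e where e: "hom_part \<iota> e x = \<eta>'" "norm e * norm x ^ r \<le> K * norm \<eta>'" using K(2)[OF x] by blast
        have "norm \<eta>' * norm \<eta>' \<le> norm (snd_vec \<nu>) * norm e"
          using \<nu>2[of e] e(1) norm_cauchy_schwarz[of "snd_vec \<nu>" e] by (simp add: dot_square_norm power2_eq_square)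
        then have "norm \<eta>' * norm \<eta>' * norm x ^ r \<le> norm (snd_vec \<nu>) * norm e * norm x ^ r"
          by (intro mult_right_mono) auto
        also have "\<dots> \<le> norm (snd_vec \<nu>) * (K * norm \<eta>')"
          using mult_left_mono[OF e(2), of "norm (snd_vec \<nu>)"] by (simp add: mult.assoc)
        also have "\<dots> \<le> (C * norm x * norm (fst_vec \<nu>)) * (K * norm \<eta>')"
          using \<nu>le K(1) by (intro mult_right_mono) auto
        also have "\<dots> \<le> (C * norm x * (norm \<eta>' * ((M + 1) * \<eta> * norm x ^ (r - 1)))) * (K * norm \<eta>')"
          using le1 C(1) K(1) by (intro mult_right_mono mult_left_mono) auto
        also have "\<dots> = (C * K * ((M + 1) * \<eta>)) * (norm \<eta>' * norm \<eta>' * (norm x * norm x ^ (r - 1)))"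
          by (simp only: mult_ac)
        also have "norm x * norm x ^ (r - 1) = norm x ^ r"
          using r_pos by (metis Suc_pred' power_Suc)
        finally have "1 * (norm \<eta>' * norm \<eta>' * norm x ^ r) \<le> (C * K * ((M + 1) * \<eta>)) * (norm \<eta>' * norm \<eta>' * norm x ^ r)"
          by simp
        moreover have "norm \<eta>' * norm \<eta>' * norm x ^ r > 0" using \<open>\<eta>' \<noteq> 0\<close> x by simp
        ultimately show False using \<eta>(2) by (simp only: mult_le_cancel_right) auto
      qed
    qed
  qed
  then have "\<forall>\<^sub>F q in nhds (0 :: 'a^('n + 'k)). fst_vec q \<noteq> 0 \<longrightarrow> transverse_at (graph_of g) W (pair_vec (fst_vec q) (g (fst_vec q)))"
    using eventually_fst_vec[where y = "0 :: 'a^'k"] by simp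
  then have "\<forall>\<^sub>F q in nhds 0. transverse_at (graph_of g) W q"
  proof eventually_elim
    case (elim q)
    show ?case
    proof (cases "q \<in> graph_of g \<inter> W")
      case True
      then have "q = pair_vec (fst_vec q) (g (fst_vec q))" "fst_vec q \<noteq> 0"
        using W_off by (auto simp: graph_of_def in_vertical_iff)
      then show ?thesis using elim by simp
    qed (auto simp: transverse_at_def)
  qed
  then show "\<forall>\<^sub>F q in at 0. transverse_at (graph_of g) W q"
    by (rule filter_leD[OF at_within_le_nhds])
qed

lemma competitor_graph_eventually:
  assumes "isCont g (0 :: 'a^'n)" "g 0 = (0 :: 'a^'k)" "\<forall>\<^sub>F q in nhds 0. Q q"
  obtains \<delta> where "\<delta> > 0" "\<And>x. norm x < \<delta> \<Longrightarrow> Q (pair_vec x (g x))"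
proof -
  obtain \<epsilon> where \<epsilon>: "\<epsilon> > 0" "\<And>x y. norm (x - 0) < \<epsilon> \<Longrightarrow> norm (y - 0) < \<epsilon> \<Longrightarrow> Q (pair_vec x y)"
    using eventually_nhds_pair_vec[where x\<^sub>0 = 0 and y\<^sub>0 = 0 and Q = Q] assms(3) by auto
  obtain d where d: "d > 0" "\<And>x. norm x < d \<Longrightarrow> norm (g x) < \<epsilon>"
    using assms(1,2) \<epsilon>(1) unfolding continuous_at_eps_delta by (auto simp: dist_norm)
  show thesis by (rule that[of "min d \<epsilon>"]) (use d \<epsilon> in auto)
qed

lemma transverse_imp_w_regular:
  assumes t: "tr_W r W f"
  shows "w_regular_W (\<beta>\<^sub>0 -` W) (pair_vec 0 u\<^sub>0)"
proof (rule ccontr)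
  assume "\<not> w_regular_W (\<beta>\<^sub>0 -` W) (pair_vec 0 u\<^sub>0)"
  then have nw: "\<not> (\<forall>\<^sub>F w in nhds (pair_vec 0 u\<^sub>0). w \<in> \<beta>\<^sub>0 -` W \<longrightarrow>
     subspace_dist vertical (tangent_space (\<beta>\<^sub>0 -` W) w) \<le> ereal (C * norm (fst_vec w)))" if "C > 0" for C
    using that smooth_preimage unfolding w_regular_W_def by blast
  \<comment> \<open>After correction by value b and derivative A, the graph meets W over x and has
    there a nonzero normal vector in common with W.\<close>
  define P where "P x b A \<longleftrightarrow> pair_vec x (f x + b) \<in> W \<and>
     (\<exists>\<zeta>. \<zeta> \<noteq> 0 \<and> (\<forall>\<tau>\<in>tangent_space W (pair_vec x (f x + b)). \<zeta> \<bullet> \<tau> = 0) \<and>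
       (\<forall>v. \<zeta> \<bullet> pair_vec v (frechet_derivative f (at x) v + A v) = 0))" for x b A
  define H where "H = real CARD('c)"
  define M where "M = real (CARD('c) * r)"
  have HM: "H > 0" "M > 0" using r_pos by (auto simp: H_def M_def)
  obtain K where K: "K > 0" "\<And>(x :: 'a^'n) y. x \<noteq> 0 \<Longrightarrow> \<exists>u. hom_part \<iota> u x = y \<and> norm u * norm x ^ r \<le> K * norm y"
    using hom_part_surj[where 'a = 'a] by blast
  have ex: "\<exists>x b A. x \<noteq> 0 \<and> norm x < \<epsilon> \<and> norm b \<le> \<epsilon> * norm x ^ r \<and> linear A \<and>
      (\<forall>v. norm (A v) \<le> \<epsilon> * norm x ^ (r - 1) * norm v) \<and> P x b A" if "\<epsilon> > 0" for \<epsilon>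
  proof -
    \<comment> \<open>With this constant, failure of (w) bounds the x-component of
      \<open>\<nu>\<close> by H |x|^(r-1) |\<eta>| / C, which is half the allowance \<epsilon>
      |x|^(r-1) |\<eta>|.\<close>
    define C where "C = 2 * H / \<epsilon>"
    have "C > 0" using HM that by (simp add: C_def)
    \<comment> \<open>The distance of u from \<open>u\<^sub>0\<close> enters the value b with factor
      H, where all of \<open>\<epsilon>\<close> is available, and the derivative with factor M,
      where the rank-one term takes the other half.\<close>
    define \<rho> where "\<rho> = min \<epsilon> (min (\<epsilon> / H) (\<epsilon> / (2 * M)))"
    have \<rho>: "\<rho> > 0" "\<rho> \<le> \<epsilon>" "H * \<rho> \<le> \<epsilon>" "M * \<rho> \<le> \<epsilon> / 2"
    proof -
      have "\<rho> \<le> \<epsilon> / H" "\<rho> \<le> \<epsilon> / (2 * M)" by (simp_all add: \<rho>_def)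
      then show "H * \<rho> \<le> \<epsilon>" "M * \<rho> \<le> \<epsilon> / 2" using HM by (simp_all add: field_simps)
    qed (use that HM in \<open>simp_all add: \<rho>_def\<close>)
    have "\<not> (\<forall>\<^sub>F w in nhds (pair_vec 0 u\<^sub>0). \<not> (w \<in> \<beta>\<^sub>0 -` W \<and>
      \<not> subspace_dist vertical (tangent_space (\<beta>\<^sub>0 -` W) w) \<le> ereal (C * norm (fst_vec w)) \<and>
      (\<exists>f'. (f\<^sub>0 has_derivative f') (at (fst_vec w)))))"
    proof
      assume "\<forall>\<^sub>F w in nhds (pair_vec 0 u\<^sub>0). \<not> (w \<in> \<beta>\<^sub>0 -` W \<and>
        \<not> subspace_dist vertical (tangent_space (\<beta>\<^sub>0 -` W) w) \<le> ereal (C * norm (fst_vec w)) \<and>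
        (\<exists>f'. (f\<^sub>0 has_derivative f') (at (fst_vec w))))"
      with eventually_fst_vec[OF f\<^sub>0_differentiable, of u\<^sub>0]
      have "\<forall>\<^sub>F w in nhds (pair_vec 0 u\<^sub>0). w \<in> \<beta>\<^sub>0 -` W \<longrightarrow>
        subspace_dist vertical (tangent_space (\<beta>\<^sub>0 -` W) w) \<le> ereal (C * norm (fst_vec w))"
        by eventually_elim blast
      with nw[OF \<open>C > 0\<close>] show False by blast
    qed
    then obtain x u where "norm (x - 0) < \<rho>" "norm (u - u\<^sub>0) < \<rho>"
      "pair_vec x u \<in> \<beta>\<^sub>0 -` W \<and>
      \<not> subspace_dist vertical (tangent_space (\<beta>\<^sub>0 -` W) (pair_vec x u)) \<le> ereal (C * norm (fst_vec (pair_vec x u))) \<and>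
      (\<exists>f'. (f\<^sub>0 has_derivative f') (at (fst_vec (pair_vec x u))))"
      by (rule frequently_nhds_pair_vec[OF _ \<rho>(1)])
    then have xu: "norm x < \<rho>" "norm (u - u\<^sub>0) < \<rho>"
      "\<beta>\<^sub>0 (pair_vec x u) \<in> W"
      "\<not> subspace_dist vertical (tangent_space (\<beta>\<^sub>0 -` W) (pair_vec x u)) \<le> ereal (C * norm x)"
      "\<exists>f'. (f\<^sub>0 has_derivative f') (at x)" by simp_all
    obtain f' where f': "(f\<^sub>0 has_derivative f') (at x)" using xu(5) by blast
    have x: "x \<noteq> 0" using fst_vec_nonzero[OF xu(3)] by simp
    define d where "d = u - u\<^sub>0"
    define b where "b = hom_part \<iota> d x"
    have \<beta>w: "\<beta>\<^sub>0 (pair_vec x u) = pair_vec x (f x + b)"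
      by (simp add: \<beta>_eq perturbed_family_eq b_def d_def hom_part_diff)
    have "C * norm x \<ge> 0" using \<open>C > 0\<close> by simp
    from subspace_dist_vertical_le_iff[OF this] xu(4)
    obtain \<nu> where \<nu>: "\<nu> \<in> herm_compl (tangent_space (\<beta>\<^sub>0 -` W) (pair_vec x u))"
      "C * norm x * norm (fst_vec \<nu>) < norm (snd_vec \<nu>)" by (metis not_le)
    obtain B where B: "(\<beta>\<^sub>0 has_derivative B) (at (pair_vec x u))"
      "\<And>v w. B (pair_vec v w) = pair_vec v (f' v + hom_deriv \<iota> u x v + hom_part \<iota> w x)"
      using \<beta>_derivative[OF f'] by blast
    have T: "tangent_space (\<beta>\<^sub>0 -` W) (pair_vec x u) = {v. B v \<in> tangent_space W (pair_vec x (f x + b))}"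
      using tangent_space_preimage[of f\<^sub>0 f' "pair_vec x u" B W] f' x B(1) \<beta>w by simp
    have \<nu>T: "\<nu> \<bullet> v = 0" if "B v \<in> tangent_space W (pair_vec x (f x + b))" for v
      using \<nu>(1) that inner_zero_if_herm_zero unfolding T herm_compl_def by blast
    have 0: "0 \<in> tangent_space W (pair_vec x (f x + b))"
      using xu(3) \<beta>w by (intro zero_in_tangent_space) simp
    \<comment> \<open>The vector 0 is tangent to W, so the kernel of B lies in the tangent space of
      the preimage and \<open>\<nu>\<close> is orthogonal to it.\<close>
    obtain \<zeta> where \<zeta>: "\<And>v. \<nu> \<bullet> v = \<zeta> \<bullet> B v"
      using in_range_adjoint[OF has_derivative_linear[OF B(1)], of \<nu>] \<nu>T 0 by metis
    \<comment> \<open>B is onto for x nonzero: the parameter component can be adjusted to reach any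
      \<open>\<tau>\<close>, and a preimage of a tangent vector of W is tangent to the preimage of
      W.\<close>
    have \<zeta>W: "\<zeta> \<bullet> \<tau> = 0" if "\<tau> \<in> tangent_space W (pair_vec x (f x + b))" for \<tau>
    proof -
      obtain e where "hom_part \<iota> e x = snd_vec \<tau> - f' (fst_vec \<tau>) - hom_deriv \<iota> u x (fst_vec \<tau>)"
        using K(2)[OF x] by blast
      then have "B (pair_vec (fst_vec \<tau>) e) = \<tau>" by (simp add: B(2))
      then show ?thesis using \<zeta>[of "pair_vec (fst_vec \<tau>) e"] \<nu>T[of "pair_vec (fst_vec \<tau>) e"] that by simp
    qed
    define \<xi> \<eta> where "\<xi> = fst_vec \<zeta>" and "\<eta> = snd_vec \<zeta>"
    have \<nu>1: "fst_vec \<nu> \<bullet> v = \<xi> \<bullet> v + \<eta> \<bullet> (f' v + hom_deriv \<iota> u x v)" for v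
      unfolding \<xi>_def \<eta>_def by (rule conormal_pullback(1)[OF has_derivative_linear[OF f'] B(2) \<zeta>])
    have \<nu>2: "snd_vec \<nu> \<bullet> v = \<eta> \<bullet> hom_part \<iota> v x" for v
      unfolding \<eta>_def by (rule conormal_pullback(2)[OF has_derivative_linear[OF f'] B(2) \<zeta>])
    have \<nu>2pos: "norm (snd_vec \<nu>) > 0"
      using \<nu>(2) \<open>C * norm x \<ge> 0\<close> by (meson mult_nonneg_nonneg norm_ge_zero order_le_less_trans)
    have \<nu>2le: "norm (snd_vec \<nu>) \<le> norm \<eta> * (H * norm x ^ r)"
    proof -
      let ?v = "snd_vec \<nu>"
      have "norm ?v * norm ?v \<le> norm \<eta> * norm (hom_part \<iota> ?v x)"
        using \<nu>2[of ?v] norm_cauchy_schwarz[of \<eta> "hom_part \<iota> ?v x"] by (simp add: dot_square_norm power2_eq_square)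
      also have "\<dots> \<le> norm \<eta> * (H * (norm ?v * norm x ^ r))"
        unfolding H_def by (intro mult_left_mono norm_hom_part_le) auto
      finally have "norm ?v * norm ?v \<le> (norm \<eta> * (H * norm x ^ r)) * norm ?v" by (simp only: mult_ac)
      then show ?thesis using \<nu>2pos by simp
    qed
    have \<eta>0: "norm \<eta> > 0" using \<nu>2pos \<nu>2le by auto
    have \<nu>1le: "norm (fst_vec \<nu>) \<le> (\<epsilon> / 2) * norm x ^ (r - 1) * norm \<eta>"
    proof -
      have "norm x ^ r = norm x * norm x ^ (r - 1)" using r_pos by (metis Suc_pred' power_Suc)
      then have "C * norm x * norm (fst_vec \<nu>) < norm \<eta> * (H * (norm x * norm x ^ (r - 1)))"
        using \<nu>(2) \<nu>2le by simp
      then have "norm x * (C * norm (fst_vec \<nu>)) < norm x * (norm \<eta> * (H * norm x ^ (r - 1)))"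
        by (simp only: mult_ac)
      then have "C * norm (fst_vec \<nu>) < norm \<eta> * (H * norm x ^ (r - 1))" using x by simp
      then have "norm (fst_vec \<nu>) < norm \<eta> * (H * norm x ^ (r - 1)) / C"
        using \<open>C > 0\<close> by (simp add: pos_less_divide_eq mult.commute)
      also have "\<dots> = (\<epsilon> / 2) * norm x ^ (r - 1) * norm \<eta>" using HM by (simp add: C_def)
      finally show ?thesis by simp
    qed
    \<comment> \<open>The first term turns the derivative of f into that of f_u. The second is the
      smallest change along \<open>\<eta>\<close> whose inner product with \<open>\<eta>\<close>
      cancels the x-component of \<open>\<nu>\<close>.\<close>
    define A where "A v = hom_deriv \<iota> d x v - ((fst_vec \<nu> \<bullet> v) / (\<eta> \<bullet> \<eta>)) *\<^sub>R \<eta>" for v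
    have linA: "linear A"
      unfolding A_def[abs_def]
      by (intro linear_compose_sub linear_hom_deriv linearI)
        (simp_all add: inner_add_right add_divide_distrib scaleR_add_left)
    have "norm (A v) \<le> \<epsilon> * norm x ^ (r - 1) * norm v" for v
    proof -
      have "norm (A v) \<le> norm (hom_deriv \<iota> d x v) + norm (((fst_vec \<nu> \<bullet> v) / (\<eta> \<bullet> \<eta>)) *\<^sub>R \<eta>)"
        unfolding A_def by (rule norm_triangle_ineq4)
      also have "norm (hom_deriv \<iota> d x v) \<le> M * (norm d * norm x ^ (r - 1) * norm v)"
        using norm_hom_deriv_le[of d x v] by (simp add: M_def)
      also have "\<dots> = (M * norm d) * (norm x ^ (r - 1) * norm v)" by simp
      also have "\<dots> \<le> (\<epsilon> / 2) * (norm x ^ (r - 1) * norm v)"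
      proof (rule mult_right_mono)
        have "M * norm d \<le> M * \<rho>" using xu(2) HM by (simp add: d_def)
        then show "M * norm d \<le> \<epsilon> / 2" using \<rho>(4) by simp
      qed simp
      also have "norm (((fst_vec \<nu> \<bullet> v) / (\<eta> \<bullet> \<eta>)) *\<^sub>R \<eta>) = \<bar>fst_vec \<nu> \<bullet> v\<bar> / norm \<eta>"
        using \<eta>0 by (simp add: dot_square_norm power2_eq_square)
      also have "\<dots> \<le> norm (fst_vec \<nu>) * norm v / norm \<eta>"
        by (intro divide_right_mono Cauchy_Schwarz_ineq2) auto
      also have "\<dots> \<le> ((\<epsilon> / 2) * norm x ^ (r - 1) * norm \<eta>) * norm v / norm \<eta>"
        by (intro divide_right_mono mult_right_mono \<nu>1le) auto
      also have "\<dots> = (\<epsilon> / 2) * (norm x ^ (r - 1) * norm v)" using \<eta>0 by simp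
      finally show ?thesis by (simp add: algebra_simps)
    qed
    moreover have "norm b \<le> \<epsilon> * norm x ^ r"
    proof -
      have "norm b \<le> (H * norm d) * norm x ^ r" using norm_hom_part_le[of d x] by (simp add: b_def H_def mult.assoc)
      also have "\<dots> \<le> \<epsilon> * norm x ^ r"
      proof (rule mult_right_mono)
        have "H * norm d \<le> H * \<rho>" using xu(2) HM by (simp add: d_def)
        then show "H * norm d \<le> \<epsilon>" using \<rho>(3) by simp
      qed simp
      finally show ?thesis .
    qed
    moreover have "P x b A"
      unfolding P_def
    proof (intro conjI exI[of _ \<zeta>] ballI allI)
      show "pair_vec x (f x + b) \<in> W" using xu(3) \<beta>w by simp
      show "\<zeta> \<noteq> 0" using \<eta>0 by (auto simp: \<eta>_def)
      show "\<zeta> \<bullet> \<tau> = 0" if "\<tau> \<in> tangent_space W (pair_vec x (f x + b))" for \<tau> by (rule \<zeta>W[OF that])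
      fix v
      have "frechet_derivative f (at x) = (\<lambda>v. f' v + hom_deriv \<iota> u\<^sub>0 x v)"
        using frechet_derivative_at[OF f_has_derivative[OF f']] by simp
      moreover have "\<eta> \<bullet> A v = \<eta> \<bullet> hom_deriv \<iota> d x v - fst_vec \<nu> \<bullet> v"
        using \<eta>0 by (simp add: A_def inner_diff_right)
      moreover have "hom_deriv \<iota> d x v = hom_deriv \<iota> u x v - hom_deriv \<iota> u\<^sub>0 x v"
        by (simp add: d_def hom_deriv_diff)
      ultimately show "\<zeta> \<bullet> pair_vec v (frechet_derivative f (at x) v + A v) = 0"
        using \<nu>1[of v] by (simp add: inner_split_vec \<xi>_def[symmetric] \<eta>_def[symmetric] inner_add_right inner_diff_right)
    qed
    moreover have "norm x < \<epsilon>" using xu(1) \<rho>(2) by simp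
    ultimately show ?thesis using x linA by blast
  qed
  obtain g where g: "jet_competitor r f g" "isCont g 0"
    "\<And>\<epsilon>. \<epsilon> > 0 \<Longrightarrow> \<exists>x A. x \<noteq> 0 \<and> norm x < \<epsilon> \<and> ((\<lambda>x. g x - f x) has_derivative A) (at x) \<and> P x (g x - f x) A"
    using jet_competitor_interpolation[OF f_Cr f_0 r_pos ex] by blast
  have g0: "g 0 = 0" using g(1) by (simp add: jet_competitor_def)
  have "\<forall>\<^sub>F q in at 0. transverse_at (graph_of g) W q" using t g(1) unfolding tr_W_def by blast
  then have "\<forall>\<^sub>F q in nhds 0. q \<noteq> 0 \<longrightarrow> transverse_at (graph_of g) W q"
    by (simp add: eventually_at_filter)
  with competitor_graph_eventually[OF g(2) g0]
  obtain \<delta> where \<delta>: "\<delta> > 0" "\<And>x. norm x < \<delta> \<Longrightarrow> pair_vec x (g x) \<noteq> 0 \<longrightarrow> transverse_at (graph_of g) W (pair_vec x (g x))"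
    by blast
  obtain \<delta>' where \<delta>': "\<delta>' > 0" "\<And>x. norm x < \<delta>' \<Longrightarrow> \<exists>f'. (f\<^sub>0 has_derivative f') (at x)"
    using f\<^sub>0_differentiable unfolding eventually_nhds_metric by (auto simp: dist_norm)
  obtain x A where x: "x \<noteq> 0" "norm x < min \<delta> \<delta>'" "((\<lambda>x. g x - f x) has_derivative A) (at x)" "P x (g x - f x) A"
    using g(3)[of "min \<delta> \<delta>'"] \<delta>(1) \<delta>'(1) by auto
  obtain f' where "(f\<^sub>0 has_derivative f') (at x)" using \<delta>'(2)[of x] x(2) by auto
  from f_has_derivative[OF this] have f': "(f has_derivative frechet_derivative f (at x)) (at x)"
    using frechet_derivative_works differentiable_def by blast
  have gd: "(g has_derivative (\<lambda>v. frechet_derivative f (at x) v + A v)) (at x)"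
    using has_derivative_add[OF f' x(3)] by simp
  obtain \<zeta> where \<zeta>: "\<zeta> \<noteq> 0" "\<And>\<tau>. \<tau> \<in> tangent_space W (pair_vec x (g x)) \<Longrightarrow> \<zeta> \<bullet> \<tau> = 0"
    "\<And>v. \<zeta> \<bullet> pair_vec v (frechet_derivative f (at x) v + A v) = 0" and inW: "pair_vec x (g x) \<in> W"
    using x(4) unfolding P_def by auto
  have "pair_vec x (g x) \<noteq> 0" using x(1) by (metis fst_vec_pair_vec fst_vec_zero)
  then have "transverse_at (graph_of g) W (pair_vec x (g x))" using \<delta>(2)[of x] x(2) by simp
  moreover have "pair_vec x (g x) \<in> graph_of g" by (auto simp: graph_of_def)
  \<comment> \<open>Transversality writes \<open>\<zeta>\<close> itself as a sum of two vectors to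
    which it is orthogonal.\<close>
  ultimately have "\<zeta> \<in> {a + b |a b. a \<in> tangent_space (graph_of g) (pair_vec x (g x)) \<and> b \<in> tangent_space W (pair_vec x (g x))}"
    using inW unfolding transverse_at_def by simp
  then obtain a b where "\<zeta> = a + b" "a \<in> range (\<lambda>v. pair_vec v (frechet_derivative f (at x) v + A v))"
    "b \<in> tangent_space W (pair_vec x (g x))"
    unfolding tangent_space_graph[OF gd] by blast
  then have "\<zeta> \<bullet> \<zeta> = 0" using \<zeta>(2,3) by (auto simp: inner_add_right)
  with \<zeta>(1) show False by simp
qed

text \<open>Lifting a competitor moves its points in S to points of the preimage off the axis and
  close to (0, \<open>u\<^sub>0\<close>). Conversely such points are interpolated by a competitor;
  only values matter, so the derivative correction is A = 0.\<close>

lemma vertical_preimage_iff_graph: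
  assumes "0 \<in> S"
  shows "(\<forall>\<^sub>F z in nhds (pair_vec 0 u\<^sub>0). z \<in> \<beta>\<^sub>0 -` S \<longrightarrow> z \<in> vertical) \<longleftrightarrow>
    (\<forall>g. jet_competitor r f g \<longrightarrow> (\<forall>\<^sub>F q in nhds 0. q \<in> graph_of g \<inter> S \<longleftrightarrow> q = 0))"
proof (intro iffI allI impI)
  fix g assume v: "\<forall>\<^sub>F z in nhds (pair_vec 0 u\<^sub>0). z \<in> \<beta>\<^sub>0 -` S \<longrightarrow> z \<in> vertical" and g: "jet_competitor r f g"
  have g0: "g 0 = 0" using g by (simp add: jet_competitor_def)
  have "\<forall>\<^sub>F x in nhds 0. x \<noteq> 0 \<longrightarrow> pair_vec x (g x) \<notin> S"
    using competitor_lift_eventually[OF g zero_less_one v]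
    by eventually_elim (auto simp: in_vertical_iff)
  from eventually_fst_vec[OF this, where y = "0 :: 'a^'k"]
  have "\<forall>\<^sub>F q in nhds (0 :: 'a^('n + 'k)). fst_vec q \<noteq> 0 \<longrightarrow> pair_vec (fst_vec q) (g (fst_vec q)) \<notin> S" by simp
  then show "\<forall>\<^sub>F q in nhds 0. q \<in> graph_of g \<inter> S \<longleftrightarrow> q = 0"
  proof eventually_elim
    case (elim q)
    have "0 \<in> graph_of g" unfolding graph_of_def using g0 by (intro CollectI exI[of _ 0]) simp
    moreover have "q = 0" if "q \<in> graph_of g \<inter> S"
      using that elim g0 by (auto simp: graph_of_def)
    ultimately show ?case using assms by blast
  qed
next
  assume t: "\<forall>g. jet_competitor r f g \<longrightarrow> (\<forall>\<^sub>F q in nhds 0. q \<in> graph_of g \<inter> S \<longleftrightarrow> q = 0)"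
  show "\<forall>\<^sub>F z in nhds (pair_vec 0 u\<^sub>0). z \<in> \<beta>\<^sub>0 -` S \<longrightarrow> z \<in> vertical"
  proof (rule ccontr)
    assume n: "\<not> ?thesis"
    define P where "P x b A \<longleftrightarrow> pair_vec x (f x + b) \<in> S" for x b and A :: "'a^'n \<Rightarrow> 'a^'k"
    have ex: "\<exists>x b A. x \<noteq> 0 \<and> norm x < \<epsilon> \<and> norm b \<le> \<epsilon> * norm x ^ r \<and> linear A \<and>
      (\<forall>v. norm (A v) \<le> \<epsilon> * norm x ^ (r - 1) * norm v) \<and> P x b A" if "\<epsilon> > 0" for \<epsilon>
    proof -
      define \<rho> where "\<rho> = min \<epsilon> (\<epsilon> / CARD('c))"
      have "\<rho> > 0" using that by (simp add: \<rho>_def)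
      have "\<not> (\<forall>\<^sub>F z in nhds (pair_vec 0 u\<^sub>0). \<not> (z \<in> \<beta>\<^sub>0 -` S \<and> z \<notin> vertical))"
        using n by simp
      then obtain x u where "norm (x - 0) < \<rho>" "norm (u - u\<^sub>0) < \<rho>"
        "pair_vec x u \<in> \<beta>\<^sub>0 -` S \<and> pair_vec x u \<notin> vertical"
        by (rule frequently_nhds_pair_vec[OF _ \<open>\<rho> > 0\<close>])
      then have xu: "norm x < \<rho>" "norm (u - u\<^sub>0) < \<rho>" "\<beta>\<^sub>0 (pair_vec x u) \<in> S" "x \<noteq> 0"
        by (simp_all add: in_vertical_iff)
      define b where "b = hom_part \<iota> (u - u\<^sub>0) x"
      have "\<beta>\<^sub>0 (pair_vec x u) = pair_vec x (f x + b)"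
        by (simp add: \<beta>_eq perturbed_family_eq b_def hom_part_diff)
      then have "P x b (\<lambda>v. 0)" using xu(3) by (simp add: P_def)
      moreover have "norm b \<le> \<epsilon> * norm x ^ r"
      proof -
        have "norm b \<le> (CARD('c) * norm (u - u\<^sub>0)) * norm x ^ r"
          using norm_hom_part_le[of "u - u\<^sub>0" x] by (simp add: b_def mult.assoc)
        also have "\<dots> \<le> \<epsilon> * norm x ^ r"
        proof (rule mult_right_mono)
          have "norm (u - u\<^sub>0) \<le> \<epsilon> / CARD('c)" using xu(2) by (simp add: \<rho>_def)
          then show "CARD('c) * norm (u - u\<^sub>0) \<le> \<epsilon>" by (simp add: pos_le_divide_eq mult.commute)
        qed simp
        finally show ?thesis .
      qed
      moreover have "linear (\<lambda>v :: 'a^'n. 0 :: 'a^'k)" by (rule linear_zero)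
      ultimately show ?thesis using xu(1,4) that
        by (intro exI[of _ x] exI[of _ b] exI[of _ "\<lambda>v. 0"]) (auto simp: \<rho>_def)
    qed
    obtain g where g: "jet_competitor r f g" "isCont g 0"
      "\<And>\<epsilon>. \<epsilon> > 0 \<Longrightarrow> \<exists>x A. x \<noteq> 0 \<and> norm x < \<epsilon> \<and> ((\<lambda>x. g x - f x) has_derivative A) (at x) \<and> P x (g x - f x) A"
      using jet_competitor_interpolation[OF f_Cr f_0 r_pos ex] by blast
    have g0: "g 0 = 0" using g(1) by (simp add: jet_competitor_def)
    have "\<forall>\<^sub>F q in nhds 0. q \<in> graph_of g \<inter> S \<longleftrightarrow> q = 0" using t g(1) by blast
    with competitor_graph_eventually[OF g(2) g0]
    obtain \<delta> where \<delta>: "\<delta> > 0" "\<And>x. norm x < \<delta> \<Longrightarrow> pair_vec x (g x) \<in> graph_of g \<inter> S \<longleftrightarrow> pair_vec x (g x) = 0"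
      by blast
    obtain x A where x: "x \<noteq> 0" "norm x < \<delta>" "P x (g x - f x) A" using g(3)[OF \<delta>(1)] by blast
    have "pair_vec x (g x) \<in> graph_of g \<inter> S" using x(3) by (auto simp: P_def graph_of_def)
    then have "pair_vec x (g x) = 0" using \<delta>(2)[OF x(2)] by blast
    then show False using x(1) by (metis fst_vec_pair_vec fst_vec_zero)
  qed
qed

text \<open>An inequality valid near (0, \<open>u\<^sub>0\<close>) is valid near each nearby point
  with the same C. Condition (w) at this one point therefore spreads along the axis.\<close>

lemma verdier_equisingular_W_iff:
  "verdier_equisingular_W W (perturbed_family f\<^sub>0 \<iota>) u\<^sub>0 \<longleftrightarrow> w_regular_W (\<beta>\<^sub>0 -` W) (pair_vec 0 u\<^sub>0)"
proof
  assume "verdier_equisingular_W W (perturbed_family f\<^sub>0 \<iota>) u\<^sub>0"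
  from eventually_nhds_x_imp_x[OF this[unfolded verdier_equisingular_W_def]]
  show "w_regular_W (\<beta>\<^sub>0 -` W) (pair_vec 0 u\<^sub>0)" by (simp add: in_vertical_iff)
next
  assume w: "w_regular_W (\<beta>\<^sub>0 -` W) (pair_vec 0 u\<^sub>0)"
  then obtain C where C: "C > 0" "\<forall>\<^sub>F w in nhds (pair_vec 0 u\<^sub>0). w \<in> \<beta>\<^sub>0 -` W \<longrightarrow>
     subspace_dist vertical (tangent_space (\<beta>\<^sub>0 -` W) w) \<le> ereal (C * norm (fst_vec w))"
    unfolding w_regular_W_def by blast
  have "\<forall>\<^sub>F a in nhds (pair_vec 0 u\<^sub>0). w_regular_W (\<beta>\<^sub>0 -` W) a"
    using iffD2[OF eventually_eventually C(2)]
      iffD2[OF eventually_eventually smooth_preimage[of u\<^sub>0, unfolded smooth_submanifold_near_def]]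
  proof eventually_elim
    case (elim a)
    then show ?case unfolding w_regular_W_def smooth_submanifold_near_def using C(1) by blast
  qed
  then show "verdier_equisingular_W W (perturbed_family f\<^sub>0 \<iota>) u\<^sub>0"
    unfolding verdier_equisingular_W_def by eventually_elim simp
qed

lemma verdier_equisingular_X_iff:
  "verdier_equisingular_X X W (perturbed_family f\<^sub>0 \<iota>) u\<^sub>0 \<longleftrightarrow>
    verdier_equisingular_W W (perturbed_family f\<^sub>0 \<iota>) u\<^sub>0 \<and>
    (\<forall>\<^sub>F z in nhds (pair_vec 0 u\<^sub>0). z \<in> \<beta>\<^sub>0 -` (X - W) \<longrightarrow> z \<in> vertical)"
proof
  assume *: "verdier_equisingular_X X W (perturbed_family f\<^sub>0 \<iota>) u\<^sub>0"
  from eventually_nhds_x_imp_x[OF this[unfolded verdier_equisingular_X_def]] *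
  show "verdier_equisingular_W W (perturbed_family f\<^sub>0 \<iota>) u\<^sub>0 \<and>
    (\<forall>\<^sub>F z in nhds (pair_vec 0 u\<^sub>0). z \<in> \<beta>\<^sub>0 -` (X - W) \<longrightarrow> z \<in> vertical)"
    unfolding verdier_equisingular_W_iff by (simp add: in_vertical_iff w_regular_X_def)
next
  assume *: "verdier_equisingular_W W (perturbed_family f\<^sub>0 \<iota>) u\<^sub>0 \<and>
    (\<forall>\<^sub>F z in nhds (pair_vec 0 u\<^sub>0). z \<in> \<beta>\<^sub>0 -` (X - W) \<longrightarrow> z \<in> vertical)"
  then have "\<forall>\<^sub>F a in nhds (pair_vec 0 u\<^sub>0). a \<in> vertical \<longrightarrow> w_regular_W (\<beta>\<^sub>0 -` W) a"
    "\<forall>\<^sub>F a in nhds (pair_vec 0 u\<^sub>0). \<forall>\<^sub>F z in nhds a. z \<in> \<beta>\<^sub>0 -` (X - W) \<longrightarrow> z \<in> vertical"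
    unfolding verdier_equisingular_W_def eventually_eventually by blast+
  then show "verdier_equisingular_X X W (perturbed_family f\<^sub>0 \<iota>) u\<^sub>0"
    unfolding verdier_equisingular_X_def w_regular_X_def by eventually_elim blast
qed

end

theorem corollary2p23:
  fixes F :: "'a::real_or_complex^('n::finite + 'k::finite) \<Rightarrow> 'a^'p::finite"
    and f\<^sub>0 :: "'a^'n \<Rightarrow> 'a^'k"
    and \<iota> :: "'c::finite \<Rightarrow> ('n \<Rightarrow> nat) \<times> 'k"
    and X W :: "('a^('n + 'k)) set"
    and u\<^sub>0 :: "'a^'c"
    and r :: nat
  assumes "analytic_near F 0" and "F 0 = 0"
    and "X = zero_locus F" and "W = regular_part F"
    and "smooth_submanifold_near W 0"
    and "\<forall>\<^sub>F z in nhds 0. z \<in> X - vertical \<longrightarrow> z \<in> closure W"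
    and "r > 0"
    and "analytic_near f\<^sub>0 0" and "f\<^sub>0 0 = 0"
    and "bij_betw \<iota> UNIV (degree_pairs r)"
  shows "(tr_W r W (perturbed_family f\<^sub>0 \<iota> u\<^sub>0) \<longleftrightarrow>
           verdier_equisingular_W W (perturbed_family f\<^sub>0 \<iota>) u\<^sub>0) \<and>
         (tr_X r X W (perturbed_family f\<^sub>0 \<iota> u\<^sub>0) \<longleftrightarrow>
           verdier_equisingular_X X W (perturbed_family f\<^sub>0 \<iota>) u\<^sub>0)"
proof -
  \<comment> \<open>0 lies on \<open>vertical\<close>, which W avoids, so 0 belongs to S = X - W.
    This is what makes the graph condition an equivalence with q = 0.\<close>
  have 0: "0 \<in> X" "0 \<notin> W" "W \<inter> vertical = {}"
    using assms(2,3,4) by (auto simp: zero_locus_def regular_part_def in_vertical_iff)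
  interpret jet_transversality \<iota> r f\<^sub>0 W u\<^sub>0
    by unfold_locales (use assms 0 in auto)
  have W: "tr_W r W f \<longleftrightarrow> verdier_equisingular_W W (perturbed_family f\<^sub>0 \<iota>) u\<^sub>0"
    unfolding verdier_equisingular_W_iff using w_regular_imp_transverse transverse_imp_w_regular by blast
  moreover have "tr_X r X W f \<longleftrightarrow> verdier_equisingular_X X W (perturbed_family f\<^sub>0 \<iota>) u\<^sub>0"
    unfolding tr_X_def verdier_equisingular_X_iff W using vertical_preimage_iff_graph[of "X - W"] 0 by blast
  ultimately show ?thesis by blast
qed

end
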